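(* Let $W(x,y)$ be a real polynomial in $x$ and $y$ of degree $N$, and let $W_N(x,y)$ be the homogeneous part of $W$ of degree $N$. Suppose that 1. $W(x,y)>0$ for all $(x,y)\in\mathbf{R}^2$; 2. $N\ge 4$; and 3. $W_N(x,y)$ is positive definite. Let $c$ be a real parameter. Then the system $$\frac{dx}{dt}=x(2x^2+2y^2+1)\bigl((x^2+y^2)^2+x^2-y^2-c\bigr)-y(2x^2+2y^2-1)W(x,y),$$ $$\frac{dy}{dt}=y(2x^2+2y^2-1)\bigl((x^2+y^2)^2+x^2-y^2-c\bigr)+x(2x^2+2y^2+1)W(x,y)$$ has the following qualitative features. For every $c$, its fixed points in the finite plane are exactly $(0,0)$ and $(0,\pm 1/\sqrt2)$, the origin is a saddle point, and there is an attracting limit cycle at infinity. Moreover: - if $c\le -1/4$, the points $(0,\pm1/\sqrt2)$ are two unstable spirals; - if $-1/4<c<0$, the points $(0,\pm1/\sqrt2)$ are two stable spirals, and there are two repelling limit cycles, one surrounding each of these two spirals; - if $c=0$, the points $(0,\pm1/\sqrt2)$ are two stable spirals, and there are two homoclinic orbits which branch from the saddle at the origin, one surrounding each of the two spirals; - if $c>0$, the points $(0,\pm1/\sqrt2)$ are two stable spirals, and there is one single repelling limit cycle, centered at the origin, which surrounds all three fixed points.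
   Context: $W_N$ positive definite means $W_N(x,y)>0$ for all $(x,y)\ne(0,0)$. A stable (unstable) spiral is a fixed point such that nearby trajectories spiral around it infinitely often while converging to it in forward (backward) time. A limit cycle is repelling if nearby trajectories approach it in backward time. Behavior at infinity (Poincaré sphere): the phase plane is tangent to a sphere and is mapped to it by central projection from the center, antipodal points being identified; points at infinity of the plane correspond to points of the equator. The system, of degree $m$ (the maximum of the degrees of the two right-hand sides), is extended to the equator with the standard (Poincaré compactification) time rescaling, under which the equator is invariant. Concretely, near the equator use coordinates $(s,\theta)$ with $s=1/r\ge 0$, so $x=\cos\theta/s$, $y=\sin\theta/s$, and new time $\tau$ with $dt=s^{m-1}d\tau$; the resulting vector field in $(s,\theta)$ extends smoothly to $s=0$ (the equator) with $ds/d\tau=0$ there. A fixed point at infinity is a zero of this extended field on $s=0$. There is a cycle at infinity if there are no fixed points at infinity (so that the equator is a closed orbit). It is an attracting limit cycle at infinity if all trajectories sufficiently near it approach it in forward time. *)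

theory Defs
  imports "HOL-Analysis.Analysis" "HOL-Computational_Algebra.Polynomial"
begin

section \<open>Real polynomials in two variables\<close>

text \<open>A polynomial in \<open>x\<close> and \<open>y\<close> is a polynomial in \<open>y\<close> whose coefficients are polynomials in \<open>x\<close>:
  the coefficient of \<open>x ^ i * y ^ j\<close> is \<open>coeff (coeff p j) i\<close>.\<close>

definition poly2 :: "real poly poly \<Rightarrow> real \<Rightarrow> real \<Rightarrow> real" where
  "poly2 p x y = poly (poly p [:y:]) x"

definition total_degree :: "real poly poly \<Rightarrow> nat" where
  "total_degree p = (LEAST n. \<forall>i j. coeff (coeff p j) i \<noteq> 0 \<longrightarrow> i + j \<le> n)"

definition hom_part :: "nat \<Rightarrow> real poly poly \<Rightarrow> real \<Rightarrow> real \<Rightarrow> real" where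
  "hom_part k p x y = (\<Sum>i\<le>k. coeff (coeff p (k - i)) i * x ^ i * y ^ (k - i))"

definition polX :: "real poly poly" where "polX = [:[:0, 1:]:]"

definition polY :: "real poly poly" where "polY = [:0, 1:]"

definition polC :: "real \<Rightarrow> real poly poly" where "polC a = [:[:a:]:]"

lemma poly2_simps [simp]:
  "poly2 polX x y = x" "poly2 polY x y = y" "poly2 (polC a) x y = a"
  "poly2 0 x y = 0" "poly2 1 x y = 1" "poly2 (numeral n) x y = numeral n"
  "poly2 (p + q) x y = poly2 p x y + poly2 q x y"
  "poly2 (p - q) x y = poly2 p x y - poly2 q x y"
  "poly2 (- p) x y = - poly2 p x y"
  "poly2 (p * q) x y = poly2 p x y * poly2 q x y"
  "poly2 (p ^ k) x y = poly2 p x y ^ k"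
  by (simp_all add: poly2_def polX_def polY_def polC_def)

lemma coeff_le_total_degree:
  assumes "coeff (coeff p j) i \<noteq> 0"
  shows "i + j \<le> total_degree p"
proof -
  let ?B = "degree p + (\<Sum>j\<le>degree p. degree (coeff p j))"
  have "\<forall>i j. coeff (coeff p j) i \<noteq> 0 \<longrightarrow> i + j \<le> ?B"
  proof (intro allI impI)
    fix i j assume nz: "coeff (coeff p j) i \<noteq> 0"
    then have "coeff p j \<noteq> 0" by auto
    then have j: "j \<le> degree p" by (rule le_degree)
    have "i \<le> degree (coeff p j)" using nz by (rule le_degree)
    also have "\<dots> \<le> (\<Sum>j\<le>degree p. degree (coeff p j))"
      using j by (intro member_le_sum) auto
    finally show "i + j \<le> ?B" using j by simp
  qed
  then have "\<forall>i j. coeff (coeff p j) i \<noteq> 0 \<longrightarrow> i + j \<le> total_degree p"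
    unfolding total_degree_def by (rule LeastI)
  with assms show ?thesis by blast
qed

lemma poly2_eq_sum_hom_part:
  assumes n: "total_degree p \<le> n"
  shows "poly2 p x y = (\<Sum>k\<le>n. hom_part k p x y)"
proof -
  define a where "a = (\<lambda>i j. coeff (coeff p j) i)"
  have a: "a i j = 0" if "i + j > n" for i j
    using coeff_le_total_degree[of p j i] that n unfolding a_def by force
  have cp: "coeff p j = 0" if "j > n" for j
    using a[of _ j] that unfolding a_def by (intro poly_eqI) auto
  have dp: "degree p \<le> n" using cp by (intro degree_le) auto
  have dc: "degree (coeff p j) \<le> n" for j
    using a[of _ j] unfolding a_def by (intro degree_le) auto
  have ev: "poly r z = (\<Sum>i\<le>n. coeff r i * z ^ i)"
    if "degree r \<le> n" for r :: "real poly" and z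
    unfolding poly_altdef using that
    by (intro sum.mono_neutral_left) (auto simp: coeff_eq_0)
  have ev2: "poly p z = (\<Sum>i\<le>n. coeff p i * z ^ i)" for z
    unfolding poly_altdef using dp
    by (intro sum.mono_neutral_left) (auto simp: coeff_eq_0)
  have "poly2 p x y = (\<Sum>j\<le>n. poly (coeff p j) x * y ^ j)"
    unfolding poly2_def ev2 by (simp add: poly_sum poly_power)
  also have "\<dots> = (\<Sum>j\<le>n. \<Sum>i\<le>n. a i j * x ^ i * y ^ j)"
    by (simp add: ev[OF dc] sum_distrib_right a_def)
  also have "\<dots> = (\<Sum>i\<le>n. \<Sum>j\<le>n. a i j * x ^ i * y ^ j)"
    by (rule sum.swap)
  also have "\<dots> = (\<Sum>(i,j)\<in>{..n}\<times>{..n}. a i j * x ^ i * y ^ j)"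
    by (simp add: sum.cartesian_product)
  also have "\<dots> = (\<Sum>(i,j)\<in>{(i,j). i + j \<le> n}. a i j * x ^ i * y ^ j)"
    by (rule sum.mono_neutral_right) (auto, metis a not_le)
  also have "\<dots> = (\<Sum>k\<le>n. hom_part k p x y)"
    by (simp add: sum.triangle_reindex_eq hom_part_def a_def)
  finally show ?thesis .
qed


section \<open>Autonomous systems in the plane\<close>

definition solves :: "(real \<times> real \<Rightarrow> real \<times> real) \<Rightarrow> (real \<Rightarrow> real \<times> real) \<Rightarrow> real set \<Rightarrow> bool" where
  "solves f \<gamma> J \<longleftrightarrow> (\<forall>t\<in>J. (\<gamma> has_vector_derivative f (\<gamma> t)) (at t within J))"

text \<open>The trajectory through \<open>q\<close> exists for all forward time and has the property \<open>R\<close>; this is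
  intended for locally Lipschitz fields, where that trajectory is unique. Backward time is
  obtained by passing to the field \<open>\<lambda>q. - f q\<close>.\<close>

definition forward_trajectory ::
  "(real \<times> real \<Rightarrow> real \<times> real) \<Rightarrow> real \<times> real \<Rightarrow> ((real \<Rightarrow> real \<times> real) \<Rightarrow> bool) \<Rightarrow> bool" where
  "forward_trajectory f q R \<longleftrightarrow>
     (\<exists>\<gamma>. solves f \<gamma> {0..} \<and> \<gamma> 0 = q) \<and>
     (\<forall>\<gamma>. solves f \<gamma> {0..} \<and> \<gamma> 0 = q \<longrightarrow> R \<gamma>)"

definition fixed_point :: "(real \<times> real \<Rightarrow> real \<times> real) \<Rightarrow> real \<times> real \<Rightarrow> bool" where
  "fixed_point f p \<longleftrightarrow> f p = 0"

definition saddle_point :: "(real \<times> real \<Rightarrow> real \<times> real) \<Rightarrow> real \<times> real \<Rightarrow> bool" where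
  "saddle_point f p \<longleftrightarrow> fixed_point f p \<and>
     (\<exists>A a b u v. (f has_derivative A) (at p) \<and> a < 0 \<and> 0 < b \<and>
        u \<noteq> 0 \<and> v \<noteq> 0 \<and> A u = a *\<^sub>R u \<and> A v = b *\<^sub>R v)"

text \<open>A continuous polar angle \<open>\<phi>\<close> about \<open>p\<close> tends to plus or minus infinity.\<close>

definition spirals_around :: "(real \<Rightarrow> real \<times> real) \<Rightarrow> real \<times> real \<Rightarrow> bool" where
  "spirals_around \<gamma> p \<longleftrightarrow>
     (\<exists>\<phi>. continuous_on {0..} \<phi> \<and>
        (\<forall>t\<ge>0. \<gamma> t \<noteq> p \<and> \<gamma> t - p = norm (\<gamma> t - p) *\<^sub>R (cos (\<phi> t), sin (\<phi> t))) \<and>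
        filterlim \<phi> at_infinity at_top)"

definition stable_spiral :: "(real \<times> real \<Rightarrow> real \<times> real) \<Rightarrow> real \<times> real \<Rightarrow> bool" where
  "stable_spiral f p \<longleftrightarrow> fixed_point f p \<and>
     (\<exists>\<delta>>0. \<forall>q. 0 < dist q p \<and> dist q p < \<delta> \<longrightarrow>
        forward_trajectory f q (\<lambda>\<gamma>. (\<gamma> \<longlongrightarrow> p) at_top \<and> spirals_around \<gamma> p))"

definition unstable_spiral :: "(real \<times> real \<Rightarrow> real \<times> real) \<Rightarrow> real \<times> real \<Rightarrow> bool" where
  "unstable_spiral f p \<longleftrightarrow> stable_spiral (\<lambda>q. - f q) p"

definition closed_orbit :: "(real \<times> real \<Rightarrow> real \<times> real) \<Rightarrow> (real \<times> real) set \<Rightarrow> bool" where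
  "closed_orbit f C \<longleftrightarrow>
     (\<exists>\<gamma> T. solves f \<gamma> UNIV \<and> T > 0 \<and> (\<forall>t. \<gamma> (t + T) = \<gamma> t) \<and>
        (\<exists>t. \<gamma> t \<noteq> \<gamma> 0) \<and> C = range \<gamma>)"

definition limit_cycle :: "(real \<times> real \<Rightarrow> real \<times> real) \<Rightarrow> (real \<times> real) set \<Rightarrow> bool" where
  "limit_cycle f C \<longleftrightarrow> closed_orbit f C \<and>
     (\<exists>U. open U \<and> C \<subseteq> U \<and> (\<forall>C'. closed_orbit f C' \<and> C' \<inter> U \<noteq> {} \<longrightarrow> C' = C))"

definition attracts_nearby :: "(real \<times> real \<Rightarrow> real \<times> real) \<Rightarrow> (real \<times> real) set \<Rightarrow> bool" where
  "attracts_nearby f C \<longleftrightarrow>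
     (\<exists>U. open U \<and> C \<subseteq> U \<and>
        (\<forall>q\<in>U. forward_trajectory f q (\<lambda>\<gamma>. ((\<lambda>t. infdist (\<gamma> t) C) \<longlongrightarrow> 0) at_top)))"

definition repelling_limit_cycle :: "(real \<times> real \<Rightarrow> real \<times> real) \<Rightarrow> (real \<times> real) set \<Rightarrow> bool" where
  "repelling_limit_cycle f C \<longleftrightarrow> limit_cycle f C \<and> attracts_nearby (\<lambda>q. - f q) C"

definition homoclinic_orbit ::
  "(real \<times> real \<Rightarrow> real \<times> real) \<Rightarrow> real \<times> real \<Rightarrow> (real \<times> real) set \<Rightarrow> bool" where
  "homoclinic_orbit f p \<Gamma> \<longleftrightarrow> fixed_point f p \<and>
     (\<exists>\<gamma>. solves f \<gamma> UNIV \<and> (\<forall>t. \<gamma> t \<noteq> p) \<and>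
        (\<gamma> \<longlongrightarrow> p) at_top \<and> (\<gamma> \<longlongrightarrow> p) at_bot \<and> \<Gamma> = range \<gamma>)"


section \<open>Polynomial systems and their behaviour at infinity\<close>

definition poly_field :: "real poly poly \<Rightarrow> real poly poly \<Rightarrow> real \<times> real \<Rightarrow> real \<times> real" where
  "poly_field P Q = (\<lambda>(x, y). (poly2 P x y, poly2 Q x y))"

definition system_degree :: "real poly poly \<Rightarrow> real poly poly \<Rightarrow> nat" where
  "system_degree P Q = max (total_degree P) (total_degree Q)"

text \<open>The smooth extension to \<open>s = 0\<close> of \<open>s ^ m * R (cos \<theta> / s, sin \<theta> / s)\<close>,
  see \<open>poly_at_infinity_eq\<close> below.\<close>

definition poly_at_infinity :: "nat \<Rightarrow> real poly poly \<Rightarrow> real \<Rightarrow> real \<Rightarrow> real" where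
  "poly_at_infinity m R s \<theta> = (\<Sum>k\<le>m. s ^ (m - k) * hom_part k R (cos \<theta>) (sin \<theta>))"

text \<open>The system in the coordinates \<open>(s, \<theta>)\<close> with \<open>x = cos \<theta> / s\<close>, \<open>y = sin \<theta> / s\<close> and in the
  time \<open>\<tau>\<close> with \<open>dt = s ^ (m - 1) d\<tau>\<close>, see \<open>field_at_infinity_related\<close> below; the equator
  is \<open>s = 0\<close>.\<close>

definition field_at_infinity :: "real poly poly \<Rightarrow> real poly poly \<Rightarrow> real \<times> real \<Rightarrow> real \<times> real" where
  "field_at_infinity P Q = (\<lambda>(s, \<theta>).
     let m = system_degree P Q; p = poly_at_infinity m P s \<theta>; q = poly_at_infinity m Q s \<theta>
     in (- s * (cos \<theta> * p + sin \<theta> * q), cos \<theta> * q - sin \<theta> * p))"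

definition cycle_at_infinity :: "real poly poly \<Rightarrow> real poly poly \<Rightarrow> bool" where
  "cycle_at_infinity P Q \<longleftrightarrow> \<not> (\<exists>\<theta>. fixed_point (field_at_infinity P Q) (0, \<theta>))"

definition attracting_limit_cycle_at_infinity :: "real poly poly \<Rightarrow> real poly poly \<Rightarrow> bool" where
  "attracting_limit_cycle_at_infinity P Q \<longleftrightarrow> cycle_at_infinity P Q \<and>
     (\<exists>\<delta>>0. \<forall>s \<theta>. 0 < s \<and> s < \<delta> \<longrightarrow>
        forward_trajectory (field_at_infinity P Q) (s, \<theta>)
          (\<lambda>\<gamma>. (\<forall>\<tau>\<ge>0. fst (\<gamma> \<tau>) > 0) \<and> ((\<lambda>\<tau>. fst (\<gamma> \<tau>)) \<longlongrightarrow> 0) at_top))"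

lemma poly_at_infinity_eq:
  assumes "s \<noteq> 0" "total_degree R \<le> m"
  shows "poly_at_infinity m R s \<theta> = s ^ m * poly2 R (cos \<theta> / s) (sin \<theta> / s)"
proof -
  have h: "hom_part k R (u / s) (v / s) = hom_part k R u v / s ^ k" for k u v
    unfolding hom_part_def sum_divide_distrib
  proof (rule sum.cong)
    fix i assume "i \<in> {..k}"
    then have "s ^ k = s ^ i * s ^ (k - i)" by (simp flip: power_add)
    then show "coeff (coeff R (k - i)) i * (u / s) ^ i * (v / s) ^ (k - i) =
        coeff (coeff R (k - i)) i * u ^ i * v ^ (k - i) / s ^ k"
      by (simp add: power_divide)
  qed simp
  show ?thesis
    unfolding poly_at_infinity_def poly2_eq_sum_hom_part[OF assms(2)] sum_distrib_left h
    using assms(1) by (intro sum.cong) (auto simp: power_diff)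
qed

lemma field_at_infinity_related:
  assumes "s > 0" "system_degree P Q > 0" "field_at_infinity P Q (s, \<theta>) = (s', \<theta>')"
  defines "\<Phi> \<equiv> \<lambda>(s, \<theta>). (cos \<theta> / s, sin \<theta> / s)"
  shows "(\<Phi> has_derivative
            (\<lambda>(a, b). (- cos \<theta> / s\<^sup>2 * a - sin \<theta> / s * b, - sin \<theta> / s\<^sup>2 * a + cos \<theta> / s * b)))
           (at (s, \<theta>))"
    and "(- cos \<theta> / s\<^sup>2 * s' - sin \<theta> / s * \<theta>', - sin \<theta> / s\<^sup>2 * s' + cos \<theta> / s * \<theta>') =
          s ^ (system_degree P Q - 1) *\<^sub>R poly_field P Q (\<Phi> (s, \<theta>))"
proof -
  show "(\<Phi> has_derivative
            (\<lambda>(a, b). (- cos \<theta> / s\<^sup>2 * a - sin \<theta> / s * b, - sin \<theta> / s\<^sup>2 * a + cos \<theta> / s * b)))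
           (at (s, \<theta>))"
    unfolding \<Phi>_def case_prod_beta using assms(1)
    by (auto intro!: derivative_eq_intros simp: fun_eq_iff power2_eq_square field_simps)
  define m where "m = system_degree P Q"
  define p where "p = poly2 P (cos \<theta> / s) (sin \<theta> / s)"
  define q where "q = poly2 Q (cos \<theta> / s) (sin \<theta> / s)"
  define k where "k = m - 1"
  have m: "s ^ m = s * s ^ k" using assms(2) by (cases m) (auto simp: m_def k_def)
  have s': "s' = - s * (cos \<theta> * (s ^ m * p) + sin \<theta> * (s ^ m * q))"
    and t': "\<theta>' = cos \<theta> * (s ^ m * q) - sin \<theta> * (s ^ m * p)"
    using assms(1,3) unfolding field_at_infinity_def Let_def
    by (auto simp: poly_at_infinity_eq system_degree_def m_def p_def q_def)
  have *: "- a / s\<^sup>2 * (- s * (a * (s ^ m * p) + b * (s ^ m * q))) - b / s * (a * (s ^ m * q) - b * (s ^ m * p)) =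
        s ^ k * p * (a\<^sup>2 + b\<^sup>2)" for a b p q
    unfolding m using assms(1) by (simp add: field_simps power2_eq_square)
  have 1: "- cos \<theta> / s\<^sup>2 * s' - sin \<theta> / s * \<theta>' = s ^ k * p * ((cos \<theta>)\<^sup>2 + (sin \<theta>)\<^sup>2)"
    unfolding s' t' by (rule *)
  have 2: "- sin \<theta> / s\<^sup>2 * s' + cos \<theta> / s * \<theta>' = s ^ k * q * ((cos \<theta>)\<^sup>2 + (sin \<theta>)\<^sup>2)"
    unfolding s' t' using *[of "sin \<theta>" q "cos \<theta>" p] by (simp add: algebra_simps)
  show "(- cos \<theta> / s\<^sup>2 * s' - sin \<theta> / s * \<theta>', - sin \<theta> / s\<^sup>2 * s' + cos \<theta> / s * \<theta>') =
          s ^ (system_degree P Q - 1) *\<^sub>R poly_field P Q (\<Phi> (s, \<theta>))"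
    unfolding 1 2 by (simp add: \<Phi>_def poly_field_def p_def q_def k_def m_def)
qed


section \<open>The system\<close>

definition sysP :: "real poly poly \<Rightarrow> real \<Rightarrow> real poly poly" where
  "sysP W c =
     polX * (2 * polX ^ 2 + 2 * polY ^ 2 + 1) * ((polX ^ 2 + polY ^ 2) ^ 2 + polX ^ 2 - polY ^ 2 - polC c)
     - polY * (2 * polX ^ 2 + 2 * polY ^ 2 - 1) * W"

definition sysQ :: "real poly poly \<Rightarrow> real \<Rightarrow> real poly poly" where
  "sysQ W c =
     polY * (2 * polX ^ 2 + 2 * polY ^ 2 - 1) * ((polX ^ 2 + polY ^ 2) ^ 2 + polX ^ 2 - polY ^ 2 - polC c)
     + polX * (2 * polX ^ 2 + 2 * polY ^ 2 + 1) * W"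

lemma poly_field_sys:
  "poly_field (sysP W c) (sysQ W c) (x, y) =
     (x * (2 * x\<^sup>2 + 2 * y\<^sup>2 + 1) * ((x\<^sup>2 + y\<^sup>2)\<^sup>2 + x\<^sup>2 - y\<^sup>2 - c) - y * (2 * x\<^sup>2 + 2 * y\<^sup>2 - 1) * poly2 W x y,
      y * (2 * x\<^sup>2 + 2 * y\<^sup>2 - 1) * ((x\<^sup>2 + y\<^sup>2)\<^sup>2 + x\<^sup>2 - y\<^sup>2 - c) + x * (2 * x\<^sup>2 + 2 * y\<^sup>2 + 1) * poly2 W x y)"
  by (simp add: poly_field_def sysP_def sysQ_def)

end

theory Submission
  imports Defs
begin

text \<open>
  Write \<open>z = x + \<i> * y\<close> and \<open>\<zeta> = z^2 + 1/2\<close>. This \<open>\<zeta>\<close> is the product of the displacements of \<open>z\<close> from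
  the two points \<open>\<plusminus> \<i> / sqrt 2\<close>, so the level curves of \<open>R = cmod \<zeta> ^ 2\<close> are Cassini ovals with these
  points as foci. Since \<open>(x^2 + y^2)^2 + x^2 - y^2 = R - 1/4\<close>, the system with \<open>k = c + 1/4\<close> reads
  \<open>z' = 2 * \<zeta> * cnj z * (R - k + \<i> * W)\<close>, and therefore
  \<open>\<zeta>' = 4 * cmod z ^ 2 * \<zeta> * (R - k + \<i> * W)\<close>.
  Modulus and argument of \<open>\<zeta>\<close> separate: \<open>R' = 8 * cmod z ^ 2 * R * (R - k)\<close>, while the argument grows at
  the positive rate \<open>4 * cmod z ^ 2 * W\<close>. In the \<open>\<zeta>\<close>-plane this is a rotation around \<open>0\<close> with an unstable
  circle \<open>R = k\<close> if \<open>k > 0\<close>. The phase portrait in the \<open>z\<close>-plane is its lift along \<open>z \<mapsto> z^2 + 1/2\<close>, whose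
  only branch point \<open>\<zeta> = 1/2\<close> lies under the saddle \<open>z = 0\<close> (\<open>focal_derivative\<close>, \<open>cassini_derivative\<close>).

  At the foci \<open>\<zeta> = 0\<close>, and \<open>\<zeta>\<close> winds around \<open>0\<close> forever while \<open>R\<close> tends to \<open>0\<close>, in forward time if
  \<open>k > 0\<close> and in backward time if \<open>k \<le> 0\<close> (\<open>spiral_at_focus\<close>). Along every trajectory \<open>(R - k)^2\<close> is
  nondecreasing, so closed orbits, and orbits homoclinic to the saddle in the case \<open>k = 1/4\<close>, lie on
  \<open>R = k\<close>. The circle \<open>cmod \<zeta> = sqrt k\<close> does not reach the branch point if \<open>0 < k < 1/4\<close> and lifts to
  two ovals; it passes through the branch point if \<open>k = 1/4\<close> and lifts to the two lobes of a
  lemniscate; it encloses the branch point if \<open>k > 1/4\<close> and lifts to a single curve that covers it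
  twice. Explicit square roots parametrize these lifts, and as the velocity of the curve is a positive
  multiple of the field, a change of time turns them into orbits (\<open>parametrization_derivative\<close>,
  \<open>orbit_of_parametrization\<close>). In backward time \<open>R\<close> tends to \<open>k\<close> nearby, so the closed ones are
  repelling (\<open>attracts_nearby_level\<close>).

  For large \<open>R\<close> the equation for \<open>R\<close> pushes trajectories outwards. Near the equator \<open>1 / R\<close> is comparable
  with \<open>s^4\<close>, and it decreases to \<open>0\<close> in the rescaled time, although \<open>s\<close> itself need not be monotone
  (\<open>inverse_cassini_derivative\<close>, \<open>attracting_at_infinity\<close>). On the equator the angular speed is twice the
  leading part of \<open>W\<close>, hence positive (\<open>angular_speed_at_infinity\<close>); this also fixes the degree of the
  system as \<open>N + 3\<close>.

  Trajectories exist by a Picard iteration for globally Lipschitz fields, applied after composing the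
  field with the projection to a closed convex set that traps the trajectory (\<open>forward_trajectoryI\<close>).
  Uniqueness serves to count the closed and homoclinic orbits (\<open>range_eq_of_common_point\<close>).
\<close>

section \<open>Scalar and linear differential equations\<close>

lemma nondecreasing_of_derivative:
  fixes u :: "real \<Rightarrow> real"
  assumes ab: "a \<le> b" "{a..b} \<subseteq> J"
    and d: "\<And>t. t \<in> J \<Longrightarrow> (u has_real_derivative u' t) (at t within J)"
    and nn: "\<And>t. t \<in> J \<Longrightarrow> 0 \<le> u' t"
  shows "u a \<le> u b"
proof (rule DERIV_nonneg_imp_increasing_open[OF ab(1)])
  have d': "(u has_real_derivative u' t) (at t within {a..b})" if "t \<in> {a..b}" for t
    using d[of t] that ab(2) by (meson has_field_derivative_subset subsetD)
  show "continuous_on {a..b} u"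
    using d' by (rule DERIV_continuous_on)
  fix t assume t: "a < t" "t < b"
  then have "at t within {a..b} = at t" by (intro at_within_interior) auto
  moreover have "t \<in> J" using t ab by auto
  ultimately show "\<exists>y. DERIV u t :> y \<and> y \<ge> 0" using d'[of t] t nn[of t] by auto
qed

lemma nonincreasing_of_derivative:
  fixes u :: "real \<Rightarrow> real"
  assumes ab: "a \<le> b" "{a..b} \<subseteq> J"
    and d: "\<And>t. t \<in> J \<Longrightarrow> (u has_real_derivative u' t) (at t within J)"
    and nn: "\<And>t. t \<in> J \<Longrightarrow> u' t \<le> 0"
  shows "u b \<le> u a"
  using nondecreasing_of_derivative[OF ab, of "\<lambda>t. - u t" "\<lambda>t. - u' t"] d nn
  by (auto intro!: derivative_eq_intros)

text \<open>The derivative is required to stay away from \<open>0\<close> only as long as \<open>u\<close> itself does. This covers decay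
  that is not exponential, such as \<open>u' = - u^2\<close> at a weak focus.\<close>

lemma tendsto_0_of_negative_derivative:
  fixes u :: "real \<Rightarrow> real"
  assumes d: "\<And>t. t \<ge> 0 \<Longrightarrow> (u has_real_derivative u' t) (at t within {0..})"
    and pos: "\<And>t. t \<ge> 0 \<Longrightarrow> u t \<ge> 0"
    and np: "\<And>t. t \<ge> 0 \<Longrightarrow> u' t \<le> 0"
    and dec: "\<And>e. e > 0 \<Longrightarrow> \<exists>m>0. \<forall>t\<ge>0. u t \<ge> e \<longrightarrow> u' t \<le> - m"
  shows "(u \<longlongrightarrow> 0) at_top"
proof (rule tendstoI)
  fix e :: real assume e: "e > 0"
  then obtain m where m: "m > 0" "\<And>t. t \<ge> 0 \<Longrightarrow> u t \<ge> e \<Longrightarrow> u' t \<le> - m" using dec by blast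
  have mono: "u b \<le> u a" if "0 \<le> a" "a \<le> b" for a b
    using d np that by (intro nonincreasing_of_derivative[of a b "{0..}" u u']) auto
  have "\<exists>t0\<ge>0. u t0 < e"
  proof (rule ccontr)
    assume "\<not> ?thesis"
    then have ge: "u t \<ge> e" if "t \<ge> 0" for t using that by force
    have "u T + m * T \<le> u 0 + m * 0" if "T \<ge> 0" for T
    proof (rule nonincreasing_of_derivative[of 0 T "{0..}" "\<lambda>t. u t + m * t" "\<lambda>t. u' t + m"])
      show "((\<lambda>t. u t + m * t) has_real_derivative u' t + m) (at t within {0..})" if "t \<in> {0..}" for t
        using d[of t] that by (auto intro!: derivative_eq_intros)
    qed (use that m(2) ge in force)+
    moreover have T: "(u 0 + 1) / m \<ge> 0" using pos[of 0] m(1) by simp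
    ultimately have "u ((u 0 + 1) / m) + m * ((u 0 + 1) / m) \<le> u 0 + m * 0" by blast
    moreover have "m * ((u 0 + 1) / m) = u 0 + 1" using m(1) by simp
    ultimately show False using pos[OF T] by simp
  qed
  then obtain t0 where "t0 \<ge> 0" "u t0 < e" by blast
  then have "dist (u t) 0 < e" if "t \<ge> t0" for t
    using mono[of t0 t] pos[of t] that by auto
  then show "\<forall>\<^sub>F t in at_top. dist (u t) 0 < e"
    unfolding eventually_at_top_linorder by blast
qed

text \<open>Composition with the projection to \<open>J\<close> extends the integrand continuously to the whole line, so
  compact intervals and half-lines need no separate treatment.\<close>

lemma antiderivative_on_closed_interval:
  fixes h :: "real \<Rightarrow> 'a :: euclidean_space"
  assumes J: "closed J" "convex J" "J \<noteq> {}" and h: "continuous_on J h"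
  shows "\<exists>A. \<forall>t\<in>J. (A has_vector_derivative h t) (at t within J)"
proof -
  define g where "g = (\<lambda>t. h (closest_point J t))"
  have "continuous_on UNIV g"
    unfolding g_def using J h
    by (intro continuous_on_compose2[OF h] continuous_on_closest_point)
       (auto intro: closest_point_in_set)
  then have "isCont g x" for x by (simp add: continuous_on_eq_continuous_at)
  then obtain A where A: "\<And>x. (A has_vector_derivative g x) (at x)"
    using einterval_antiderivative[of "-\<infinity>" "\<infinity>" g] by auto
  then have "\<forall>t\<in>J. (A has_vector_derivative h t) (at t within J)"
    by (metis closest_point_self g_def has_vector_derivative_at_within)
  then show ?thesis by blast
qed

text \<open>The exponential shows two things at once: \<open>w\<close> never vanishes if \<open>w 0\<close> does not, and the imaginary part
  of \<open>A\<close> is a continuous choice of its argument.\<close>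

lemma linear_ode_solution:
  fixes w h :: "real \<Rightarrow> complex"
  assumes J: "closed J" "convex J" "0 \<in> J" and h: "continuous_on J h"
    and w: "\<And>t. t \<in> J \<Longrightarrow> (w has_vector_derivative h t * w t) (at t within J)"
  shows "\<exists>A. (\<forall>t\<in>J. (A has_vector_derivative h t) (at t within J)) \<and> (\<forall>t\<in>J. w t = w 0 * exp (A t))"
proof -
  obtain B where B: "\<And>t. t \<in> J \<Longrightarrow> (B has_vector_derivative h t) (at t within J)"
    using antiderivative_on_closed_interval[OF J(1,2) _ h] J(3) by blast
  define A where "A = (\<lambda>t. B t - B 0)"
  have A: "(A has_vector_derivative h t) (at t within J)" if "t \<in> J" for t
    unfolding A_def using B[OF that] by (auto intro!: derivative_eq_intros)
  have E: "((\<lambda>t. exp (- A t)) has_vector_derivative - h t * exp (- A t)) (at t within J)" if "t \<in> J" for t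
  proof -
    have "((\<lambda>t. - A t) has_vector_derivative - h t) (at t within J)"
      using A[OF that] by (auto intro!: derivative_eq_intros)
    from field_vector_diff_chain_within[OF this, of exp "exp (- A t)"]
    show ?thesis by (auto simp: o_def DERIV_exp has_field_derivative_at_within mult.commute)
  qed
  have "((\<lambda>t. w t * exp (- A t)) has_vector_derivative 0) (at t within J)" if "t \<in> J" for t
    using has_vector_derivative_mult[OF w[OF that] E[OF that]] by (simp add: algebra_simps)
  then obtain c where c: "\<And>t. t \<in> J \<Longrightarrow> w t * exp (- A t) = c"
    using has_vector_derivative_zero_constant[OF J(2), of "\<lambda>t. w t * exp (- A t)"] by blast
  have "w t = w 0 * exp (A t)" if "t \<in> J" for t
  proof -
    have "w t * exp (- A t) = w 0" using c[OF that] c[OF J(3)] by (simp add: A_def)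
    then have "w t * (exp (- A t) * exp (A t)) = w 0 * exp (A t)" by (simp add: mult.assoc[symmetric])
    then show ?thesis by (simp flip: exp_add)
  qed
  with A show ?thesis by blast
qed

section \<open>Existence of trajectories\<close>

lemma integral_has_vector_derivative_half_line:
  fixes g :: "real \<Rightarrow> 'a :: banach"
  assumes g: "continuous_on {0..} g" and t: "t \<ge> 0"
  shows "((\<lambda>u. integral {0..u} g) has_vector_derivative g t) (at t within {0..})"
proof -
  have "((\<lambda>u. integral {0..u} g) has_vector_derivative g t) (at t within {0..t + 1})"
    using t by (intro integral_has_vector_derivative continuous_on_subset[OF g]) auto
  moreover have "at t within {0..t + 1} = at t within {0..}"
    by (rule at_within_nhd[of _ "{..<t + 1}"]) auto
  ultimately show ?thesis by simp
qed

text \<open>With the weight \<open>exp (- a * t)\<close>, integration has norm at most \<open>1 / a\<close> on the whole half-line; this is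
  what makes the Picard operator a contraction there.\<close>

lemma norm_integral_le_exp:
  fixes h :: "real \<Rightarrow> 'a :: euclidean_space"
  assumes h: "continuous_on {0..} h" and a: "a > 0" and t: "t \<ge> 0" and C: "C \<ge> 0"
    and le: "\<And>s. s \<ge> 0 \<Longrightarrow> norm (h s) \<le> C * exp (a * s)"
  shows "exp (- a * t) * norm (integral {0..t} h) \<le> C / a"
proof -
  have I: "((\<lambda>s. C * exp (a * s)) has_integral (C / a * exp (a * t) - C / a * exp (a * 0))) {0..t}"
    using t a
    by (intro fundamental_theorem_of_calculus)
       (auto intro!: derivative_eq_intros simp flip: has_real_derivative_iff_has_vector_derivative)
  have "norm (integral {0..t} h) \<le> integral {0..t} (\<lambda>s. C * exp (a * s))"
  proof (rule integral_norm_bound_integral)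
    show "h integrable_on {0..t}"
      by (rule integrable_continuous_real, rule continuous_on_subset[OF h]) auto
    show "(\<lambda>s. C * exp (a * s)) integrable_on {0..t}" using I by blast
  qed (use le in auto)
  also have "\<dots> = C / a * exp (a * t) - C / a" using integral_unique[OF I] by simp
  also have "\<dots> \<le> C / a * exp (a * t)" using a C by simp
  finally have "exp (- a * t) * norm (integral {0..t} h) \<le> exp (- a * t) * (C / a * exp (a * t))"
    by (intro mult_left_mono) auto
  also have "\<dots> = C / a" by (simp add: exp_minus)
  finally show ?thesis .
qed

text \<open>Picard's theorem in one step: for \<open>\<gamma> t = q + exp (a * t) * u t\<close> the integral equation becomes a
  fixed-point equation for a bounded continuous \<open>u\<close>, and for \<open>a > L\<close> the operator contracts the supremum
  norm by the factor \<open>L / a\<close>.\<close>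

lemma global_solution_of_lipschitz:
  fixes f :: "real \<times> real \<Rightarrow> real \<times> real"
  assumes f: "L-lipschitz_on UNIV f"
  obtains \<gamma> where "solves f \<gamma> {0..}" "\<gamma> 0 = q"
proof -
  have L: "L \<ge> 0" using f by (rule lipschitz_on_nonneg)
  define a where "a = L + 1"
  have a: "a > 0" "L / a < 1" "L / a \<ge> 0" using L by (auto simp: a_def)
  have fc: "continuous_on S f" for S
    using lipschitz_on_continuous_on[OF f] by (rule continuous_on_subset) auto
  \<comment> \<open>\<open>h u\<close> is the integrand and \<open>K u\<close> the new iterate; \<open>max 0 t\<close> extends it to negative times by a constant.\<close>
  define h where "h = (\<lambda>u s. f (q + exp (a * s) *\<^sub>R apply_bcontfun u s))"
  have hc: "continuous_on S (h u)" for u S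
    unfolding h_def
    by (intro continuous_on_compose2[OF fc[of UNIV]] continuous_intros) auto
  define K where "K = (\<lambda>u t. exp (- a * max 0 t) *\<^sub>R integral {0..max 0 t} (h u))"
  have Kc: "continuous_on UNIV (K u)" for u
  proof -
    have "continuous_on {0..} (\<lambda>t. integral {0..t} (h u))"
      using integral_has_vector_derivative_half_line[OF hc]
      by (intro continuous_on_vector_derivative) auto
    then have "continuous_on UNIV (\<lambda>t. integral {0..max 0 t} (h u))"
      by (rule continuous_on_compose2[where f = "\<lambda>t::real. max 0 t"]) (auto intro!: continuous_intros)
    moreover have "continuous_on UNIV (\<lambda>t::real. exp (- a * max 0 t))"
      by (intro continuous_intros)
    ultimately show ?thesis unfolding K_def by (intro continuous_on_scaleR)
  qed
  have Kd: "norm (K u t - K v t) \<le> L / a * dist u v" for u v t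
  proof -
    have "K u t - K v t = exp (- a * max 0 t) *\<^sub>R integral {0..max 0 t} (\<lambda>s. h u s - h v s)"
      unfolding K_def
      by (subst integral_diff) (auto intro!: integrable_continuous_real hc simp: scaleR_diff_right)
    then have "norm (K u t - K v t)
        = exp (- a * max 0 t) * norm (integral {0..max 0 t} (\<lambda>s. h u s - h v s))" by simp
    also have "\<dots> \<le> (L * dist u v) / a"
    proof (rule norm_integral_le_exp)
      fix s :: real assume "s \<ge> 0"
      have "norm (h u s - h v s) \<le> L * dist (q + exp (a * s) *\<^sub>R apply_bcontfun u s) (q + exp (a * s) *\<^sub>R apply_bcontfun v s)"
        unfolding h_def dist_norm[symmetric] using f by (rule lipschitz_onD) auto
      also have "\<dots> = L * (exp (a * s) * dist (apply_bcontfun u s) (apply_bcontfun v s))"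
        by (simp add: dist_norm flip: scaleR_diff_right)
      also have "\<dots> \<le> L * (exp (a * s) * dist u v)"
        using L by (intro mult_left_mono dist_bounded) auto
      finally show "norm (h u s - h v s) \<le> L * dist u v * exp (a * s)" by (simp add: mult_ac)
    qed (use a L hc in \<open>auto intro!: continuous_intros\<close>)
    finally show ?thesis by simp
  qed
  have K0: "norm (K 0 t) \<le> norm (f q) / a" for t
  proof -
    have "norm (K 0 t) = exp (- a * max 0 t) * norm (integral {0..max 0 t} (h 0))"
      by (simp add: K_def)
    also have "\<dots> \<le> norm (f q) / a"
    proof (rule norm_integral_le_exp)
      fix s :: real assume "s \<ge> 0"
      then have "exp (a * s) \<ge> 1" using a by simp
      from mult_left_mono[OF this, of "norm (f q)"]
      show "norm (h 0 s) \<le> norm (f q) * exp (a * s)" by (simp add: h_def)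
    qed (use a hc in auto)
    finally show ?thesis .
  qed
  have Kb: "K u \<in> bcontfun" for u
  proof (rule bcontfun_normI[OF Kc])
    fix t show "norm (K u t) \<le> norm (f q) / a + L / a * dist u 0"
      using norm_triangle_sub[of "K u t" "K 0 t"] Kd[of u t 0] K0[of t] by linarith
  qed
  define \<Phi> where "\<Phi> = (\<lambda>u. Bcontfun (K u))"
  have \<Phi>: "apply_bcontfun (\<Phi> u) = K u" for u
    unfolding \<Phi>_def using Kb by (rule Bcontfun_inverse)
  have "\<exists>!u. \<Phi> u = u"
    by (rule banach_fix_type[OF a(3,2)]) (use Kd in \<open>auto intro!: dist_bound simp: \<Phi> dist_norm[of "K _ _"]\<close>)
  then obtain u where u: "\<Phi> u = u" by blast
  define \<gamma> where "\<gamma> = (\<lambda>t. q + exp (a * t) *\<^sub>R apply_bcontfun u t)"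
  have \<gamma>: "\<gamma> t = q + integral {0..t} (\<lambda>s. f (\<gamma> s))" if "t \<ge> 0" for t
  proof -
    have "apply_bcontfun u t = exp (- (a * t)) *\<^sub>R integral {0..t} (h u)"
      using \<Phi>[of u] u that by (simp add: K_def)
    then have "\<gamma> t = q + integral {0..t} (h u)" by (simp add: \<gamma>_def flip: exp_add)
    then show ?thesis by (simp add: h_def \<gamma>_def)
  qed
  have c: "continuous_on {0..} (\<lambda>s. f (\<gamma> s))" using hc[of "{0..}" u] by (simp add: h_def \<gamma>_def)
  have "solves f \<gamma> {0..}"
    unfolding solves_def
  proof
    fix t :: real assume t: "t \<in> {0..}"
    have "((\<lambda>t. q + integral {0..t} (\<lambda>s. f (\<gamma> s))) has_vector_derivative f (\<gamma> t)) (at t within {0..})"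
      using integral_has_vector_derivative_half_line[OF c, of t] t
      by (auto intro!: derivative_eq_intros)
    then show "(\<gamma> has_vector_derivative f (\<gamma> t)) (at t within {0..})"
      by (rule has_vector_derivative_transform[rotated 2]) (use t \<gamma> in auto)
  qed
  moreover have "\<gamma> 0 = q" using \<gamma>[of 0] by simp
  ultimately show ?thesis by (rule that)
qed

text \<open>At the first time at which the curve could leave \<open>K\<close>, it is still in \<open>K\<close> because \<open>K\<close> is closed, hence in
  the interior by \<open>step\<close>, and so it remains in \<open>K\<close> for a little longer.\<close>

lemma stays_inside:
  fixes \<gamma> :: "real \<Rightarrow> 'a :: metric_space"
  assumes c: "continuous_on {0..} \<gamma>" and K: "closed K" and 0: "\<gamma> 0 \<in> interior K"
    and step: "\<And>T. T > 0 \<Longrightarrow> (\<And>t. t \<in> {0..T} \<Longrightarrow> \<gamma> t \<in> K) \<Longrightarrow> \<gamma> T \<in> interior K"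
    and t: "t \<ge> 0"
  shows "\<gamma> t \<in> K"
proof (rule ccontr)
  assume t': "\<gamma> t \<notin> K"
  define S where "S = {s. s \<ge> 0 \<and> \<gamma> s \<notin> K}"
  have S: "S \<noteq> {}" "bdd_below S" using t t' by (auto simp: S_def intro!: bdd_belowI[of _ 0])
  define T where "T = Inf S"
  have T0: "T \<ge> 0" unfolding T_def using S by (intro cInf_greatest) (auto simp: S_def)
  have before: "\<gamma> s \<in> K" if "0 \<le> s" "s < T" for s
    using cInf_lower[OF _ S(2), of s] that unfolding T_def S_def by force
  have int: "\<gamma> T \<in> interior K"
  proof (cases "T = 0")
    case False
    with T0 have T: "T > 0" by simp
    have cl: "closed ({0..T} \<inter> \<gamma> -` K)"
      using K by (intro continuous_closed_preimage continuous_on_subset[OF c]) auto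
    have "{0..<T} \<subseteq> {0..T} \<inter> \<gamma> -` K" using before by auto
    then have "closure {0..<T} \<subseteq> {0..T} \<inter> \<gamma> -` K" using cl by (rule closure_minimal)
    then have "\<gamma> s \<in> K" if "s \<in> {0..T}" for s using T that by auto
    then show ?thesis using step T by blast
  qed (use 0 in simp)
  have "(\<gamma> \<longlongrightarrow> \<gamma> T) (at T within {0..})" using c T0 by (auto simp: continuous_on_def)
  then have "\<forall>\<^sub>F s in at T within {0..}. \<gamma> s \<in> interior K"
    using int by (rule topological_tendstoD[OF _ open_interior])
  then obtain d where d: "d > 0" "\<And>s. s \<ge> 0 \<Longrightarrow> s \<noteq> T \<Longrightarrow> dist s T < d \<Longrightarrow> \<gamma> s \<in> interior K"
    unfolding eventually_at by auto
  have "Inf S < T + d" using d by (simp add: T_def)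
  then obtain s where s: "s \<in> S" "s < T + d" using S(1) cInf_lessD by blast
  have "s \<ge> T" using cInf_lower[OF s(1) S(2)] by (simp add: T_def)
  then have "\<gamma> s \<in> interior K" using d(2)[of s] int s by (cases "s = T") (auto simp: dist_real_def S_def)
  then show False using s(1) interior_subset by (auto simp: S_def)
qed

lemma solves_continuous_on: "solves f \<gamma> J \<Longrightarrow> continuous_on J \<gamma>"
  unfolding solves_def by (rule continuous_on_vector_derivative) blast

lemma solves_subset: "solves f \<gamma> J \<Longrightarrow> I \<subseteq> J \<Longrightarrow> solves f \<gamma> I"
  unfolding solves_def by (meson has_vector_derivative_within_subset subsetD)

text \<open>The projection to a closed convex set is nonexpansive, so \<open>f\<close> composed with it is globally Lipschitz and
  has global solutions. As long as such a solution stays in \<open>K\<close>, it solves the original system. The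
  assumption \<open>step\<close> is the trapping argument, to be supplied by a Lyapunov function.\<close>

lemma forward_trajectoryI:
  assumes K: "closed K" "convex K" and f: "L-lipschitz_on K f" and q: "q \<in> interior K"
    and step: "\<And>\<gamma> T. T > 0 \<Longrightarrow> solves f \<gamma> {0..T} \<Longrightarrow> \<gamma> 0 = q \<Longrightarrow> (\<And>t. t \<in> {0..T} \<Longrightarrow> \<gamma> t \<in> K)
        \<Longrightarrow> \<gamma> T \<in> interior K"
    and R: "\<And>\<gamma>. solves f \<gamma> {0..} \<Longrightarrow> \<gamma> 0 = q \<Longrightarrow> (\<And>t. t \<ge> 0 \<Longrightarrow> \<gamma> t \<in> K) \<Longrightarrow> R \<gamma>"
  shows "forward_trajectory f q R"
proof -
  have ne: "K \<noteq> {}" using q by auto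
  define g where "g = (\<lambda>x. f (closest_point K x))"
  have "L-lipschitz_on UNIV g"
  proof (rule lipschitz_onI)
    fix x y
    have "dist (g x) (g y) \<le> L * dist (closest_point K x) (closest_point K y)"
      unfolding g_def using K ne by (intro lipschitz_onD[OF f] closest_point_in_set) auto
    also have "\<dots> \<le> L * dist x y"
      using K ne lipschitz_on_nonneg[OF f] by (intro mult_left_mono closest_point_lipschitz) auto
    finally show "dist (g x) (g y) \<le> L * dist x y" .
  qed (use lipschitz_on_nonneg[OF f] in auto)
  then obtain \<gamma> where \<gamma>: "solves g \<gamma> {0..}" "\<gamma> 0 = q" by (rule global_solution_of_lipschitz)
  have sub: "solves h \<eta> {0..T}" if "solves h \<eta> {0..}" for h \<eta> T
    using that by (rule solves_subset) auto
  have fg: "solves f \<gamma> J" if "solves g \<gamma> J" "\<And>t. t \<in> J \<Longrightarrow> \<gamma> t \<in> K" for J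
    using that unfolding solves_def g_def by (simp add: closest_point_self)
  have "\<gamma> t \<in> K" if "t \<ge> 0" for t
  proof (rule stays_inside[OF solves_continuous_on[OF \<gamma>(1)] K(1) _ _ that])
    show "\<gamma> T \<in> interior K" if "T > 0" "\<And>t. t \<in> {0..T} \<Longrightarrow> \<gamma> t \<in> K" for T
      by (rule step[OF that(1) fg[OF sub[OF \<gamma>(1)]] \<gamma>(2)]) (fact that(2))+
  qed (use q \<gamma>(2) in simp)
  then have "solves f \<gamma> {0..}" using fg[OF \<gamma>(1)] by simp
  moreover have "R \<eta>" if \<eta>: "solves f \<eta> {0..}" "\<eta> 0 = q" for \<eta>
  proof (rule R[OF \<eta>])
    fix t :: real assume "t \<ge> 0"
    show "\<eta> t \<in> K"
    proof (rule stays_inside[OF solves_continuous_on[OF \<eta>(1)] K(1) _ _ \<open>t \<ge> 0\<close>])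
      show "\<eta> T \<in> interior K" if "T > 0" "\<And>t. t \<in> {0..T} \<Longrightarrow> \<eta> t \<in> K" for T
        by (rule step[OF that(1) sub[OF \<eta>(1)] \<eta>(2)]) (fact that(2))
    qed (use q \<eta>(2) in simp)
  qed
  ultimately show ?thesis using \<gamma>(2) unfolding forward_trajectory_def by blast
qed

section \<open>Uniqueness of orbits\<close>

text \<open>Gronwall's argument: on a ball that contains both solutions, the squared distance \<open>e\<close> satisfies
  \<open>e' \<le> 2 * L * e\<close>.\<close>

lemma solutions_agree_forward:
  fixes f :: "real \<times> real \<Rightarrow> real \<times> real"
  assumes lip: "\<And>r. \<exists>L. L-lipschitz_on (cball 0 r) f"
    and s: "solves f \<gamma> UNIV" "solves f \<eta> UNIV" and eq: "\<gamma> 0 = \<eta> 0" and T: "T \<ge> 0"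
  shows "\<gamma> T = \<eta> T"
proof -
  have c: "continuous_on {0..T} \<gamma>" "continuous_on {0..T} \<eta>"
    using s[THEN solves_continuous_on] by (auto intro: continuous_on_subset)
  have "bounded (\<gamma> ` {0..T} \<union> \<eta> ` {0..T})"
    using c by (auto intro!: compact_imp_bounded compact_continuous_image)
  then obtain r where r: "\<gamma> ` {0..T} \<union> \<eta> ` {0..T} \<subseteq> cball 0 r" by (meson ball_subset_cball bounded_subset_ballD order_trans)
  obtain L where L: "L-lipschitz_on (cball 0 r) f" using lip by blast
  define e where "e = (\<lambda>t. (\<gamma> t - \<eta> t) \<bullet> (\<gamma> t - \<eta> t))"
  define e' where "e' = (\<lambda>t. 2 * ((\<gamma> t - \<eta> t) \<bullet> (f (\<gamma> t) - f (\<eta> t))))"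
  have de: "(e has_real_derivative e' t) (at t within {0..T})" for t
  proof -
    have "((\<lambda>t. \<gamma> t - \<eta> t) has_vector_derivative f (\<gamma> t) - f (\<eta> t)) (at t within {0..T})"
      using s unfolding solves_def
      by (intro has_vector_derivative_diff has_vector_derivative_at_within[where S="{0..T}"]) auto
    then have "(e has_derivative (\<lambda>h. (\<gamma> t - \<eta> t) \<bullet> (h *\<^sub>R (f (\<gamma> t) - f (\<eta> t)))
        + (h *\<^sub>R (f (\<gamma> t) - f (\<eta> t))) \<bullet> (\<gamma> t - \<eta> t))) (at t within {0..T})"
      unfolding e_def has_vector_derivative_def by (intro has_derivative_inner)
    then show ?thesis
      unfolding has_field_derivative_def e'_def
      by (rule has_derivative_eq_rhs) (auto simp: inner_commute algebra_simps)
  qed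
  have le: "e' t \<le> 2 * L * e t" if "t \<in> {0..T}" for t
  proof -
    have "(\<gamma> t - \<eta> t) \<bullet> (f (\<gamma> t) - f (\<eta> t)) \<le> norm (\<gamma> t - \<eta> t) * norm (f (\<gamma> t) - f (\<eta> t))"
      by (rule norm_cauchy_schwarz)
    also have "\<dots> \<le> norm (\<gamma> t - \<eta> t) * (L * norm (\<gamma> t - \<eta> t))"
    proof (intro mult_left_mono norm_ge_zero)
      have "\<gamma> t \<in> cball 0 r" "\<eta> t \<in> cball 0 r" using r that by blast+
      then show "norm (f (\<gamma> t) - f (\<eta> t)) \<le> L * norm (\<gamma> t - \<eta> t)"
        using lipschitz_onD[OF L] by (simp only: dist_norm)
    qed
    also have "\<dots> = L * e t" by (simp add: e_def power2_norm_eq_inner[symmetric] power2_eq_square)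
    finally show ?thesis by (simp add: e'_def)
  qed
  have "e T * exp (- 2 * L * T) \<le> e 0 * exp (- 2 * L * 0)"
  proof (rule nonincreasing_of_derivative[where J = "{0..T}" and u = "\<lambda>t. e t * exp (- 2 * L * t)"
        and u' = "\<lambda>t. (e' t - 2 * L * e t) * exp (- 2 * L * t)"])
    fix t assume "t \<in> {0..T}"
    show "((\<lambda>t. e t * exp (- 2 * L * t)) has_real_derivative (e' t - 2 * L * e t) * exp (- 2 * L * t)) (at t within {0..T})"
      by (rule derivative_eq_intros de refl)+ (simp add: algebra_simps)
    show "(e' t - 2 * L * e t) * exp (- 2 * L * t) \<le> 0"
      using le[OF \<open>t \<in> {0..T}\<close>] by (simp add: mult_le_0_iff)
  qed (use T in auto)
  then have "e T \<le> 0" using eq by (simp add: e_def mult_le_0_iff zero_le_mult_iff)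
  then show ?thesis by (metis e_def eq_iff_diff_eq_0 inner_eq_zero_iff inner_ge_zero order_antisym)
qed

lemma solves_time_affine:
  assumes s: "solves f \<gamma> UNIV"
  shows "solves (\<lambda>q. a *\<^sub>R f q) (\<lambda>t. \<gamma> (a * t + b)) UNIV"
  unfolding solves_def
proof
  fix t :: real
  have "((\<lambda>t. a * t + b) has_real_derivative a) (at t)" by (auto intro!: derivative_eq_intros)
  then have "((\<lambda>t. a * t + b) has_vector_derivative a) (at t)"
    by (simp add: has_real_derivative_iff_has_vector_derivative)
  from vector_diff_chain_at[OF this, of \<gamma> "f (\<gamma> (a * t + b))"]
  show "((\<lambda>t. \<gamma> (a * t + b)) has_vector_derivative a *\<^sub>R f (\<gamma> (a * t + b))) (at t)"
    using s by (simp add: solves_def o_def)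
qed

lemma range_eq_of_common_point:
  fixes f :: "real \<times> real \<Rightarrow> real \<times> real"
  assumes lip: "\<And>r. \<exists>L. L-lipschitz_on (cball 0 r) f"
    and s: "solves f \<gamma> UNIV" "solves f \<eta> UNIV" and eq: "\<gamma> a = \<eta> b"
  shows "range \<gamma> = range \<eta>"
proof -
  define \<alpha> where "\<alpha> = (\<lambda>t. \<gamma> (t + a))"
  define \<beta> where "\<beta> = (\<lambda>t. \<eta> (t + b))"
  have s': "solves f \<alpha> UNIV" "solves f \<beta> UNIV"
    using solves_time_affine[OF s(1), of 1 a] solves_time_affine[OF s(2), of 1 b]
    by (simp_all add: \<alpha>_def \<beta>_def)
  have fwd: "\<alpha> t = \<beta> t" if "t \<ge> 0" for t
    using solutions_agree_forward[OF lip s' _ that] eq by (simp add: \<alpha>_def \<beta>_def)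
  have lip': "\<exists>L. L-lipschitz_on (cball 0 r) (\<lambda>q. - f q)" for r
    using lip[of r] by (auto simp: lipschitz_on_def dist_minus)
  have s'': "solves (\<lambda>q. - f q) (\<lambda>t. \<alpha> (- t)) UNIV" "solves (\<lambda>q. - f q) (\<lambda>t. \<beta> (- t)) UNIV"
    using solves_time_affine[OF s'(1), of "-1" 0] solves_time_affine[OF s'(2), of "-1" 0] by simp_all
  have bwd: "\<alpha> (- t) = \<beta> (- t)" if "t \<ge> 0" for t
    using solutions_agree_forward[OF lip' s'' _ that] fwd[of 0] by simp
  have "\<alpha> t = \<beta> t" for t using fwd[of t] bwd[of "- t"] by (cases "t \<ge> 0") auto
  then have "\<alpha> = \<beta>" by (rule ext)
  moreover have "range (\<lambda>t. h (t + b)) = range h" for h :: "real \<Rightarrow> real \<times> real" and b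
  proof -
    have "h t = h ((t - b) + b)" for t by simp
    then show ?thesis by blast
  qed
  ultimately show ?thesis unfolding \<alpha>_def \<beta>_def by metis
qed

section \<open>Orbits along parametrized curves\<close>

text \<open>The equation \<open>\<theta>' = g \<theta>\<close> is solved by the inverse function of an antiderivative \<open>\<tau>\<close> of \<open>1 / g\<close>. The
  bounds on \<open>g\<close> make \<open>\<tau>\<close> grow linearly, hence bijective. If \<open>g\<close> has period \<open>P\<close>, then \<open>\<tau>\<close> increases by the
  same amount \<open>T\<close> over each period.\<close>

lemma time_change:
  fixes g :: "real \<Rightarrow> real"
  assumes g: "continuous_on UNIV g" and m: "m > 0" "\<And>u. m \<le> g u" and M: "\<And>u. g u \<le> M"
  obtains \<theta> where "\<And>t. (\<theta> has_real_derivative g (\<theta> t)) (at t)" "surj \<theta>"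
    "filterlim \<theta> at_top at_top" "filterlim \<theta> at_bot at_bot"
    "\<And>P. P > 0 \<Longrightarrow> (\<And>u. g (u + P) = g u) \<Longrightarrow> \<exists>T>0. \<forall>t. \<theta> (t + T) = \<theta> t + P"
proof -
  have gp: "g u > 0" for u using m(2)[of u] m(1) by linarith
  have M0: "M > 0" using gp[of 0] M[of 0] by linarith
  have "continuous_on UNIV (\<lambda>u. 1 / g u)" using g gp by (intro continuous_intros) (auto simp: less_imp_neq[symmetric])
  then have "isCont (\<lambda>u. 1 / g u) x" for x by (simp add: continuous_on_eq_continuous_at)
  then obtain \<tau> where \<tau>: "\<And>u. (\<tau> has_real_derivative 1 / g u) (at u)"
    using einterval_antiderivative[of "-\<infinity>" "\<infinity>" "\<lambda>u. 1 / g u"]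
    by (auto simp: has_real_derivative_iff_has_vector_derivative)
  have inc: "(v - u) / M \<le> \<tau> v - \<tau> u" if "u \<le> v" for u v
  proof -
    have "\<tau> u - u / M \<le> \<tau> v - v / M"
    proof (rule nondecreasing_of_derivative[OF that, where J = UNIV])
      show "((\<lambda>u. \<tau> u - u / M) has_real_derivative 1 / g t - 1 / M) (at t)" for t
        using M0 by (auto intro!: derivative_eq_intros \<tau>)
      show "0 \<le> 1 / g t - 1 / M" for t using M[of t] gp[of t] by (simp add: frac_le)
    qed auto
    then show ?thesis by (simp add: diff_divide_distrib)
  qed
  have inj: "inj \<tau>"
  proof (rule injI, rule ccontr)
    fix u v assume "\<tau> u = \<tau> v" "u \<noteq> v"
    then show False using inc[of u v] inc[of v u] M0 by (cases "u < v") (auto simp: divide_le_0_iff)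
  qed
  have "\<exists>u. \<tau> u = y" for y
  proof -
    define b where "b = M * \<bar>y - \<tau> 0\<bar>"
    have b: "b \<ge> 0" "b / M = \<bar>y - \<tau> 0\<bar>" using M0 by (auto simp: b_def)
    have "\<tau> (- b) \<le> y" "y \<le> \<tau> b" using inc[of 0 b] inc[of "-b" 0] b by auto
    then show ?thesis
      using IVT'[of \<tau> "-b" y b] b DERIV_continuous_on[of "{-b..b}" \<tau>] \<tau>
      by (meson has_field_derivative_at_within neg_le_0_iff_le order_trans)
  qed
  then have surj: "surj \<tau>" by (metis surjI)
  define \<theta> where "\<theta> = inv \<tau>"
  have \<tau>\<theta>: "\<tau> (\<theta> t) = t" for t using surj by (simp add: \<theta>_def surj_f_inv_f)
  have \<theta>\<tau>: "\<theta> (\<tau> u) = u" for u using inj by (simp add: \<theta>_def)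
  have lip: "\<bar>\<theta> s - \<theta> t\<bar> \<le> M * \<bar>s - t\<bar>" for s t
  proof -
    have "\<theta> t - \<theta> s \<le> M * \<bar>s - t\<bar>" for s t
    proof (cases "\<theta> s \<le> \<theta> t")
      case True
      then have "\<theta> t - \<theta> s \<le> M * (t - s)"
        using inc[OF True] M0 by (simp add: \<tau>\<theta> pos_divide_le_eq mult.commute)
      also have "\<dots> \<le> M * \<bar>s - t\<bar>" using M0 by (intro mult_left_mono) auto
      finally show ?thesis .
    next
      case False
      moreover have "M * \<bar>s - t\<bar> \<ge> 0" using M0 by simp
      ultimately show ?thesis by linarith
    qed
    from this[of s t] this[of t s] show ?thesis by (simp add: abs_minus_commute abs_le_iff)
  qed
  have "M-lipschitz_on UNIV \<theta>"
    using lip M0 by (intro lipschitz_onI) (auto simp: dist_real_def)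
  then have c: "isCont \<theta> t" for t
    using lipschitz_on_continuous_on continuous_on_eq_continuous_at by blast
  have d: "(\<theta> has_real_derivative g (\<theta> t)) (at t)" for t
    using DERIV_inverse_function[OF \<tau>, of \<theta> t "t - 1" "t + 1"] gp[of "\<theta> t"] c[of t] \<tau>\<theta> by simp
  have lin: "\<theta> s - m * s \<le> \<theta> t - m * t" if "s \<le> t" for s t
  proof (rule nondecreasing_of_derivative[OF that, where J = UNIV])
    show "((\<lambda>t. \<theta> t - m * t) has_real_derivative g (\<theta> t) - m) (at t)" for t
      by (auto intro!: derivative_eq_intros d)
  qed (use m in auto)
  have lint: "filterlim (\<lambda>t. b + m * t) at_top at_top" for b
    by (rule filterlim_tendsto_add_at_top[OF tendsto_const
          filterlim_tendsto_pos_mult_at_top[OF tendsto_const m(1) filterlim_ident]])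
  have top: "filterlim \<theta> at_top at_top"
  proof (rule filterlim_at_top_mono)
    show "filterlim (\<lambda>t. \<theta> 0 + m * t) at_top at_top" by (rule lint)
    show "\<forall>\<^sub>F t in at_top. \<theta> 0 + m * t \<le> \<theta> t"
      using eventually_ge_at_top[of "0::real"] by eventually_elim (use lin[of 0] in force)
  qed
  have bot: "filterlim \<theta> at_bot at_bot"
  proof -
    have "filterlim (\<lambda>t. - \<theta> (- t)) at_top at_top"
    proof (rule filterlim_at_top_mono)
      show "filterlim (\<lambda>t. - \<theta> 0 + m * t) at_top at_top" by (rule lint)
      show "\<forall>\<^sub>F t in at_top. - \<theta> 0 + m * t \<le> - \<theta> (- t)"
        using eventually_ge_at_top[of "0::real"]
        by eventually_elim (use lin[of "- t" 0 for t] in force)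
    qed
    then show ?thesis by (simp add: filterlim_at_bot_mirror filterlim_uminus_at_top)
  qed
  have per: "\<exists>T>0. \<forall>t. \<theta> (t + T) = \<theta> t + P" if P: "P > 0" "\<And>u. g (u + P) = g u" for P
  proof -
    have dz: "((\<lambda>u. \<tau> (u + P) - \<tau> u) has_real_derivative 0) (at u)" for u
    proof -
      have "((\<lambda>u. \<tau> (u + P)) has_real_derivative 1 / g (u + P)) (at u)"
        by (rule \<tau>[of "u + P", unfolded DERIV_shift])
      from DERIV_diff[OF this \<tau>] show ?thesis using P(2) by simp
    qed
    define T where "T = \<tau> (0 + P) - \<tau> 0"
    have T: "\<tau> (u + P) = \<tau> u + T" for u
      using DERIV_isconst_all[OF allI[OF dz], of u 0] unfolding T_def by simp
    have "T > 0" using inc[of 0 P] P(1) divide_pos_pos[OF P(1) M0] unfolding T_def by (simp del: zero_less_divide_iff)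
    moreover have "\<theta> (t + T) = \<theta> t + P" for t using \<theta>\<tau>[of "\<theta> t + P"] by (simp add: T \<tau>\<theta>)
    ultimately show ?thesis by blast
  qed
  show ?thesis
    by (rule that[OF d surjI[of \<theta> \<tau>, OF \<theta>\<tau>] top bot per])
qed

text \<open>A curve whose velocity is a positive multiple of the field is an orbit up to a change of time. The
  compact set supplies the bounds that this change of time requires.\<close>

lemma orbit_of_parametrization:
  fixes Z :: "real \<Rightarrow> real \<times> real"
  assumes Z: "\<And>u. (Z has_vector_derivative (1 / G (Z u)) *\<^sub>R f (Z u)) (at u)"
    and K: "compact K" "range Z \<subseteq> K" "continuous_on K G" "\<And>q. q \<in> K \<Longrightarrow> G q > 0"
  obtains \<theta> where "solves f (\<lambda>t. Z (\<theta> t)) UNIV" "surj \<theta>"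
    "filterlim \<theta> at_top at_top" "filterlim \<theta> at_bot at_bot"
    "\<forall>P>0. (\<forall>u. Z (u + P) = Z u) \<longrightarrow> (\<exists>T>0. \<forall>t. \<theta> (t + T) = \<theta> t + P)"
proof -
  have ne: "K \<noteq> {}" using K(2) by auto
  obtain a where a: "a \<in> K" "\<And>q. q \<in> K \<Longrightarrow> G a \<le> G q"
    using continuous_attains_inf[OF K(1) ne K(3)] by blast
  obtain b where b: "b \<in> K" "\<And>q. q \<in> K \<Longrightarrow> G q \<le> G b"
    using continuous_attains_sup[OF K(1) ne K(3)] by blast
  have "continuous_on UNIV Z"
    using Z by (intro continuous_on_vector_derivative) auto
  then have c: "continuous_on UNIV (\<lambda>u. G (Z u))"
    by (rule continuous_on_compose2[OF K(3)]) (use K(2) in auto)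
  have bd: "G a > 0" "G a \<le> G (Z u)" "G (Z u) \<le> G b" for u
    using a b K(2,4) by blast+
  obtain \<theta> where \<theta>: "\<And>t. (\<theta> has_real_derivative G (Z (\<theta> t))) (at t)" "surj \<theta>"
    "filterlim \<theta> at_top at_top" "filterlim \<theta> at_bot at_bot"
    "\<And>P. P > 0 \<Longrightarrow> (\<And>u. G (Z (u + P)) = G (Z u)) \<Longrightarrow> \<exists>T>0. \<forall>t. \<theta> (t + T) = \<theta> t + P"
    using time_change[OF c bd] by blast
  have "solves f (\<lambda>t. Z (\<theta> t)) UNIV"
    unfolding solves_def
  proof
    fix t
    have "Z (\<theta> t) \<in> K" using K(2) by blast
    then have "G (Z (\<theta> t)) \<noteq> 0" using K(4)[of "Z (\<theta> t)"] by simp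
    moreover have "((\<lambda>t. Z (\<theta> t)) has_vector_derivative
        G (Z (\<theta> t)) *\<^sub>R ((1 / G (Z (\<theta> t))) *\<^sub>R f (Z (\<theta> t)))) (at t)"
      using vector_diff_chain_at[OF _ Z, of \<theta> "G (Z (\<theta> t))" t] \<theta>(1)[of t]
      by (simp add: o_def has_real_derivative_iff_has_vector_derivative)
    ultimately show "((\<lambda>t. Z (\<theta> t)) has_vector_derivative f (Z (\<theta> t))) (at t)" by simp
  qed
  then show ?thesis by (rule that[OF _ \<theta>(2-4)]) (use \<theta>(5) in force)
qed

lemma range_comp_surj: "surj \<theta> \<Longrightarrow> range Z = range (\<lambda>t. Z (\<theta> t))"
  unfolding image_image[of Z \<theta> UNIV, symmetric] by simp

lemma closed_orbit_of_parametrization: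
  fixes Z :: "real \<Rightarrow> real \<times> real"
  assumes Z: "\<And>u. (Z has_vector_derivative (1 / G (Z u)) *\<^sub>R f (Z u)) (at u)"
    and K: "compact K" "range Z \<subseteq> K" "continuous_on K G" "\<And>q. q \<in> K \<Longrightarrow> G q > 0"
    and P: "P > 0" "\<And>u. Z (u + P) = Z u" and ne: "Z u1 \<noteq> Z u2"
  shows "closed_orbit f (range Z)"
proof -
  obtain \<theta> where \<theta>: "solves f (\<lambda>t. Z (\<theta> t)) UNIV" "surj \<theta>"
    "filterlim \<theta> at_top at_top" "filterlim \<theta> at_bot at_bot"
    "\<forall>P>0. (\<forall>u. Z (u + P) = Z u) \<longrightarrow> (\<exists>T>0. \<forall>t. \<theta> (t + T) = \<theta> t + P)"
    by (rule orbit_of_parametrization[OF Z K])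
  obtain T where T: "T > 0" "\<And>t. \<theta> (t + T) = \<theta> t + P" using \<theta>(5) P by blast
  obtain t1 t2 where "\<theta> t1 = u1" "\<theta> t2 = u2" using \<theta>(2) by (metis surjD)
  then obtain t where t: "Z (\<theta> t) \<noteq> Z (\<theta> 0)" using ne by metis
  show ?thesis
    unfolding closed_orbit_def
  proof (intro exI conjI allI)
    show "solves f (\<lambda>t. Z (\<theta> t)) UNIV" "T > 0" by fact+
    show "Z (\<theta> (t + T)) = Z (\<theta> t)" for t by (simp add: T(2) P(2))
    show "range Z = range (\<lambda>t. Z (\<theta> t))" by (rule range_comp_surj[OF \<theta>(2)])
    show "Z (\<theta> t) \<noteq> Z (\<theta> 0)" by (rule t)
  qed
qed

lemma homoclinic_orbit_of_parametrization:
  fixes Z :: "real \<Rightarrow> real \<times> real"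
  assumes Z: "\<And>u. (Z has_vector_derivative (1 / G (Z u)) *\<^sub>R f (Z u)) (at u)"
    and K: "compact K" "range Z \<subseteq> K" "continuous_on K G" "\<And>q. q \<in> K \<Longrightarrow> G q > 0"
    and p: "fixed_point f p" "\<And>u. Z u \<noteq> p" "(Z \<longlongrightarrow> p) at_top" "(Z \<longlongrightarrow> p) at_bot"
  shows "homoclinic_orbit f p (range Z)"
proof -
  obtain \<theta> where \<theta>: "solves f (\<lambda>t. Z (\<theta> t)) UNIV" "surj \<theta>"
    "filterlim \<theta> at_top at_top" "filterlim \<theta> at_bot at_bot"
    "\<forall>P>0. (\<forall>u. Z (u + P) = Z u) \<longrightarrow> (\<exists>T>0. \<forall>t. \<theta> (t + T) = \<theta> t + P)"
    by (rule orbit_of_parametrization[OF Z K])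
  have "range Z = range (\<lambda>t. Z (\<theta> t))" by (rule range_comp_surj[OF \<theta>(2)])
  moreover have "((\<lambda>t. Z (\<theta> t)) \<longlongrightarrow> p) at_top" "((\<lambda>t. Z (\<theta> t)) \<longlongrightarrow> p) at_bot"
    using filterlim_compose[OF p(3) \<theta>(3)] filterlim_compose[OF p(4) \<theta>(4)] .
  ultimately show ?thesis
    unfolding homoclinic_orbit_def using \<theta>(1) p(1,2) by blast
qed

section \<open>Inside and outside of a closed set\<close>

text \<open>A connected set that meets \<open>D\<close> and avoids the frontier of \<open>D\<close> is contained in \<open>D\<close>. In this way the Jordan
  curve theorem can be avoided for curves that are given as level sets.\<close>

lemma in_inside_if_frontier_subset:
  fixes D :: "(real \<times> real) set"
  assumes "bounded D" "frontier D \<subseteq> C" "p \<in> D" "p \<notin> C"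
  shows "p \<in> inside C"
proof -
  let ?K = "connected_component_set (- C) p"
  have "p \<in> ?K" using assms(4) by simp
  moreover have "?K \<inter> frontier D = {}" using assms(2) connected_component_subset by fast
  ultimately have "?K \<subseteq> D"
    using connected_Int_frontier[of ?K D] assms(3) by blast
  then show ?thesis using assms by (auto simp: inside_def intro: bounded_subset)
qed

lemma not_in_inside_if_ray:
  fixes p v :: "real \<times> real"
  assumes v: "v \<noteq> 0" and ray: "\<And>t. t \<ge> 0 \<Longrightarrow> p + t *\<^sub>R v \<notin> C"
  shows "p \<notin> inside C"
proof
  assume "p \<in> inside C"
  then have b: "bounded (connected_component_set (- C) p)" by (simp add: inside_def)
  let ?R = "(\<lambda>t. p + t *\<^sub>R v) ` {0..}"
  have "connected ?R" by (intro connected_continuous_image continuous_intros) auto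
  moreover have "p \<in> ?R" by (rule image_eqI[of _ _ 0]) auto
  ultimately have "?R \<subseteq> connected_component_set (- C) p"
    using ray by (intro connected_component_maximal) auto
  then obtain B where B: "\<And>t. t \<ge> 0 \<Longrightarrow> norm (p + t *\<^sub>R v) \<le> B"
    using b bounded_subset unfolding bounded_iff by blast
  define t where "t = (B + norm p + 1) / norm v"
  have B0: "B \<ge> 0" using order_trans[OF norm_ge_zero B[of 0]] by simp
  then have "t \<ge> 0" "norm (t *\<^sub>R v) = B + norm p + 1" using v by (auto simp: t_def)
  then show False using B[of t] norm_triangle_ineq4[of "p + t *\<^sub>R v" p] by simp
qed

section \<open>Lipschitz estimates\<close>

text \<open>Boundedness is included because it makes this class of functions closed under products.\<close>

definition bounded_lipschitz_on :: "(real \<times> real) set \<Rightarrow> (real \<times> real \<Rightarrow> real) \<Rightarrow> bool" where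
  "bounded_lipschitz_on K g \<longleftrightarrow>
     (\<exists>B. \<forall>q\<in>K. \<bar>g q\<bar> \<le> B) \<and> (\<exists>L. \<forall>p\<in>K. \<forall>q\<in>K. \<bar>g p - g q\<bar> \<le> L * dist p q)"

lemma bounded_lipschitz_on_const: "bounded_lipschitz_on K (\<lambda>q. a)"
  unfolding bounded_lipschitz_on_def by (auto intro: exI[of _ 0])

lemma bounded_lipschitz_on_add:
  assumes "bounded_lipschitz_on K g" "bounded_lipschitz_on K h"
  shows "bounded_lipschitz_on K (\<lambda>q. g q + h q)"
proof -
  obtain B L where 1: "\<And>q. q \<in> K \<Longrightarrow> \<bar>g q\<bar> \<le> B" "\<And>p q. p \<in> K \<Longrightarrow> q \<in> K \<Longrightarrow> \<bar>g p - g q\<bar> \<le> L * dist p q"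
    using assms(1) unfolding bounded_lipschitz_on_def by blast
  obtain C M where 2: "\<And>q. q \<in> K \<Longrightarrow> \<bar>h q\<bar> \<le> C" "\<And>p q. p \<in> K \<Longrightarrow> q \<in> K \<Longrightarrow> \<bar>h p - h q\<bar> \<le> M * dist p q"
    using assms(2) unfolding bounded_lipschitz_on_def by blast
  have "\<bar>g q + h q\<bar> \<le> B + C" if "q \<in> K" for q using 1(1)[OF that] 2(1)[OF that] by linarith
  moreover have "\<bar>(g p + h p) - (g q + h q)\<bar> \<le> (L + M) * dist p q" if "p \<in> K" "q \<in> K" for p q
    using 1(2)[OF that] 2(2)[OF that] by (simp add: distrib_right)
  ultimately show ?thesis unfolding bounded_lipschitz_on_def by blast
qed

lemma bounded_lipschitz_on_mult:
  assumes "bounded_lipschitz_on K g" "bounded_lipschitz_on K h"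
  shows "bounded_lipschitz_on K (\<lambda>q. g q * h q)"
proof -
  obtain B L where 1: "\<And>q. q \<in> K \<Longrightarrow> \<bar>g q\<bar> \<le> B" "\<And>p q. p \<in> K \<Longrightarrow> q \<in> K \<Longrightarrow> \<bar>g p - g q\<bar> \<le> L * dist p q"
    using assms(1) unfolding bounded_lipschitz_on_def by blast
  obtain C M where 2: "\<And>q. q \<in> K \<Longrightarrow> \<bar>h q\<bar> \<le> C" "\<And>p q. p \<in> K \<Longrightarrow> q \<in> K \<Longrightarrow> \<bar>h p - h q\<bar> \<le> M * dist p q"
    using assms(2) unfolding bounded_lipschitz_on_def by blast
  have "\<bar>g q * h q\<bar> \<le> B * C" if "q \<in> K" for q
    unfolding abs_mult using 1(1)[OF that] 2(1)[OF that] abs_ge_zero[of "g q"]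
    by (intro mult_mono) linarith+
  moreover have "\<bar>g p * h p - g q * h q\<bar> \<le> (B * M + C * L) * dist p q" if "p \<in> K" "q \<in> K" for p q
  proof -
    have "g p * h p - g q * h q = g p * (h p - h q) + h q * (g p - g q)" by (simp add: algebra_simps)
    then have "\<bar>g p * h p - g q * h q\<bar> \<le> \<bar>g p\<bar> * \<bar>h p - h q\<bar> + \<bar>h q\<bar> * \<bar>g p - g q\<bar>"
      by (metis abs_mult abs_triangle_ineq)
    also have "\<dots> \<le> B * (M * dist p q) + C * (L * dist p q)"
      using 1(1)[OF that(1)] 2(1)[OF that(2)] 1(2)[OF that] 2(2)[OF that] abs_ge_zero[of "g p"] abs_ge_zero[of "h q"]
      by (intro add_mono mult_mono) linarith+
    finally show ?thesis by (simp add: algebra_simps)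
  qed
  ultimately show ?thesis unfolding bounded_lipschitz_on_def by blast
qed

lemma bounded_lipschitz_on_minus: "bounded_lipschitz_on K g \<Longrightarrow> bounded_lipschitz_on K (\<lambda>q. - g q)"
  using bounded_lipschitz_on_mult[OF bounded_lipschitz_on_const[of K "-1"]] by simp

lemma bounded_lipschitz_on_diff:
  "bounded_lipschitz_on K g \<Longrightarrow> bounded_lipschitz_on K h \<Longrightarrow> bounded_lipschitz_on K (\<lambda>q. g q - h q)"
  using bounded_lipschitz_on_add[OF _ bounded_lipschitz_on_minus] by simp

lemma bounded_lipschitz_on_power: "bounded_lipschitz_on K g \<Longrightarrow> bounded_lipschitz_on K (\<lambda>q. g q ^ n)"
  by (induction n) (auto intro: bounded_lipschitz_on_const bounded_lipschitz_on_mult)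

lemma bounded_lipschitz_on_sum:
  "(\<And>i. i \<in> I \<Longrightarrow> bounded_lipschitz_on K (g i)) \<Longrightarrow> bounded_lipschitz_on K (\<lambda>q. \<Sum>i\<in>I. g i q)"
  by (induction I rule: infinite_finite_induct) (auto intro: bounded_lipschitz_on_const bounded_lipschitz_on_add)

lemmas bounded_lipschitz_on_intros =
  bounded_lipschitz_on_const bounded_lipschitz_on_add bounded_lipschitz_on_mult bounded_lipschitz_on_minus
  bounded_lipschitz_on_diff bounded_lipschitz_on_power bounded_lipschitz_on_sum

lemma lipschitz_on_Pair_if:
  assumes "bounded_lipschitz_on K g" "bounded_lipschitz_on K h"
  shows "\<exists>L. L-lipschitz_on K (\<lambda>q. (g q, h q))"
proof -
  obtain L M where 1: "\<And>p q. p \<in> K \<Longrightarrow> q \<in> K \<Longrightarrow> \<bar>g p - g q\<bar> \<le> L * dist p q"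
    and 2: "\<And>p q. p \<in> K \<Longrightarrow> q \<in> K \<Longrightarrow> \<bar>h p - h q\<bar> \<le> M * dist p q"
    using assms unfolding bounded_lipschitz_on_def by blast
  have "(\<bar>L\<bar> + \<bar>M\<bar>)-lipschitz_on K (\<lambda>q. (g q, h q))"
  proof (rule lipschitz_onI)
    fix p q assume pq: "p \<in> K" "q \<in> K"
    have "dist (g p, h p) (g q, h q) \<le> \<bar>g p - g q\<bar> + \<bar>h p - h q\<bar>"
      using norm_Pair_le[of "g p - g q" "h p - h q"] by (simp add: dist_norm)
    also have "\<dots> \<le> L * dist p q + M * dist p q" using 1[OF pq] 2[OF pq] by linarith
    also have "\<dots> \<le> (\<bar>L\<bar> + \<bar>M\<bar>) * dist p q"
      unfolding distrib_right by (intro add_mono mult_right_mono) auto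
    finally show "dist (g p, h p) (g q, h q) \<le> (\<bar>L\<bar> + \<bar>M\<bar>) * dist p q" .
  qed simp
  then show ?thesis by blast
qed

lemma bounded_lipschitz_on_coordinates:
  "bounded_lipschitz_on (cball 0 r) fst" "bounded_lipschitz_on (cball 0 r) snd"
proof -
  have "\<bar>fst q\<bar> \<le> r" "\<bar>snd q\<bar> \<le> r" if "q \<in> cball 0 r" for q :: "real \<times> real"
    using that norm_fst_le[of "fst q" "snd q"] norm_snd_le[of "snd q" "fst q"] by auto
  moreover have "\<bar>fst p - fst q\<bar> \<le> 1 * dist p q" "\<bar>snd p - snd q\<bar> \<le> 1 * dist p q" for p q :: "real \<times> real"
    using dist_fst_le[of p q] dist_snd_le[of p q] by (auto simp: dist_real_def)
  ultimately show "bounded_lipschitz_on (cball 0 r) fst" "bounded_lipschitz_on (cball 0 r) snd"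
    unfolding bounded_lipschitz_on_def by blast+
qed

lemma poly_field_lipschitz: "\<exists>L. L-lipschitz_on (cball 0 r) (poly_field P Q)"
proof -
  have "bounded_lipschitz_on (cball 0 r) (\<lambda>q. poly2 R (fst q) (snd q))" for R
    unfolding poly2_eq_sum_hom_part[OF order_refl] hom_part_def
    by (intro bounded_lipschitz_on_intros bounded_lipschitz_on_coordinates)
  from lipschitz_on_Pair_if[OF this[of P] this[of Q]]
  show ?thesis by (simp add: poly_field_def case_prod_beta')
qed

text \<open>The strip is unbounded, but the extended field depends on the angle only through its sine and cosine.\<close>

lemma bounded_lipschitz_on_strip:
  assumes K: "K = {0..d} \<times> UNIV"
  shows "bounded_lipschitz_on K fst" "bounded_lipschitz_on K (\<lambda>q. cos (snd q))"
    "bounded_lipschitz_on K (\<lambda>q. sin (snd q))"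
proof -
  have "\<bar>fst q\<bar> \<le> d" if "q \<in> K" for q using that K by auto
  moreover have "\<bar>fst p - fst q\<bar> \<le> 1 * dist p q" for p q :: "real \<times> real"
    using dist_fst_le[of p q] by (simp add: dist_real_def)
  ultimately show "bounded_lipschitz_on K fst" unfolding bounded_lipschitz_on_def by blast
  have s: "\<bar>cos x - cos y\<bar> \<le> \<bar>x - y\<bar>" "\<bar>sin x - sin y\<bar> \<le> \<bar>x - y\<bar>" for x y :: real
    using field_differentiable_bound[of UNIV cos "\<lambda>x. - sin x" 1 x y]
      field_differentiable_bound[of UNIV sin cos 1 x y] by auto
  have "\<bar>cos (snd p) - cos (snd q)\<bar> \<le> 1 * dist p q" "\<bar>sin (snd p) - sin (snd q)\<bar> \<le> 1 * dist p q"
    for p q :: "real \<times> real"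
    using s[of "snd p" "snd q"] dist_snd_le[of p q] by (auto simp: dist_real_def)
  then show "bounded_lipschitz_on K (\<lambda>q. cos (snd q))" "bounded_lipschitz_on K (\<lambda>q. sin (snd q))"
    unfolding bounded_lipschitz_on_def using abs_cos_le_one abs_sin_le_one by blast+
qed

lemma field_at_infinity_lipschitz:
  assumes K: "K = {0..d} \<times> UNIV"
  shows "\<exists>L. L-lipschitz_on K (field_at_infinity P Q)"
proof -
  have p: "bounded_lipschitz_on K (\<lambda>q. poly_at_infinity m R (fst q) (snd q))" for m R
    unfolding poly_at_infinity_def hom_part_def
    by (intro bounded_lipschitz_on_intros bounded_lipschitz_on_strip[OF K])
  show ?thesis
    unfolding field_at_infinity_def case_prod_beta' Let_def
    by (intro lipschitz_on_Pair_if bounded_lipschitz_on_intros p bounded_lipschitz_on_strip[OF K])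
qed

section \<open>The focal coordinate\<close>

definition to_complex :: "real \<times> real \<Rightarrow> complex" where
  "to_complex q = Complex (fst q) (snd q)"

text \<open>The number \<open>(z - \<i> / sqrt 2) * (z + \<i> / sqrt 2)\<close>, which vanishes exactly at the two foci.\<close>

definition focal :: "real \<times> real \<Rightarrow> complex" where
  "focal q = (to_complex q)\<^sup>2 + 1 / 2"

text \<open>The squared product of the distances from the two foci.\<close>

definition cassini :: "real \<times> real \<Rightarrow> real" where
  "cassini q = (cmod (focal q))\<^sup>2"

lemma to_complex_simps [simp]: "Re (to_complex q) = fst q" "Im (to_complex q) = snd q"
  by (simp_all add: to_complex_def)

lemma to_complex_add: "to_complex (p + q) = to_complex p + to_complex q"
  and to_complex_diff: "to_complex (p - q) = to_complex p - to_complex q"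
  and to_complex_scaleR: "to_complex (a *\<^sub>R q) = a *\<^sub>R to_complex q"
  by (simp_all add: complex_eq_iff)

lemma to_complex_eq_iff: "to_complex p = to_complex q \<longleftrightarrow> p = q"
  by (simp add: complex_eq_iff prod_eq_iff)

lemma to_complex_eq_0_iff: "to_complex q = 0 \<longleftrightarrow> q = 0"
  by (simp add: complex_eq_iff prod_eq_iff)

lemma norm_to_complex: "cmod (to_complex q) = norm q"
  by (cases q) (simp add: to_complex_def norm_Pair cmod_def)

lemma dist_to_complex: "cmod (to_complex q - to_complex p) = dist q p"
  unfolding to_complex_diff[symmetric] norm_to_complex dist_norm ..

lemma norm_sq: "(norm q)\<^sup>2 = (fst q)\<^sup>2 + (snd q)\<^sup>2" for q :: "real \<times> real"
  by (cases q) (simp add: norm_Pair)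

lemma bounded_linear_to_complex: "bounded_linear to_complex"
  by (rule bounded_linear_intro[of _ 1]) (simp_all add: to_complex_add to_complex_scaleR norm_to_complex)

lemma cassini_eq: "cassini q = ((fst q)\<^sup>2 + (snd q)\<^sup>2)\<^sup>2 + (fst q)\<^sup>2 - (snd q)\<^sup>2 + 1 / 4"
  unfolding cassini_def cmod_power2 focal_def by (simp add: power2_eq_square algebra_simps)

lemma cassini_nonneg: "cassini q \<ge> 0"
  by (simp add: cassini_def)

text \<open>The triangle inequality for \<open>z^2 + 1/2\<close>: at distance \<open>r\<close> from the origin, its modulus lies between
  \<open>\<bar>r^2 - 1/2\<bar>\<close> and \<open>r^2 + 1/2\<close>.\<close>

lemma cassini_bounds: "((norm q)\<^sup>2 - 1 / 2)\<^sup>2 \<le> cassini q" "cassini q \<le> ((norm q)\<^sup>2 + 1 / 2)\<^sup>2"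
  unfolding cassini_eq norm_sq by (simp_all add: power2_eq_square algebra_simps)

lemma continuous_on_to_complex [continuous_intros]: "continuous_on S g \<Longrightarrow> continuous_on S (\<lambda>x. to_complex (g x))"
  by (rule bounded_linear.continuous_on[OF bounded_linear_to_complex])

lemma continuous_on_focal [continuous_intros]: "continuous_on S g \<Longrightarrow> continuous_on S (\<lambda>x. focal (g x))"
  unfolding focal_def by (intro continuous_intros)

lemma continuous_on_cassini [continuous_intros]: "continuous_on S g \<Longrightarrow> continuous_on S (\<lambda>x. cassini (g x))"
  unfolding cassini_def by (intro continuous_intros)

lemma continuous_on_poly2 [continuous_intros]:
  "continuous_on S g \<Longrightarrow> continuous_on S h \<Longrightarrow> continuous_on S (\<lambda>x. poly2 p (g x) (h x))"
  unfolding poly2_eq_sum_hom_part[OF order_refl] hom_part_def by (intro continuous_intros)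

lemma poly2_differentiable: "(\<lambda>q. poly2 p (fst q) (snd q)) differentiable (at q)"
  unfolding poly2_eq_sum_hom_part[OF order_refl] hom_part_def
  by (intro differentiable_sum differentiable_mult differentiable_power differentiable_const
      bounded_linear_imp_differentiable bounded_linear_fst bounded_linear_snd finite_atMost ballI)

section \<open>The system in the focal coordinate\<close>

locale cassini_system =
  fixes W :: "real poly poly" and c :: real
  assumes W_pos: "\<And>x y. poly2 W x y > 0"
begin

abbreviation f :: "real \<times> real \<Rightarrow> real \<times> real" where
  "f \<equiv> poly_field (sysP W c) (sysQ W c)"

abbreviation k :: real where "k \<equiv> c + 1 / 4"

abbreviation w :: "real \<times> real \<Rightarrow> real" where "w q \<equiv> poly2 W (fst q) (snd q)"

text \<open>The factorization on which the whole proof rests. The fixed points can be read off from it, because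
  the last factor has the positive imaginary part \<open>W\<close>.\<close>

lemma to_complex_field: "to_complex (f q) = 2 * focal q * cnj (to_complex q) * Complex (cassini q - k) (w q)"
proof (cases q)
  case (Pair x y)
  show ?thesis
    unfolding Pair cassini_eq
    by (simp add: complex_eq_iff poly_field_sys focal_def power2_eq_square algebra_simps)
qed

lemma fixed_point_iff: "fixed_point f q \<longleftrightarrow> q = 0 \<or> focal q = 0"
proof -
  have "Complex (cassini q - k) (w q) \<noteq> 0"
    using W_pos[of "fst q" "snd q"] by (simp add: complex_eq_iff)
  then show ?thesis
    unfolding fixed_point_def to_complex_eq_0_iff[symmetric] to_complex_field by auto
qed

text \<open>The chain rule \<open>\<zeta>' = 2 * z * z'\<close> turns the factor \<open>cnj z\<close> of the field into \<open>cmod z ^ 2\<close>. The scalar \<open>a\<close>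
  covers time reversal as well as the time rescaling near the equator.\<close>

lemma focal_derivative:
  assumes "(\<gamma> has_vector_derivative a *\<^sub>R f (\<gamma> t)) (at t within J)"
  shows "((\<lambda>t. focal (\<gamma> t)) has_vector_derivative
    (of_real (4 * a * (norm (\<gamma> t))\<^sup>2) * Complex (cassini (\<gamma> t) - k) (w (\<gamma> t))) * focal (\<gamma> t)) (at t within J)"
proof -
  have d: "((\<lambda>t. to_complex (\<gamma> t)) has_vector_derivative to_complex (a *\<^sub>R f (\<gamma> t))) (at t within J)"
    using bounded_linear.has_vector_derivative[OF bounded_linear_to_complex assms] .
  have n: "of_real ((norm (\<gamma> t))\<^sup>2) = to_complex (\<gamma> t) * cnj (to_complex (\<gamma> t))"
    by (metis complex_norm_square norm_to_complex)
  have "((\<lambda>t. to_complex (\<gamma> t) * to_complex (\<gamma> t) + 1 / 2) has_vector_derivative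
      to_complex (\<gamma> t) * to_complex (a *\<^sub>R f (\<gamma> t)) + to_complex (a *\<^sub>R f (\<gamma> t)) * to_complex (\<gamma> t) + 0) (at t within J)"
    by (intro has_vector_derivative_add has_vector_derivative_mult d has_vector_derivative_const)
  also have "to_complex (\<gamma> t) * to_complex (a *\<^sub>R f (\<gamma> t)) + to_complex (a *\<^sub>R f (\<gamma> t)) * to_complex (\<gamma> t) + 0 =
      of_real (4 * a) * (to_complex (\<gamma> t) * cnj (to_complex (\<gamma> t))) * Complex (cassini (\<gamma> t) - k) (w (\<gamma> t)) * focal (\<gamma> t)"
    unfolding to_complex_scaleR to_complex_field scaleR_conv_of_real by (simp add: mult_ac)
  also have "\<dots> = of_real (4 * a * (norm (\<gamma> t))\<^sup>2) * Complex (cassini (\<gamma> t) - k) (w (\<gamma> t)) * focal (\<gamma> t)"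
    unfolding n[symmetric] by simp
  finally show ?thesis unfolding focal_def power2_eq_square[of "to_complex _"] .
qed

lemma cassini_derivative:
  assumes "(\<gamma> has_vector_derivative a *\<^sub>R f (\<gamma> t)) (at t within J)"
  shows "((\<lambda>t. cassini (\<gamma> t)) has_real_derivative
    8 * a * (norm (\<gamma> t))\<^sup>2 * cassini (\<gamma> t) * (cassini (\<gamma> t) - k)) (at t within J)"
proof -
  have d: "((\<lambda>t. fst (\<gamma> t)) has_real_derivative fst (a *\<^sub>R f (\<gamma> t))) (at t within J)"
      "((\<lambda>t. snd (\<gamma> t)) has_real_derivative snd (a *\<^sub>R f (\<gamma> t))) (at t within J)"
    using bounded_linear.has_vector_derivative[OF bounded_linear_fst assms]
      bounded_linear.has_vector_derivative[OF bounded_linear_snd assms]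
    by (simp_all add: has_real_derivative_iff_has_vector_derivative)
  obtain x y where q: "\<gamma> t = (x, y)" by (cases "\<gamma> t")
  have d': "((\<lambda>t. cassini (\<gamma> t)) has_real_derivative
      2 * x * (2 * x\<^sup>2 + 2 * y\<^sup>2 + 1) * fst (a *\<^sub>R f (\<gamma> t)) + 2 * y * (2 * x\<^sup>2 + 2 * y\<^sup>2 - 1) * snd (a *\<^sub>R f (\<gamma> t)))
      (at t within J)"
    unfolding cassini_eq
    by (rule derivative_eq_intros d refl)+ (simp add: q power2_eq_square algebra_simps)
  have "2 * x * (2 * x\<^sup>2 + 2 * y\<^sup>2 + 1) * (a * (x * (2 * x\<^sup>2 + 2 * y\<^sup>2 + 1) * h - y * (2 * x\<^sup>2 + 2 * y\<^sup>2 - 1) * v)) +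
      2 * y * (2 * x\<^sup>2 + 2 * y\<^sup>2 - 1) * (a * (y * (2 * x\<^sup>2 + 2 * y\<^sup>2 - 1) * h + x * (2 * x\<^sup>2 + 2 * y\<^sup>2 + 1) * v)) =
      8 * a * (x\<^sup>2 + y\<^sup>2) * ((x\<^sup>2 + y\<^sup>2)\<^sup>2 + x\<^sup>2 - y\<^sup>2 + 1 / 4) * h" for h v
    by algebra
  from this[of "cassini (x, y) - k" "poly2 W x y"] d' show ?thesis
    unfolding norm_sq cassini_eq q by (simp add: poly_field_sys)
qed

lemma scaled_field_lipschitz: "\<exists>L. L-lipschitz_on (cball p r) (\<lambda>q. a *\<^sub>R f q)"
proof -
  obtain L where L: "L-lipschitz_on (cball 0 (norm p + r)) f" using poly_field_lipschitz by blast
  have "cball p r \<subseteq> cball 0 (norm p + r)"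
  proof
    fix x assume "x \<in> cball p r"
    then show "x \<in> cball 0 (norm p + r)"
      using norm_triangle_sub[of x p] by (simp add: dist_norm norm_minus_commute)
  qed
  with L have "L-lipschitz_on (cball p r) f" by (rule lipschitz_on_subset)
  from lipschitz_on_cmult[OF this, of a] show ?thesis by blast
qed

section \<open>The saddle at the origin\<close>

text \<open>The linearization at the origin is the symmetric traceless matrix with rows \<open>(- c, W0)\<close> and
  \<open>(W0, c)\<close>, where \<open>W0 = W 0 0 > 0\<close>. Its eigenvalues are \<open>\<plusminus> sqrt (c^2 + W0^2)\<close>.\<close>

lemma saddle_origin: "saddle_point f (0, 0)"
proof -
  obtain D where D: "((\<lambda>q. w q) has_derivative D) (at (0, 0))"
    using poly2_differentiable unfolding differentiable_def by blast
  define W0 where "W0 = poly2 W 0 0"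
  have W0: "W0 > 0" using W_pos by (simp add: W0_def)
  define A where "A = (\<lambda>v :: real \<times> real. (- c * fst v + W0 * snd v, W0 * fst v + c * snd v))"
  have fe: "f = (\<lambda>q.
     (fst q * (2 * (fst q)\<^sup>2 + 2 * (snd q)\<^sup>2 + 1) * (((fst q)\<^sup>2 + (snd q)\<^sup>2)\<^sup>2 + (fst q)\<^sup>2 - (snd q)\<^sup>2 - c) - snd q * (2 * (fst q)\<^sup>2 + 2 * (snd q)\<^sup>2 - 1) * w q,
      snd q * (2 * (fst q)\<^sup>2 + 2 * (snd q)\<^sup>2 - 1) * (((fst q)\<^sup>2 + (snd q)\<^sup>2)\<^sup>2 + (fst q)\<^sup>2 - (snd q)\<^sup>2 - c) + fst q * (2 * (fst q)\<^sup>2 + 2 * (snd q)\<^sup>2 + 1) * w q))"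
    by (rule ext) (metis poly_field_sys prod.collapse)
  have dA: "(f has_derivative A) (at (0, 0))"
    unfolding fe A_def
    by (rule derivative_eq_intros D refl | simp)+ (simp add: W0_def fun_eq_iff)
  define l where "l = sqrt (c\<^sup>2 + W0\<^sup>2)"
  have l2: "l * l = c * c + W0 * W0" unfolding l_def by (simp add: power2_eq_square)
  have l: "l > 0" unfolding l_def using W0 by (simp add: add_nonneg_pos)
  have "A (W0, s * l + c) = (s * l) *\<^sub>R (W0, s * l + c)" if "s * s = 1" for s
  proof -
    have "s * l * (s * l) = l * l" using that by (simp add: mult_ac flip: mult.assoc)
    then show ?thesis using l2 by (simp add: A_def algebra_simps)
  qed
  from this[of 1] this[of "-1"] have "A (W0, l + c) = l *\<^sub>R (W0, l + c)" "A (W0, - l + c) = (- l) *\<^sub>R (W0, - l + c)"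
    by simp_all
  moreover have "(W0, s) \<noteq> 0" for s :: real using W0 by (simp add: zero_prod_def)
  ultimately have ex: "(f has_derivative A) (at (0, 0)) \<and> - l < 0 \<and> 0 < l \<and> (W0, - l + c) \<noteq> 0 \<and> (W0, l + c) \<noteq> 0 \<and>
      A (W0, - l + c) = (- l) *\<^sub>R (W0, - l + c) \<and> A (W0, l + c) = l *\<^sub>R (W0, l + c)"
    using dA l by (intro conjI) simp_all
  have fp: "fixed_point f (0, 0)" by (simp add: fixed_point_iff zero_prod_def)
  show ?thesis
    unfolding saddle_point_def by (rule conjI[OF fp], (rule exI)+, rule ex)
qed

section \<open>The spirals at the foci\<close>

text \<open>Near the focus \<open>p\<close>, the factor \<open>z + p\<close> of \<open>\<zeta>\<close> is close to \<open>2 * p\<close>. Hence \<open>\<zeta>\<close> is comparable with \<open>z - p\<close>,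
  and their arguments differ by a bounded amount. By the equation for \<open>\<zeta>\<close>, its modulus tends to \<open>0\<close>
  and its argument grows at least linearly. The sign \<open>s\<close> is the direction of time. For \<open>k = 0\<close> the decay
  of \<open>R\<close> is driven only by \<open>R' = - 8 * cmod z ^ 2 * R^2\<close>, and the linearization is a center.\<close>

lemma spiral_at_focus:
  assumes p: "focal p = 0" and s: "(s = 1 \<and> k > 0) \<or> (s = -1 \<and> k \<le> 0)"
  shows "stable_spiral (\<lambda>q. s *\<^sub>R f q) p"
proof -
  have cp: "cassini p = 0" using p by (simp add: cassini_def)
  have "(to_complex p)\<^sup>2 = - 1 / 2" using p by (simp add: focal_def eq_neg_iff_add_eq_0)
  then have pp: "to_complex p * to_complex p = - 1 / 2" by (simp add: power2_eq_square)
  have "cmod ((to_complex p)\<^sup>2) = 1 / 2" unfolding \<open>(to_complex p)\<^sup>2 = - 1 / 2\<close> by simp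
  then have np2: "norm p * norm p = 1 / 2" by (simp add: norm_mult norm_to_complex power2_eq_square)
  have np: "7 / 10 < norm p" "norm p < 8 / 10"
  proof -
    show "7 / 10 < norm p"
    proof (rule ccontr)
      assume "\<not> 7 / 10 < norm p"
      then have "norm p * norm p \<le> 7 / 10 * (7 / 10)" by (intro mult_mono) auto
      then show False using np2 by simp
    qed
    show "norm p < 8 / 10"
    proof (rule ccontr)
      assume "\<not> norm p < 8 / 10"
      then have "8 / 10 * (8 / 10) \<le> norm p * norm p" by (intro mult_mono) auto
      then show False using np2 by simp
    qed
  qed
  \<comment> \<open>If \<open>k > 0\<close>, then \<open>R - k \<le> - R\<close> where \<open>R \<le> k / 2\<close>; if \<open>k \<le> 0\<close>, then \<open>k - R \<le> - R\<close> everywhere.\<close>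
  obtain r where r: "0 < r" "r \<le> 1 / 4" "\<And>q. q \<in> cball p r \<Longrightarrow> s * (cassini q - k) \<le> - cassini q"
  proof (cases "k > 0")
    case True
    have "continuous_on UNIV cassini" by (intro continuous_intros)
    then have "isCont cassini p" using continuous_on_eq_continuous_at[OF open_UNIV] by blast
    then obtain d where d: "d > 0" "\<And>q. dist q p < d \<Longrightarrow> dist (cassini q) (cassini p) < k / 2"
      unfolding continuous_at_eps_delta using True by (metis half_gt_zero)
    show ?thesis
    proof (rule that[of "min (1 / 4) (d / 2)"])
      fix q assume "q \<in> cball p (min (1 / 4) (d / 2))"
      then have "dist (cassini q) (cassini p) < k / 2" using d(1) by (intro d(2)) (auto simp: dist_commute)
      then show "s * (cassini q - k) \<le> - cassini q" using True s by (auto simp: cp dist_real_def)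
    qed (use d in auto)
  next
    case False
    show ?thesis by (rule that[of "1 / 4"]) (use False s in auto)
  qed
  define K where "K = cball p r"
  have fac: "focal q = to_complex (q - p) * (to_complex q + to_complex p)" for q
    by (simp add: focal_def to_complex_diff power2_eq_square algebra_simps pp)
  have near: "1 \<le> cmod (to_complex q + to_complex p)" "cmod (to_complex q + to_complex p) \<le> 2" "1 / 8 \<le> (norm q)\<^sup>2" "cmod ((to_complex q - to_complex p) / to_complex p) < 1"
    if "q \<in> K" for q
  proof -
    have d: "cmod (to_complex q - to_complex p) \<le> 1 / 4"
      using that r(2) by (simp add: K_def dist_to_complex dist_commute)
    have "cmod (2 * to_complex p) = 2 * norm p" by (simp add: norm_mult norm_to_complex)
    moreover have "to_complex q + to_complex p = 2 * to_complex p + (to_complex q - to_complex p)" by simp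
    ultimately show "1 \<le> cmod (to_complex q + to_complex p)" "cmod (to_complex q + to_complex p) \<le> 2"
      using norm_triangle_ineq[of "2 * to_complex p" "to_complex q - to_complex p"] norm_diff_ineq[of "2 * to_complex p" "to_complex q - to_complex p"] d np
      by (simp_all only:)
    have "4 / 10 \<le> norm q"
      using norm_triangle_ineq2[of p q] np d by (simp add: dist_to_complex dist_norm norm_minus_commute)
    from mult_mono[OF this this] show "1 / 8 \<le> (norm q)\<^sup>2" by (simp add: power2_eq_square)
    show "cmod ((to_complex q - to_complex p) / to_complex p) < 1"
      using d np by (simp add: norm_divide norm_to_complex divide_less_eq)
  qed
  have cas: "(dist q p)\<^sup>2 \<le> cassini q" "cassini q \<le> 4 * (dist q p)\<^sup>2" if "q \<in> K" for q
  proof -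
    have e: "cassini q = (dist q p)\<^sup>2 * (cmod (to_complex q + to_complex p))\<^sup>2"
      unfolding cassini_def fac by (simp add: norm_mult power_mult_distrib norm_to_complex dist_norm)
    have "1 \<le> (cmod (to_complex q + to_complex p))\<^sup>2" "(cmod (to_complex q + to_complex p))\<^sup>2 \<le> 4"
      using near[OF that] power_mono[of 1 "cmod (to_complex q + to_complex p)" 2] power_mono[of "cmod (to_complex q + to_complex p)" 2 2] by auto
    then show "(dist q p)\<^sup>2 \<le> cassini q" "cassini q \<le> 4 * (dist q p)\<^sup>2"
      unfolding e using mult_left_mono[of _ _ "(dist q p)\<^sup>2"] by fastforce+
  qed
  have dec: "8 * s * (norm q)\<^sup>2 * cassini q * (cassini q - k) \<le> - (cassini q)\<^sup>2" if "q \<in> K" for q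
  proof -
    have "8 * s * (norm q)\<^sup>2 * cassini q * (cassini q - k) = (8 * (norm q)\<^sup>2 * cassini q) * (s * (cassini q - k))"
      by simp
    also have "\<dots> \<le> (8 * (norm q)\<^sup>2 * cassini q) * (- cassini q)"
      using r(3)[of q] that cassini_nonneg[of q] by (intro mult_left_mono) (auto simp: K_def)
    also have "\<dots> = - (8 * (norm q)\<^sup>2) * (cassini q)\<^sup>2" by (simp add: power2_eq_square)
    also have "\<dots> \<le> - 1 * (cassini q)\<^sup>2" using near(3)[OF that] by (intro mult_right_mono) auto
    finally show ?thesis by simp
  qed
  have pK: "p \<in> K" using r by (simp add: K_def)
  have "compact K" unfolding K_def by simp
  moreover have "K \<noteq> {}" using pK by auto
  moreover have "continuous_on K (\<lambda>q. w q)" by (intro continuous_intros)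
  ultimately obtain q0 where q0: "\<And>q. q \<in> K \<Longrightarrow> w q0 \<le> w q"
    using continuous_attains_inf[of K "\<lambda>q. w q"] by blast
  define \<mu> where "\<mu> = w q0"
  have \<mu>: "\<mu> > 0" "\<And>q. q \<in> K \<Longrightarrow> \<mu> \<le> w q" using q0 W_pos by (auto simp: \<mu>_def)
  show ?thesis
    unfolding stable_spiral_def
  proof (intro conjI exI[of _ "r / 2"] allI impI)
    show "fixed_point (\<lambda>q. s *\<^sub>R f q) p"
      using fixed_point_iff[of p] p by (simp add: fixed_point_def)
    show "0 < r / 2" using r by simp
    fix q assume q: "0 < dist q p \<and> dist q p < r / 2"
    obtain L where L: "L-lipschitz_on K (\<lambda>q. s *\<^sub>R f q)" using scaled_field_lipschitz unfolding K_def by blast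
    show "forward_trajectory (\<lambda>q. s *\<^sub>R f q) q (\<lambda>\<gamma>. (\<gamma> \<longlongrightarrow> p) at_top \<and> spirals_around \<gamma> p)"
    proof (rule forward_trajectoryI[OF _ _ L])
      show "closed K" "convex K" by (simp_all add: K_def)
      show "q \<in> interior K" using q r by (simp add: K_def interior_cball dist_commute)
    next
      fix \<gamma> T assume T: "T > 0" and \<gamma>: "solves (\<lambda>q. s *\<^sub>R f q) \<gamma> {0..T}" "\<gamma> 0 = q"
        and K: "\<And>t. t \<in> {0..T} \<Longrightarrow> \<gamma> t \<in> K"
      have "cassini (\<gamma> T) \<le> cassini (\<gamma> 0)"
      proof (rule nonincreasing_of_derivative[of 0 T "{0..T}" _
            "\<lambda>t. 8 * s * (norm (\<gamma> t))\<^sup>2 * cassini (\<gamma> t) * (cassini (\<gamma> t) - k)"])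
        fix t assume t: "t \<in> {0..T}"
        show "((\<lambda>t. cassini (\<gamma> t)) has_real_derivative
            8 * s * (norm (\<gamma> t))\<^sup>2 * cassini (\<gamma> t) * (cassini (\<gamma> t) - k)) (at t within {0..T})"
          using \<gamma>(1) t by (intro cassini_derivative) (auto simp: solves_def)
        show "8 * s * (norm (\<gamma> t))\<^sup>2 * cassini (\<gamma> t) * (cassini (\<gamma> t) - k) \<le> 0"
          using dec[OF K[OF t]] zero_le_power2[of "cassini (\<gamma> t)"] by linarith
      qed (use T in auto)
      moreover have "q \<in> K" "\<gamma> T \<in> K" using K[of 0] K[of T] \<gamma>(2) T by auto
      ultimately have "(dist (\<gamma> T) p)\<^sup>2 \<le> 4 * (dist q p)\<^sup>2"
        using cas(1)[of "\<gamma> T"] cas(2)[of q] \<gamma>(2) by simp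
      also have "\<dots> = (2 * dist q p)\<^sup>2" by simp
      also have "\<dots> < r\<^sup>2" using q r by (intro power_strict_mono) auto
      finally have "dist (\<gamma> T) p < r" using r by (simp add: power2_less_imp_less)
      then show "\<gamma> T \<in> interior K" by (simp add: K_def interior_cball dist_commute)
    next
      fix \<gamma> assume \<gamma>: "solves (\<lambda>q. s *\<^sub>R f q) \<gamma> {0..}" "\<gamma> 0 = q" and K: "\<And>t. t \<ge> 0 \<Longrightarrow> \<gamma> t \<in> K"
      have c\<gamma>: "continuous_on {0..} \<gamma>" using \<gamma>(1) by (rule solves_continuous_on)
      have lim0: "((\<lambda>t. cassini (\<gamma> t)) \<longlongrightarrow> 0) at_top"
      proof (rule tendsto_0_of_negative_derivative)
        fix t :: real assume t: "t \<ge> 0"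
        show "((\<lambda>t. cassini (\<gamma> t)) has_real_derivative
            8 * s * (norm (\<gamma> t))\<^sup>2 * cassini (\<gamma> t) * (cassini (\<gamma> t) - k)) (at t within {0..})"
          using \<gamma>(1) t by (intro cassini_derivative) (auto simp: solves_def)
        show "8 * s * (norm (\<gamma> t))\<^sup>2 * cassini (\<gamma> t) * (cassini (\<gamma> t) - k) \<le> 0"
          using dec[OF K[OF t]] zero_le_power2[of "cassini (\<gamma> t)"] by linarith
      next
        fix e :: real assume e: "e > 0"
        have "8 * s * (norm (\<gamma> t))\<^sup>2 * cassini (\<gamma> t) * (cassini (\<gamma> t) - k) \<le> - e\<^sup>2"
          if "t \<ge> 0" "e \<le> cassini (\<gamma> t)" for t
          using dec[OF K[OF that(1)]] power_mono[OF that(2), of 2] e by linarith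
        then show "\<exists>m>0. \<forall>t\<ge>0. e \<le> cassini (\<gamma> t) \<longrightarrow>
            8 * s * (norm (\<gamma> t))\<^sup>2 * cassini (\<gamma> t) * (cassini (\<gamma> t) - k) \<le> - m"
          using e by (intro exI[of _ "e\<^sup>2"]) auto
      qed (rule cassini_nonneg)
      have "((\<lambda>t. dist (\<gamma> t) p) \<longlongrightarrow> 0) at_top"
      proof (rule Lim_null_comparison)
        show "((\<lambda>t. sqrt (cassini (\<gamma> t))) \<longlongrightarrow> 0) at_top" using tendsto_real_sqrt[OF lim0] by simp
        show "\<forall>\<^sub>F t in at_top. norm (dist (\<gamma> t) p) \<le> sqrt (cassini (\<gamma> t))"
          using eventually_ge_at_top[of "0::real"]
          by eventually_elim (use cas(1)[OF K] in \<open>simp add: real_le_rsqrt\<close>)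
      qed
      then have lim: "(\<gamma> \<longlongrightarrow> p) at_top" by (rule tendsto_dist_iff[THEN iffD2])
      define h where "h = (\<lambda>t. of_real (4 * s * (norm (\<gamma> t))\<^sup>2) * Complex (cassini (\<gamma> t) - k) (w (\<gamma> t)))"
      have ch: "continuous_on {0..} h"
        unfolding h_def Complex_eq by (intro continuous_intros c\<gamma>)
      have dfocal: "((\<lambda>t. focal (\<gamma> t)) has_vector_derivative h t * focal (\<gamma> t)) (at t within {0..})" if "t \<in> {0..}" for t
        unfolding h_def using \<gamma>(1) that by (intro focal_derivative) (auto simp: solves_def)
 have J: "closed {0::real..}" "convex {0::real..}" "(0::real) \<in> {0..}" by auto
      obtain A where A: "\<And>t. t \<in> {0..} \<Longrightarrow> (A has_vector_derivative h t) (at t within {0..})"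
        "\<And>t. t \<in> {0..} \<Longrightarrow> focal (\<gamma> t) = focal (\<gamma> 0) * exp (A t)"
        using linear_ode_solution[OF J ch dfocal] by blast
      have cA: "continuous_on {0..} A" using A(1) by (rule continuous_on_vector_derivative)
      have w0: "focal (\<gamma> 0) \<noteq> 0" using cas(1)[of q] q K[of 0] \<gamma>(2) by (auto simp: cassini_def)
      have p0: "to_complex p \<noteq> 0" using pp by auto
      define n where "n = (\<lambda>t. (to_complex (\<gamma> t) + to_complex p) / to_complex p)"
      have Re_n: "Re (n t) > 0" if "t \<ge> 0" for t
      proof -
        have "n t = 2 + (to_complex (\<gamma> t) - to_complex p) / to_complex p" using p0 by (simp add: n_def field_simps)
        then have "Re (n t) \<ge> 2 - cmod ((to_complex (\<gamma> t) - to_complex p) / to_complex p)"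
          using abs_Re_le_cmod[of "(to_complex (\<gamma> t) - to_complex p) / to_complex p"] by simp
        then show ?thesis using near(4)[OF K[OF that]] by linarith
      qed
      have n_nz: "n t \<notin> \<real>\<^sub>\<le>\<^sub>0" "n t \<noteq> 0" if "t \<ge> 0" for t
        using Re_n[OF that] by (auto simp: complex_nonpos_Reals_iff)
      have cn: "continuous_on {0..} n" unfolding n_def using p0 by (intro continuous_intros c\<gamma>) auto
      \<comment> \<open>A continuous logarithm of \<open>z - p = \<zeta> / (z + p)\<close>; the principal branch is continuous along \<open>n\<close>, which stays in the right half plane.\<close>
      define E where "E = (\<lambda>t. Ln (focal (\<gamma> 0)) + A t - Ln (n t) - Ln (to_complex p))"
      have E: "to_complex (\<gamma> t - p) = exp (E t)" if "t \<ge> 0" for t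
      proof -
        have "exp (E t) = focal (\<gamma> 0) * exp (A t) / (n t * to_complex p)"
          using w0 p0 n_nz[OF that] by (simp add: E_def exp_add exp_diff)
        also have "focal (\<gamma> 0) * exp (A t) = focal (\<gamma> t)" using A(2)[of t] that by (simp only: atLeast_iff)
        also have "focal (\<gamma> t) = to_complex (\<gamma> t - p) * (n t * to_complex p)" using p0 by (simp add: fac n_def)
        finally show ?thesis using n_nz(2)[OF that] p0 by simp
      qed
      have cE: "continuous_on {0..} E"
        unfolding E_def using n_nz by (intro continuous_intros cA cn) auto
      have dIm: "((\<lambda>t. s * Im (A t)) has_real_derivative 4 * (norm (\<gamma> t))\<^sup>2 * w (\<gamma> t)) (at t within {0..})"
        if "t \<in> {0..}" for t
      proof -
        have "((\<lambda>t. Im (A t)) has_real_derivative Im (h t)) (at t within {0..})"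
          using bounded_linear.has_vector_derivative[OF bounded_linear_Im A(1)[OF that]]
          by (simp add: has_real_derivative_iff_has_vector_derivative)
        moreover have "s * Im (h t) = 4 * (norm (\<gamma> t))\<^sup>2 * w (\<gamma> t)" using s by (auto simp: h_def)
        ultimately show ?thesis using DERIV_cmult[of "\<lambda>t. Im (A t)" "Im (h t)" t "{0..}" s] by simp
      qed
      have grow: "s * Im (A 0) + \<mu> / 2 * t \<le> s * Im (A t)" if "t \<ge> 0" for t
      proof -
        have "s * Im (A 0) - \<mu> / 2 * 0 \<le> s * Im (A t) - \<mu> / 2 * t"
        proof (rule nondecreasing_of_derivative[of 0 t "{0..}" _ "\<lambda>t. 4 * (norm (\<gamma> t))\<^sup>2 * w (\<gamma> t) - \<mu> / 2"])
          fix u :: real assume u: "u \<in> {0..}"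
          show "((\<lambda>t. s * Im (A t) - \<mu> / 2 * t) has_real_derivative 4 * (norm (\<gamma> u))\<^sup>2 * w (\<gamma> u) - \<mu> / 2) (at u within {0..})"
            by (rule derivative_eq_intros dIm[OF u] refl)+ simp
          have "4 * (1 / 8) * \<mu> \<le> 4 * (norm (\<gamma> u))\<^sup>2 * w (\<gamma> u)"
            using near(3)[OF K] \<mu>(1) \<mu>(2)[OF K] u by (intro mult_mono) auto
          then show "0 \<le> 4 * (norm (\<gamma> u))\<^sup>2 * w (\<gamma> u) - \<mu> / 2" by simp
        qed (use that in auto)
        then show ?thesis by simp
      qed
      define C where "C = \<bar>Im (Ln (focal (\<gamma> 0)))\<bar> + \<bar>s * Im (A 0)\<bar> + pi + \<bar>Im (Ln (to_complex p))\<bar>"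
      have big: "- C + \<mu> / 2 * t \<le> norm (Im (E t))" if "t \<ge> 0" for t
      proof -
        have "\<bar>Im (Ln (n t))\<bar> \<le> pi"
          using mpi_less_Im_Ln[OF n_nz(2)[OF that]] Im_Ln_le_pi[OF n_nz(2)[OF that]] by linarith
        moreover have "\<bar>s * Im (A t)\<bar> = \<bar>Im (A t)\<bar>" using s by auto
        ultimately show ?thesis using grow[OF that] unfolding E_def C_def by simp
      qed
      have "spirals_around \<gamma> p"
        unfolding spirals_around_def
      proof (intro exI[of _ "\<lambda>t. Im (E t)"] conjI allI impI)
        show "continuous_on {0..} (\<lambda>t. Im (E t))" by (intro continuous_intros cE)
        fix t :: real assume t: "t \<ge> 0"
        have "to_complex (\<gamma> t - p) \<noteq> 0" using E[OF t] by simp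
        then show "\<gamma> t \<noteq> p" by (auto simp: to_complex_eq_0_iff)
        have "norm (\<gamma> t - p) = exp (Re (E t))" using E[OF t] by (simp flip: norm_to_complex)
        then have "to_complex (\<gamma> t - p) = to_complex (norm (\<gamma> t - p) *\<^sub>R (cos (Im (E t)), sin (Im (E t))))"
          using E[OF t] by (simp add: complex_eq_iff Re_exp Im_exp)
        then show "\<gamma> t - p = norm (\<gamma> t - p) *\<^sub>R (cos (Im (E t)), sin (Im (E t)))"
          by (simp only: to_complex_eq_iff)
      next
        have "filterlim (\<lambda>t. - C + \<mu> / 2 * t) at_top at_top"
          using \<mu>(1) by (intro filterlim_tendsto_add_at_top[OF tendsto_const]
            filterlim_tendsto_pos_mult_at_top[OF tendsto_const] filterlim_ident) auto
        then have "filterlim (\<lambda>t. norm (Im (E t))) at_top at_top"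
          by (rule filterlim_at_top_mono)
             (use eventually_ge_at_top[of "0::real"] in \<open>eventually_elim, use big in blast\<close>)
        then show "filterlim (\<lambda>t. Im (E t)) at_infinity at_top"
          by (rule filterlim_norm_at_top_imp_at_infinity)
      qed
      with lim show "(\<gamma> \<longlongrightarrow> p) at_top \<and> spirals_around \<gamma> p" by blast
    qed
  qed
qed

end

section \<open>Cassini ovals\<close>

definition of_complex :: "complex \<Rightarrow> real \<times> real" where
  "of_complex z = (Re z, Im z)"

lemma to_complex_of_complex [simp]: "to_complex (of_complex z) = z" and of_complex_to_complex [simp]: "of_complex (to_complex q) = q"
  by (simp_all add: of_complex_def to_complex_def)

lemma norm_of_complex [simp]: "norm (of_complex z) = cmod z"
  by (simp flip: norm_to_complex)

lemma bounded_linear_of_complex: "bounded_linear of_complex"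
  unfolding of_complex_def by (intro bounded_linear_Pair bounded_linear_Re bounded_linear_Im)

lemma cassini_origin [simp]: "cassini (0, 0) = 1 / 4"
  by (simp add: cassini_eq)

lemma cassini_uminus [simp]: "cassini (- q) = cassini q"
  by (simp add: cassini_eq)

text \<open>If \<open>r^2 > M + 2\<close>, then \<open>(r^2 - 1/2)^2 > M + 1\<close>, against the lower bound for \<open>cassini\<close>.\<close>

lemma norm_sq_le_of_cassini: "cassini q \<le> M \<Longrightarrow> (norm q)\<^sup>2 \<le> M + 2"
proof (rule ccontr)
  assume a: "cassini q \<le> M" "\<not> (norm q)\<^sup>2 \<le> M + 2"
  have "M \<ge> 0" using a(1) cassini_nonneg[of q] by linarith
  then have "(norm q)\<^sup>2 - 1 / 2 > M + 1" "M + 1 \<ge> 1" using a(2) by linarith+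
  then have "((norm q)\<^sup>2 - 1 / 2)\<^sup>2 > (M + 1) * 1"
    unfolding power2_eq_square by (intro mult_strict_mono') auto
  then have "(M + 1) * 1 < cassini q" using cassini_bounds(1) by (rule less_le_trans)
  then show False using a(1) by simp
qed

lemma compact_cassini_le: "compact {q. cassini q \<le> M}"
proof -
  have "bounded {q. cassini q \<le> M}"
  proof (rule boundedI)
    fix q assume "q \<in> {q. cassini q \<le> M}"
    then have "(norm q)\<^sup>2 \<le> M + 2" using norm_sq_le_of_cassini by blast
    then show "norm q \<le> sqrt (M + 2)" by (rule real_le_rsqrt)
  qed
  moreover have "closed {q. cassini q \<le> M}"
    by (intro closed_Collect_le continuous_intros)
  ultimately show ?thesis by (simp add: compact_eq_bounded_closed)
qed

lemma compact_cassini_level: "compact {q. cassini q = M}"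
proof -
  have "closed {q. cassini q = M}" by (intro closed_Collect_eq continuous_intros)
  then have "compact ({q. cassini q \<le> M} \<inter> {q. cassini q = M})" using compact_cassini_le by (rule compact_Int_closed[rotated])
  moreover have "{q. cassini q \<le> M} \<inter> {q. cassini q = M} = {q. cassini q = M}" by auto
  ultimately show ?thesis by simp
qed

lemma focal_polar:
  assumes "cassini q = k" "k > 0"
  obtains \<theta> where "0 \<le> \<theta>" "\<theta> < 2 * pi" "focal q = sqrt k * cis \<theta>"
proof (rule that[of "Arg2pi (focal q)"])
  have "cmod (focal q) = sqrt k" using assms by (simp add: cassini_def real_sqrt_unique)
  then show "focal q = sqrt k * cis (Arg2pi (focal q))"
    using Arg2pi_eq[of "focal q"] by (simp add: cis_conv_exp)
qed (use Arg2pi in auto)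

lemma cis_has_vector_derivative:
  assumes "(\<phi> has_real_derivative \<psi>) (at u)"
  shows "((\<lambda>u. cis (\<phi> u)) has_vector_derivative \<i> * of_real \<psi> * cis (\<phi> u)) (at u)"
proof -
  have "((\<lambda>u. \<i> * of_real (\<phi> u)) has_vector_derivative \<i> * of_real \<psi>) (at u)"
    using assms
    by (intro has_vector_derivative_mult_right has_vector_derivative_of_real)
       (simp add: has_real_derivative_iff_has_vector_derivative)
  from field_vector_diff_chain_at[OF this DERIV_exp]
  show ?thesis by (simp add: o_def cis_conv_exp)
qed

lemma csqrt_right_half_plane:
  assumes "Re a > 0"
  shows "a \<notin> \<real>\<^sub>\<le>\<^sub>0" "Re (csqrt a) > 0"
proof -
  show "a \<notin> \<real>\<^sub>\<le>\<^sub>0" using assms by (auto simp: complex_nonpos_Reals_iff)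
  define s where "s = csqrt a"
  have "s * s = a" by (simp add: s_def flip: power2_eq_square)
  then have "Re (s * s) > 0" using assms by simp
  then have "Re s \<noteq> 0" by (auto simp: not_less)
  then show "Re (csqrt a) > 0" using csqrt_principal[of a] unfolding s_def by blast
qed

text \<open>A lift of the circle \<open>\<zeta> = sqrt k * cis \<theta>\<close>. While the circle stays to the left of the branch point \<open>1/2\<close>,
  the radicand lies in the right half plane, where the principal square root is smooth. The factor
  \<open>\<sigma> = \<plusminus> 1\<close> selects the upper or the lower oval.\<close>

definition oval :: "real \<Rightarrow> real \<Rightarrow> real \<Rightarrow> complex" where
  "oval \<sigma> k \<theta> = of_real \<sigma> * (\<i> * csqrt (1 / 2 - sqrt k * cis \<theta>))"

lemma oval_focal:
  assumes "\<sigma> * \<sigma> = 1"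
  shows "(oval \<sigma> k \<theta>)\<^sup>2 + 1 / 2 = sqrt k * cis \<theta>"
proof -
  have "(complex_of_real \<sigma>)\<^sup>2 = 1" using assms by (metis of_real_1 of_real_power power2_eq_square)
  then show ?thesis by (simp add: oval_def power_mult_distrib)
qed

lemma oval_side:
  assumes "\<sigma> * \<sigma> = 1" "sqrt k * cos \<theta> < 1 / 2"
  shows "\<sigma> * Im (oval \<sigma> k \<theta>) > 0"
proof -
  have "\<sigma> * Im (oval \<sigma> k \<theta>) = (\<sigma> * \<sigma>) * Re (csqrt (1 / 2 - sqrt k * cis \<theta>))" by (simp add: oval_def)
  then show ?thesis using csqrt_right_half_plane(2)[of "1 / 2 - sqrt k * cis \<theta>"] assms by simp
qed

lemma oval_differentiable:
  assumes \<phi>: "(\<phi> has_real_derivative \<psi>) (at u)" and "sqrt k * cos (\<phi> u) < 1 / 2"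
  shows "\<exists>d. ((\<lambda>u. oval \<sigma> k (\<phi> u)) has_vector_derivative d) (at u)"
proof -
  have "((\<lambda>u. 1 / 2 - sqrt k * cis (\<phi> u)) has_vector_derivative 0 - sqrt k * (\<i> * of_real \<psi> * cis (\<phi> u))) (at u)"
    by (intro has_vector_derivative_diff has_vector_derivative_const has_vector_derivative_mult_right
        cis_has_vector_derivative \<phi>)
  from field_vector_diff_chain_at[OF this has_field_derivative_csqrt] csqrt_right_half_plane(1)[of "1 / 2 - sqrt k * cis (\<phi> u)"] assms(2)
  have "((\<lambda>u. csqrt (1 / 2 - sqrt k * cis (\<phi> u))) has_vector_derivative
      (0 - sqrt k * (\<i> * of_real \<psi> * cis (\<phi> u))) * inverse (2 * csqrt (1 / 2 - sqrt k * cis (\<phi> u)))) (at u)"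
    by (simp add: o_def)
  from has_vector_derivative_mult_right[OF has_vector_derivative_mult_right[OF this, of \<i>], of "complex_of_real \<sigma>"]
  show ?thesis unfolding oval_def by (rule exI)
qed

lemma oval_unique:
  assumes s: "\<sigma> * \<sigma> = 1" and q: "focal q = sqrt k * cis \<theta>" "\<sigma> * snd q > 0" and lt: "sqrt k * cos \<theta> < 1 / 2"
  shows "q = of_complex (oval \<sigma> k \<theta>)"
proof -
  have "(to_complex q)\<^sup>2 = (oval \<sigma> k \<theta>)\<^sup>2"
    using oval_focal[OF s, of k \<theta>] q(1) unfolding focal_def by (metis add_right_cancel)
  then consider "to_complex q = oval \<sigma> k \<theta>" | "to_complex q = - oval \<sigma> k \<theta>" by (auto simp: power2_eq_iff)
  then have "to_complex q = oval \<sigma> k \<theta>"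
  proof cases
    case 2
    then have "snd q = - Im (oval \<sigma> k \<theta>)" by (metis to_complex_simps(2) uminus_complex.simps(2))
    then show ?thesis using oval_side[OF s lt] q(2) by simp
  qed
  then show ?thesis by (metis of_complex_to_complex)
qed

text \<open>A lift of the circle \<open>\<zeta> = sqrt k * cis \<theta>\<close> when it encloses the branch point: taking \<open>cis \<theta>\<close> out of the
  root \<open>sqrt (\<zeta> - 1/2)\<close> leaves a radicand in the right half plane, and the half angle gives the curve
  the period \<open>4 * pi\<close>.\<close>

definition loop :: "real \<Rightarrow> real \<Rightarrow> complex" where
  "loop k \<theta> = cis (\<theta> / 2) * csqrt (sqrt k - cis (- \<theta>) / 2)"

lemma loop_focal: "(loop k \<theta>)\<^sup>2 + 1 / 2 = sqrt k * cis \<theta>"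
proof -
  have "(loop k \<theta>)\<^sup>2 = cis \<theta> * (sqrt k - cis (- \<theta>) / 2)"
  proof -
    have "(cis (\<theta> / 2))\<^sup>2 = cis \<theta>" unfolding power2_eq_square cis_mult by simp
    then show ?thesis by (simp add: loop_def power_mult_distrib)
  qed
  also have "\<dots> = sqrt k * cis \<theta> - (cis \<theta> * cis (- \<theta>)) / 2" by (simp add: algebra_simps)
  also have "cis \<theta> * cis (- \<theta>) = 1" by (simp add: cis_mult)
  finally show ?thesis by simp
qed

lemma loop_shift: "loop k (\<theta> + 2 * pi) = - loop k \<theta>"
proof -
  have "cis (- (\<theta> + 2 * pi)) = cis (- \<theta>)" by (simp add: complex_eq_iff del: minus_add_distrib)
  moreover have "cis ((\<theta> + 2 * pi) / 2) = - cis (\<theta> / 2)" by (simp add: complex_eq_iff add_divide_distrib)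
  ultimately show ?thesis by (simp add: loop_def)
qed

lemma loop_differentiable:
  assumes "sqrt k > 1 / 2"
  shows "\<exists>d. (loop k has_vector_derivative d) (at u)"
proof -
  have p: "Re (sqrt k - cis (- u) / 2) > 0" proof -
    have "Re (sqrt k - cis (- u) / 2) = sqrt k - cos u / 2" by simp
    then show ?thesis using assms cos_le_one[of u] by linarith
  qed
  have d: "((\<lambda>u. sqrt k - cis (- u) / 2) has_vector_derivative 0 - (\<i> * of_real (-1) * cis (- u)) / 2) (at u)"
    by (intro has_vector_derivative_diff has_vector_derivative_const has_vector_derivative_divide
        cis_has_vector_derivative) (auto intro!: derivative_eq_intros)
  from field_vector_diff_chain_at[OF this has_field_derivative_csqrt[OF csqrt_right_half_plane(1)[OF p]]]
  obtain d where d: "((\<lambda>u. csqrt (sqrt k - cis (- u) / 2)) has_vector_derivative d) (at u)"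
    by (auto simp: o_def)
  have "((\<lambda>u. cis (u / 2)) has_vector_derivative \<i> * of_real (1 / 2) * cis (u / 2)) (at u)"
    by (intro cis_has_vector_derivative) (auto intro!: derivative_eq_intros)
  from has_vector_derivative_mult[OF this d] show ?thesis unfolding loop_def[abs_def] by (rule exI)
qed

text \<open>On the horizontal axis \<open>R = (x^2 + 1/2)^2\<close>, so that \<open>R \<le> 1/4\<close> leaves only the saddle. This separates
  the two ovals.\<close>

lemma cassini_le_quarter:
  assumes "cassini q \<le> 1 / 4" "snd q = 0"
  shows "q = (0, 0)"
proof -
  have "((fst q)\<^sup>2)\<^sup>2 + (fst q)\<^sup>2 \<le> 0" using assms by (simp add: cassini_eq)
  then have "(fst q)\<^sup>2 \<le> 0" using zero_le_power2[of "(fst q)\<^sup>2"] by linarith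
  then show "q = (0, 0)" using \<open>snd q = 0\<close> by (simp add: prod_eq_iff)
qed

lemma cassini_less_quarter: "cassini q < 1 / 4 \<Longrightarrow> snd q \<noteq> 0"
  using cassini_le_quarter[of q] by fastforce

text \<open>The set \<open>C\<close> is the oval, or the lobe together with the saddle if \<open>k = 1/4\<close>. One focus lies in the
  bounded set that \<open>C\<close> bounds; from the other one a vertical ray runs to infinity in the opposite half
  plane.\<close>

lemma oval_inside:
  assumes s: "\<sigma> * \<sigma> = 1" and k: "0 < k" "k \<le> 1 / 4"
    and C: "{q. cassini q = k \<and> \<sigma> * snd q > 0} \<subseteq> C" "C \<subseteq> insert (0, 0) {q. cassini q = k \<and> \<sigma> * snd q > 0}"
      "k = 1 / 4 \<Longrightarrow> (0, 0) \<in> C"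
  shows "(0, \<sigma> / sqrt 2) \<in> inside C" "(0, - (\<sigma> / sqrt 2)) \<notin> inside C"
proof -
  define D where "D = {q. cassini q < k \<and> \<sigma> * snd q > 0}"
  have s0: "\<sigma> \<noteq> 0" using s by auto
  have cp: "cassini (0, \<sigma> / sqrt 2) = 0"
    using s by (simp add: cassini_eq power_divide power2_eq_square[of \<sigma>])
  have "D = {q. cassini q < k} \<inter> {q. 0 < \<sigma> * snd q}" by (auto simp: D_def)
  then have oD: "open D" by (auto intro!: open_Int open_Collect_less continuous_intros)
  have "closed {q. cassini q \<le> k \<and> \<sigma> * snd q \<ge> 0}"
    by (intro closed_Collect_conj closed_Collect_le continuous_intros)
  then have clD: "closure D \<subseteq> {q. cassini q \<le> k \<and> \<sigma> * snd q \<ge> 0}"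
    by (intro closure_minimal) (auto simp: D_def)
  show "(0, \<sigma> / sqrt 2) \<in> inside C"
  proof (rule in_inside_if_frontier_subset[of D])
    show "bounded D"
      by (rule bounded_subset[OF compact_imp_bounded[OF compact_cassini_le[of k]]]) (auto simp: D_def)
    show "frontier D \<subseteq> C"
    proof
      fix q assume "q \<in> frontier D"
      then have q: "cassini q \<le> k" "\<sigma> * snd q \<ge> 0" "q \<notin> D"
        using clD oD by (auto simp: frontier_def interior_open)
      show "q \<in> C"
      proof (cases "snd q = 0")
        case True
        then have "q = (0, 0)" using cassini_le_quarter[of q] q(1) k(2) by linarith
        moreover from this have "k = 1 / 4" using q(1) k(2) by simp
        ultimately show ?thesis using C(3) by simp
      next
        case False
        then have "\<sigma> * snd q > 0" using q(2) s0 by (simp add: order_less_le)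
        then show ?thesis using q C(1) by (auto simp: D_def)
      qed
    qed
    show "(0, \<sigma> / sqrt 2) \<in> D" using k s by (simp add: D_def cp)
    show "(0, \<sigma> / sqrt 2) \<notin> C" using C(2) cp k s0 by auto
  qed
  show "(0, - (\<sigma> / sqrt 2)) \<notin> inside C"
  proof (rule not_in_inside_if_ray[of "(0, - \<sigma>)"])
    show "(0, - \<sigma>) \<noteq> 0" using s0 by (simp add: zero_prod_def)
    fix t :: real assume t: "t \<ge> 0"
    have "\<sigma> * snd ((0, - (\<sigma> / sqrt 2)) + t *\<^sub>R (0, - \<sigma>)) = - (\<sigma> * \<sigma>) * (1 / sqrt 2 + t)"
      by (simp add: algebra_simps)
    also have "\<dots> < 0"
    proof -
      have "1 / sqrt 2 + t > 0" using t by (intro add_pos_nonneg) auto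
      then show ?thesis using s by simp
    qed
    finally have "\<sigma> * snd ((0, - (\<sigma> / sqrt 2)) + t *\<^sub>R (0, - \<sigma>)) < 0" .
    then show "(0, - (\<sigma> / sqrt 2)) + t *\<^sub>R (0, - \<sigma>) \<notin> C" using C(2) by auto
  qed
qed

section \<open>Closed and homoclinic orbits as level curves\<close>

context cassini_system
begin

lemma level_distance_derivative:
  assumes "(\<gamma> has_vector_derivative a *\<^sub>R f (\<gamma> t)) (at t within J)"
  shows "((\<lambda>t. (cassini (\<gamma> t) - k)\<^sup>2) has_real_derivative
    a * (16 * (norm (\<gamma> t))\<^sup>2 * cassini (\<gamma> t) * (cassini (\<gamma> t) - k)\<^sup>2)) (at t within J)"
  by (rule derivative_eq_intros cassini_derivative assms refl)+ (simp add: power2_eq_square)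

lemma level_distance_nondecreasing:
  assumes "solves f \<gamma> UNIV" "s \<le> t"
  shows "(cassini (\<gamma> s) - k)\<^sup>2 \<le> (cassini (\<gamma> t) - k)\<^sup>2"
proof (rule nondecreasing_of_derivative[OF assms(2), where J = UNIV])
  show "((\<lambda>t. (cassini (\<gamma> t) - k)\<^sup>2) has_real_derivative
    1 * (16 * (norm (\<gamma> t))\<^sup>2 * cassini (\<gamma> t) * (cassini (\<gamma> t) - k)\<^sup>2)) (at t)" for t
    using assms(1) by (intro level_distance_derivative) (simp add: solves_def)
qed (use cassini_nonneg in auto)

text \<open>A nondecreasing periodic function is constant. If the constant value of \<open>(R - k)^2\<close> were not \<open>0\<close>, then
  its derivative could vanish only because the orbit consists of fixed points.\<close>

lemma closed_orbit_on_level: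
  assumes "closed_orbit f C"
  shows "C \<subseteq> {q. cassini q = k}"
proof -
  obtain \<gamma> T t1 where \<gamma>: "solves f \<gamma> UNIV" "T > 0" "\<And>t. \<gamma> (t + T) = \<gamma> t" "\<gamma> t1 \<noteq> \<gamma> 0" "C = range \<gamma>"
    using assms unfolding closed_orbit_def by blast
  define D where "D = (\<lambda>t. (cassini (\<gamma> t) - k)\<^sup>2)"
  have mono: "D s \<le> D t" if "s \<le> t" for s t
    using level_distance_nondecreasing[OF \<gamma>(1) that] by (simp add: D_def)
  have per: "\<gamma> (t + real n * T) = \<gamma> t" for t n
  proof (induction n)
    case (Suc n)
    then show ?case using \<gamma>(3)[of "t + real n * T"] by (simp add: algebra_simps)
  qed simp
  have D: "D s = D t" if "s \<le> t" for s t
  proof -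
    obtain n where "t - s < real n * T" using reals_Archimedean3[OF \<gamma>(2)] by blast
    then have "D t \<le> D (s + real n * T)" by (intro mono) simp
    also have "\<dots> = D s" by (simp add: D_def per)
    finally show ?thesis using mono[OF that] by simp
  qed
  then have D0: "D t = D 0" for t using D[of t 0] D[of 0 t] by linarith
  have "D 0 = 0"
  proof (rule ccontr)
    assume nz: "D 0 \<noteq> 0"
    have "f (\<gamma> t) = 0" for t
    proof -
      have "(D has_real_derivative 1 * (16 * (norm (\<gamma> t))\<^sup>2 * cassini (\<gamma> t) * D t)) (at t)"
        unfolding D_def using \<gamma>(1) by (intro level_distance_derivative) (simp add: solves_def)
      moreover have "(D has_real_derivative 0) (at t)" using D0 by (metis (no_types) DERIV_const ext)
      ultimately have "1 * (16 * (norm (\<gamma> t))\<^sup>2 * cassini (\<gamma> t) * D t) = 0" by (rule DERIV_unique)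
      then have "\<gamma> t = 0 \<or> focal (\<gamma> t) = 0" using nz D0[of t] by (simp add: cassini_def)
      then show ?thesis using fixed_point_iff by (simp add: fixed_point_def)
    qed
    then have "(\<gamma> has_vector_derivative 0) (at t)" for t using \<gamma>(1) by (simp add: solves_def)
    then obtain b where "\<And>t. \<gamma> t = b"
      using has_vector_derivative_zero_constant[of UNIV \<gamma>] by auto
    then show False using \<gamma>(4) by simp
  qed
  then show ?thesis using D0 \<gamma>(5) by (auto simp: D_def)
qed

text \<open>The nonnegative function \<open>(R - k)^2\<close> is nondecreasing along the orbit and tends to \<open>0\<close> in forward time.\<close>

lemma homoclinic_orbit_on_level:
  assumes "homoclinic_orbit f p \<Gamma>" "cassini p = k"
  shows "\<Gamma> \<subseteq> {q. cassini q = k} - {p}"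
proof -
  obtain \<gamma> where \<gamma>: "solves f \<gamma> UNIV" "\<And>t. \<gamma> t \<noteq> p" "(\<gamma> \<longlongrightarrow> p) at_top" "\<Gamma> = range \<gamma>"
    using assms(1) unfolding homoclinic_orbit_def by blast
  have "continuous_on UNIV cassini" by (intro continuous_intros)
  then have "isCont cassini p" using continuous_on_eq_continuous_at[OF open_UNIV] by blast
  from isCont_tendsto_compose[OF this \<gamma>(3)]
  have "((\<lambda>t. (cassini (\<gamma> t) - k)\<^sup>2) \<longlongrightarrow> (cassini p - k)\<^sup>2) at_top" by (intro tendsto_intros)
  then have l: "((\<lambda>t. (cassini (\<gamma> t) - k)\<^sup>2) \<longlongrightarrow> 0) at_top" using assms(2) by simp
  have "(cassini (\<gamma> t) - k)\<^sup>2 \<le> 0" for t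
  proof (rule tendsto_lowerbound[OF l])
    show "\<forall>\<^sub>F s in at_top. (cassini (\<gamma> t) - k)\<^sup>2 \<le> (cassini (\<gamma> s) - k)\<^sup>2"
      using eventually_ge_at_top[of t] by eventually_elim (rule level_distance_nondecreasing[OF \<gamma>(1)])
  qed simp
  then have "cassini (\<gamma> t) = k" for t by simp
  then show ?thesis unfolding \<gamma>(4) using \<gamma>(2) by blast
qed

lemma closed_orbits_disjoint:
  assumes "closed_orbit f C" "closed_orbit f C'" "q \<in> C" "q \<in> C'"
  shows "C = C'"
proof -
  obtain \<gamma> \<eta> where "solves f \<gamma> UNIV" "solves f \<eta> UNIV" "C = range \<gamma>" "C' = range \<eta>"
    using assms(1,2) unfolding closed_orbit_def by blast
  then show ?thesis
    using range_eq_of_common_point[OF poly_field_lipschitz, where \<gamma> = \<gamma> and \<eta> = \<eta>] assms(3,4) by blast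
qed

lemma homoclinic_orbits_disjoint:
  assumes "homoclinic_orbit f p C" "homoclinic_orbit f p C'" "q \<in> C" "q \<in> C'"
  shows "C = C'"
proof -
  obtain \<gamma> \<eta> where "solves f \<gamma> UNIV" "solves f \<eta> UNIV" "C = range \<gamma>" "C' = range \<eta>"
    using assms(1,2) unfolding homoclinic_orbit_def by blast
  then show ?thesis
    using range_eq_of_common_point[OF poly_field_lipschitz, where \<gamma> = \<gamma> and \<eta> = \<eta>] assms(3,4) by blast
qed

text \<open>On \<open>R = k\<close> the field is \<open>2 * \<zeta> * cnj z * \<i> * W\<close>. If the argument of \<open>\<zeta>\<close> moves with speed \<open>\<psi>\<close>, then
  \<open>2 * z * z' = \<i> * \<psi> * \<zeta>\<close>, and comparing the two gives the factor. Only differentiability of the lift \<open>Z\<close>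
  has to be known; its derivative follows from that of \<open>\<zeta>\<close>.\<close>

lemma parametrization_derivative:
  assumes k: "k > 0" and Z: "(Z has_vector_derivative d) (at u)" and nz: "Z u \<noteq> 0"
    and focal: "\<And>u. (Z u)\<^sup>2 + 1 / 2 = sqrt k * cis (\<phi> u)" and \<phi>: "(\<phi> has_real_derivative \<psi>) (at u)"
  shows "((\<lambda>u. of_complex (Z u)) has_vector_derivative
    (\<psi> / (4 * (norm (of_complex (Z u)))\<^sup>2 * w (of_complex (Z u)))) *\<^sub>R f (of_complex (Z u))) (at u)"
proof -
  define q where "q = of_complex (Z u)"
  have cq: "to_complex q = Z u" by (simp add: q_def)
  have fq: "focal q = sqrt k * cis (\<phi> u)" using focal[of u] by (simp add: focal_def cq)
  have "cassini q = k" using k by (simp add: cassini_def fq norm_mult power_mult_distrib)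
  then have cf: "to_complex (f q) = 2 * focal q * cnj (Z u) * (\<i> * of_real (w q))"
    unfolding to_complex_field cq by (simp add: Complex_eq)
  have wp: "w q \<noteq> 0" using W_pos[of "fst q" "snd q"] by simp
  have nn: "of_real ((norm q)\<^sup>2) = Z u * cnj (Z u)" by (metis complex_norm_square norm_to_complex cq)
  have n0: "norm q \<noteq> 0" using nz by (simp add: q_def)
  have "((\<lambda>u. Z u * Z u + 1 / 2) has_vector_derivative Z u * d + d * Z u + 0) (at u)"
    by (intro has_vector_derivative_add has_vector_derivative_mult Z has_vector_derivative_const)
  moreover have "((\<lambda>u. Z u * Z u + 1 / 2) has_vector_derivative sqrt k * (\<i> * of_real \<psi> * cis (\<phi> u))) (at u)"
    unfolding power2_eq_square[symmetric] focal
    by (intro has_vector_derivative_mult_right cis_has_vector_derivative \<phi>)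
  ultimately have "Z u * d + d * Z u + 0 = sqrt k * (\<i> * of_real \<psi> * cis (\<phi> u))"
    by (rule vector_derivative_unique_at)
  then have d: "2 * Z u * d = \<i> * of_real \<psi> * focal q" by (simp add: fq mult_ac)
  define g where "g = \<psi> / (4 * (norm q)\<^sup>2 * w q)"
  have g: "g * (4 * (norm q)\<^sup>2 * w q) = \<psi>" using n0 wp by (simp add: g_def)
  have "2 * Z u * (of_real g * to_complex (f q)) = \<i> * of_real (g * (4 * (norm q)\<^sup>2 * w q)) * focal q"
    unfolding cf of_real_mult nn by (simp add: mult_ac)
  then have "2 * Z u * (of_real g * to_complex (f q)) = 2 * Z u * d" unfolding g d .
  then have "d = to_complex (g *\<^sub>R f q)" using nz by (simp add: to_complex_scaleR scaleR_conv_of_real)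
  then have "of_complex d = g *\<^sub>R f q" by simp
  with bounded_linear.has_vector_derivative[OF bounded_linear_of_complex Z] show ?thesis
    by (simp add: q_def g_def)
qed

text \<open>For \<open>k = 1/4\<close> this speed vanishes at the saddle, where the argument of \<open>\<zeta>\<close> comes to rest; that level
  curve needs another parameter.\<close>

lemma level_speed:
  assumes k: "k \<noteq> 1 / 4"
  shows "continuous_on {q. cassini q = k} (\<lambda>q. 4 * (norm q)\<^sup>2 * w q)"
    "\<And>q. q \<in> {q. cassini q = k} \<Longrightarrow> 4 * (norm q)\<^sup>2 * w q > 0"
proof -
  show "continuous_on {q. cassini q = k} (\<lambda>q. 4 * (norm q)\<^sup>2 * w q)" by (intro continuous_intros)
  fix q assume "q \<in> {q. cassini q = k}"
  then have "q \<noteq> 0" using k by (auto simp: zero_prod_def)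
  then show "4 * (norm q)\<^sup>2 * w q > 0" using W_pos by simp
qed

lemma closed_orbit_of_focal_angle:
  assumes k: "k > 0" "k \<noteq> 1 / 4"
    and Z: "\<And>u. \<exists>d. (Z has_vector_derivative d) (at u)" "\<And>u. (Z u)\<^sup>2 + 1 / 2 = sqrt k * cis u"
    and P: "P > 0" "\<And>u. Z (u + P) = Z u" and ne: "Z u1 \<noteq> Z u2"
  shows "closed_orbit f (range (\<lambda>u. of_complex (Z u)))"
proof (rule closed_orbit_of_parametrization[where K = "{q. cassini q = k}" and G = "\<lambda>q. 4 * (norm q)\<^sup>2 * w q"
      and P = P and ?u1.0 = u1 and ?u2.0 = u2, OF _ compact_cassini_level _ level_speed[OF k(2)] P(1)])
  have cas: "cassini (of_complex (Z u)) = k" for u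
    using k Z(2)[of u] by (simp add: cassini_def focal_def norm_mult power_mult_distrib)
  show "range (\<lambda>u. of_complex (Z u)) \<subseteq> {q. cassini q = k}" using cas by auto
  fix u
  have "of_complex (Z u) \<noteq> (0, 0)" using cas[of u] k(2) by auto
  then have nz: "Z u \<noteq> 0" by (auto simp: of_complex_def)
  obtain d where "(Z has_vector_derivative d) (at u)" using Z(1) by blast
  from parametrization_derivative[OF k(1) this nz Z(2), of 1]
  show "((\<lambda>u. of_complex (Z u)) has_vector_derivative (1 / (4 * (norm (of_complex (Z u)))\<^sup>2 * w (of_complex (Z u)))) *\<^sub>R
      f (of_complex (Z u))) (at u)" by (auto intro!: derivative_eq_intros)
  show "of_complex (Z (u + P)) = of_complex (Z u)" using P(2) by simp
  show "of_complex (Z u1) \<noteq> of_complex (Z u2)" using ne by (metis to_complex_of_complex)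
qed auto

lemma closed_orbit_oval:
  assumes k: "k > 0" "k < 1 / 4" and s: "\<sigma> * \<sigma> = 1"
  shows "closed_orbit f {q. cassini q = k \<and> \<sigma> * snd q > 0}"
proof -
  have sk: "0 < sqrt k" "sqrt k < 1 / 2" using k real_sqrt_less_mono[of k "1 / 4"] by (auto simp: real_sqrt_divide)
  have lt: "sqrt k * cos u < 1 / 2" for u
    using mult_left_mono[OF cos_le_one[of u], of "sqrt k"] sk by linarith
  have "range (\<lambda>u. of_complex (oval \<sigma> k u)) = {q. cassini q = k \<and> \<sigma> * snd q > 0}"
  proof (intro equalityI subsetI)
    fix q assume "q \<in> range (\<lambda>u. of_complex (oval \<sigma> k u))"
    then obtain u where u: "q = of_complex (oval \<sigma> k u)" by blast
    have "focal q = sqrt k * cis u" using oval_focal[OF s, of k u] by (simp add: focal_def u)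
    then have "cassini q = k" using k by (simp add: cassini_def norm_mult power_mult_distrib)
    then show "q \<in> {q. cassini q = k \<and> \<sigma> * snd q > 0}"
      using oval_side[OF s lt, of u] by (simp add: u of_complex_def)
  next
    fix q assume q: "q \<in> {q. cassini q = k \<and> \<sigma> * snd q > 0}"
    then obtain \<theta> where "focal q = sqrt k * cis \<theta>" using focal_polar[of q k] k(1) by blast
    then show "q \<in> range (\<lambda>u. of_complex (oval \<sigma> k u))" using oval_unique[OF s _ _ lt, of q \<theta>] q by blast
  qed
  moreover have "closed_orbit f (range (\<lambda>u. of_complex (oval \<sigma> k u)))"
  proof (rule closed_orbit_of_focal_angle[where P = "2 * pi" and ?u1.0 = 0 and ?u2.0 = pi])
    show "\<exists>d. ((\<lambda>u. oval \<sigma> k u) has_vector_derivative d) (at u)" for u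
      by (rule oval_differentiable[OF DERIV_ident lt])
    show "oval \<sigma> k (u + 2 * pi) = oval \<sigma> k u" for u by (simp add: oval_def cis_mult[symmetric])
    show "(oval \<sigma> k u)\<^sup>2 + 1 / 2 = sqrt k * cis u" for u by (rule oval_focal[OF s])
    have "(oval \<sigma> k 0)\<^sup>2 + 1 / 2 \<noteq> (oval \<sigma> k pi)\<^sup>2 + 1 / 2"
      unfolding oval_focal[OF s] using sk by simp
    then show "oval \<sigma> k 0 \<noteq> oval \<sigma> k pi" by metis
  qed (use k in auto)
  ultimately show ?thesis by simp
qed

lemma closed_orbit_loop:
  assumes k: "k > 1 / 4"
  shows "closed_orbit f {q. cassini q = k}"
proof -
  have sk: "sqrt k > 1 / 2" using k real_sqrt_less_mono[of "1 / 4" k] by (auto simp: real_sqrt_divide)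
  have "range (\<lambda>u. of_complex (loop k u)) = {q. cassini q = k}"
  proof (intro equalityI subsetI)
    fix q assume "q \<in> range (\<lambda>u. of_complex (loop k u))"
    then obtain u where u: "q = of_complex (loop k u)" by blast
    have "focal q = sqrt k * cis u" using loop_focal[of k u] by (simp add: focal_def u)
    then show "q \<in> {q. cassini q = k}" using k by (simp add: cassini_def norm_mult power_mult_distrib)
  next
    fix q assume "q \<in> {q. cassini q = k}"
    then obtain \<theta> where "focal q = sqrt k * cis \<theta>" using focal_polar[of q k] k by auto
    then have "(to_complex q)\<^sup>2 = (loop k \<theta>)\<^sup>2" using loop_focal[of k \<theta>] unfolding focal_def by (metis add_right_cancel)
    then have "to_complex q = loop k \<theta> \<or> to_complex q = loop k (\<theta> + 2 * pi)" unfolding loop_shift by (simp add: power2_eq_iff)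
    then have "q = of_complex (loop k \<theta>) \<or> q = of_complex (loop k (\<theta> + 2 * pi))" by (metis of_complex_to_complex)
    then show "q \<in> range (\<lambda>u. of_complex (loop k u))" by blast
  qed
  moreover have "closed_orbit f (range (\<lambda>u. of_complex (loop k u)))"
  proof (rule closed_orbit_of_focal_angle[where P = "2 * pi + 2 * pi" and ?u1.0 = 0 and ?u2.0 = "0 + 2 * pi"])
    show "\<exists>d. (loop k has_vector_derivative d) (at u)" for u by (rule loop_differentiable[OF sk])
    show "loop k (u + (2 * pi + 2 * pi)) = loop k u" for u
      unfolding add.assoc[symmetric] loop_shift by simp
    show "(loop k u)\<^sup>2 + 1 / 2 = sqrt k * cis u" for u by (rule loop_focal)
    have "loop k 0 \<noteq> 0" using loop_focal[of k 0] sk by (auto simp: complex_eq_iff)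
    then show "loop k 0 \<noteq> loop k (0 + 2 * pi)" unfolding loop_shift by simp
  qed (use k in auto)
  ultimately show ?thesis by simp
qed

section \<open>Repelling limit cycles\<close>

text \<open>Every closed orbit lies on \<open>R = k\<close>, so one that meets \<open>S\<close> meets \<open>C\<close> and coincides with it by uniqueness.\<close>

lemma limit_cycle_on_level:
  assumes "open S" "C = {q. cassini q = k} \<inter> S" "closed_orbit f C"
  shows "limit_cycle f C"
  unfolding limit_cycle_def
proof (intro conjI exI[of _ S] allI impI)
  fix C' assume C': "closed_orbit f C' \<and> C' \<inter> S \<noteq> {}"
  then obtain q where q: "q \<in> C'" "q \<in> S" by blast
  then have "q \<in> C" using closed_orbit_on_level C' assms(2) by blast
  then show "C' = C" using closed_orbits_disjoint C' assms(3) q by blast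
qed (use assms in auto)

text \<open>In reversed time \<open>(R - k)^2\<close> has the derivative \<open>- 16 * cmod z ^ 2 * R * (R - k)^2\<close>. Its coefficient is
  bounded away from \<open>0\<close> near the level, because \<open>\<eta>\<close> keeps \<open>R\<close> away from \<open>0\<close> (the foci) and from \<open>1/4\<close> (the
  saddle). Hence \<open>R\<close> tends to \<open>k\<close>, and by compactness the distance from \<open>C\<close> tends to \<open>0\<close>. The open sets
  \<open>S\<close> and \<open>S'\<close> separate the components of the level set: a trajectory that starts in \<open>S\<close> stays there by
  connectedness.\<close>

lemma attracts_nearby_level:
  assumes k: "k > 0" and \<eta>: "0 < \<eta>" "\<eta> \<le> k" "\<eta> \<le> \<bar>k - 1 / 4\<bar>"
    and S: "open S" "open S'" "S \<inter> S' = {}" "\<And>q. \<bar>cassini q - k\<bar> < \<eta> \<Longrightarrow> q \<in> S \<union> S'"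
    and C: "C = {q. cassini q = k} \<inter> S" "C \<noteq> {}"
  shows "attracts_nearby (\<lambda>q. - f q) C"
proof -
  define U where "U = {q. \<bar>cassini q - k\<bar> < \<eta> / 2} \<inter> S"
  have "open U" unfolding U_def
    by (intro open_Int open_Collect_less continuous_intros S(1))
  moreover have "C \<subseteq> U" using C(1) \<eta> by (auto simp: U_def)
  moreover have "forward_trajectory (\<lambda>q. - f q) q (\<lambda>\<gamma>. ((\<lambda>t. infdist (\<gamma> t) C) \<longlongrightarrow> 0) at_top)" if q: "q \<in> U" for q
  proof -
    define M where "M = {q. \<bar>cassini q - k\<bar> \<le> \<eta> / 2}"
    have MS: "q \<in> S \<union> S'" if "q \<in> M" for q
    proof (rule S(4))
      have "\<bar>cassini q - k\<bar> \<le> \<eta> / 2" using that by (simp add: M_def)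
      then show "\<bar>cassini q - k\<bar> < \<eta>" using \<eta>(1) by linarith
    qed
    have "closed M" unfolding M_def by (intro closed_Collect_le continuous_intros)
    moreover have "M \<subseteq> {q. cassini q \<le> k + \<eta>}"
    proof
      fix q assume "q \<in> M"
      then have "\<bar>cassini q - k\<bar> \<le> \<eta> / 2" by (simp add: M_def)
      then have "cassini q \<le> k + \<eta>" using \<eta>(1) by linarith
      then show "q \<in> {q. cassini q \<le> k + \<eta>}" by simp
    qed
    ultimately have cM: "compact M"
      using compact_Int_closed[OF compact_cassini_le] by (metis inf.absorb_iff2)
    have qM: "q \<in> M" using q by (auto simp: M_def U_def)
    obtain r where r: "M \<subseteq> ball 0 r" using bounded_subset_ballD[OF compact_imp_bounded[OF cM]] by blast
    define K where "K = cball (0 :: real \<times> real) r"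
    obtain L where "L-lipschitz_on K (\<lambda>q. (-1) *\<^sub>R f q)" unfolding K_def using scaled_field_lipschitz by blast
    then have L: "L-lipschitz_on K (\<lambda>q. - f q)" by simp
    have d: "((\<lambda>t. (cassini (\<gamma> t) - k)\<^sup>2) has_real_derivative
        - (16 * (norm (\<gamma> t))\<^sup>2 * cassini (\<gamma> t) * (cassini (\<gamma> t) - k)\<^sup>2)) (at t within J)"
      if "solves (\<lambda>q. - f q) \<gamma> J" "t \<in> J" for \<gamma> J t
      using level_distance_derivative[of \<gamma> "-1" t J] that by (simp add: solves_def)
    have stay: "\<gamma> T \<in> M" "(cassini (\<gamma> T) - k)\<^sup>2 < (\<eta> / 2)\<^sup>2"
      if \<gamma>: "solves (\<lambda>q. - f q) \<gamma> {0..T}" "\<gamma> 0 = q" "T \<ge> 0" for \<gamma> T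
    proof -
      have "(cassini (\<gamma> T) - k)\<^sup>2 \<le> (cassini (\<gamma> 0) - k)\<^sup>2"
        by (rule nonincreasing_of_derivative[OF \<gamma>(3) order_refl d[OF \<gamma>(1)]])
           (auto simp: cassini_nonneg)
      also have "\<dots> < (\<eta> / 2)\<^sup>2"
      proof -
        have "\<bar>cassini (\<gamma> 0) - k\<bar>\<^sup>2 < (\<eta> / 2)\<^sup>2"
          using q \<gamma>(2) by (intro power_strict_mono) (simp_all add: U_def)
        then show ?thesis by (simp only: power2_abs)
      qed
      finally show *: "(cassini (\<gamma> T) - k)\<^sup>2 < (\<eta> / 2)\<^sup>2" .
      then have "\<bar>cassini (\<gamma> T) - k\<bar> \<le> \<bar>\<eta> / 2\<bar>" by (intro abs_le_square_iff[THEN iffD2]) simp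
      then show "\<gamma> T \<in> M" using \<eta>(1) by (simp add: M_def)
    qed
    show ?thesis
    proof (rule forward_trajectoryI[OF _ _ L])
      show "closed K" "convex K" by (simp_all add: K_def)
      show "q \<in> interior K" using qM r by (auto simp: K_def interior_cball)
      show "\<gamma> T \<in> interior K" if "T > 0" "solves (\<lambda>q. - f q) \<gamma> {0..T}" "\<gamma> 0 = q" for \<gamma> T
        using stay(1)[OF that(2,3)] that(1) r by (auto simp: K_def interior_cball)
    next
      fix \<gamma> assume \<gamma>: "solves (\<lambda>q. - f q) \<gamma> {0..}" "\<gamma> 0 = q"
      have sub: "solves (\<lambda>q. - f q) \<gamma> {0..T}" for T by (rule solves_subset[OF \<gamma>(1)]) auto
      have M: "\<gamma> t \<in> M" if "t \<ge> 0" for t using stay(1)[OF sub \<gamma>(2) that] .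
      have "connected (\<gamma> ` {0..})"
        using solves_continuous_on[OF \<gamma>(1)] by (intro connected_continuous_image) auto
      moreover have "\<gamma> ` {0..} \<subseteq> S \<union> S'"
        using M MS by blast
      moreover have "q \<in> S \<inter> \<gamma> ` {0..}" using q \<gamma>(2) by (auto simp: U_def)
      ultimately have "S' \<inter> \<gamma> ` {0..} = {}"
        using connectedD[of "\<gamma> ` {0..}" S S'] S(1-3) by blast
      then have notS': "\<gamma> t \<in> M - S'" if "t \<ge> 0" for t using M[OF that] that by blast
      have "continuous_on M (\<lambda>q. 16 * (norm q)\<^sup>2 * cassini q)" by (intro continuous_intros)
      then obtain q0 where q0: "q0 \<in> M" "\<And>q. q \<in> M \<Longrightarrow> 16 * (norm q0)\<^sup>2 * cassini q0 \<le> 16 * (norm q)\<^sup>2 * cassini q"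
        using continuous_attains_inf[OF cM, of "\<lambda>q. 16 * (norm q)\<^sup>2 * cassini q"] qM by blast
      define m where "m = 16 * (norm q0)\<^sup>2 * cassini q0"
      have "q0 \<noteq> (0, 0)" "cassini q0 \<noteq> 0" using q0(1) \<eta> by (auto simp: M_def)
      then have m: "m > 0" using cassini_nonneg[of q0] by (simp add: m_def zero_prod_def)
      have lim: "((\<lambda>t. (cassini (\<gamma> t) - k)\<^sup>2) \<longlongrightarrow> 0) at_top"
      proof (rule tendsto_0_of_negative_derivative)
        show "((\<lambda>t. (cassini (\<gamma> t) - k)\<^sup>2) has_real_derivative
          - (16 * (norm (\<gamma> t))\<^sup>2 * cassini (\<gamma> t) * (cassini (\<gamma> t) - k)\<^sup>2)) (at t within {0..})" if "t \<ge> 0" for t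
          using d[OF \<gamma>(1)] that by simp
        fix e :: real assume e: "e > 0"
        have "- (16 * (norm (\<gamma> t))\<^sup>2 * cassini (\<gamma> t) * (cassini (\<gamma> t) - k)\<^sup>2) \<le> - (m * e)"
          if "t \<ge> 0" "e \<le> (cassini (\<gamma> t) - k)\<^sup>2" for t
          using mult_mono[OF q0(2)[OF M[OF that(1)]] that(2)] m e cassini_nonneg[of "\<gamma> t"] by (simp add: m_def)
        then show "\<exists>m>0. \<forall>t\<ge>0. e \<le> (cassini (\<gamma> t) - k)\<^sup>2 \<longrightarrow>
            - (16 * (norm (\<gamma> t))\<^sup>2 * cassini (\<gamma> t) * (cassini (\<gamma> t) - k)\<^sup>2) \<le> - m"
          using m e by (intro exI[of _ "m * e"]) auto
      qed (auto simp: cassini_nonneg)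
      show "((\<lambda>t. infdist (\<gamma> t) C) \<longlongrightarrow> 0) at_top"
      proof (rule tendstoI)
        fix e :: real assume e: "e > 0"
        define N where "N = (M - S') \<inter> {q. infdist q C \<ge> e}"
        have "closed {q. infdist q C \<ge> e}" by (intro closed_Collect_le continuous_intros)
        then have cN: "compact N" unfolding N_def using cM S(2) by (intro compact_Int_closed compact_diff)
        have "\<exists>\<mu>>0. \<forall>q\<in>N. \<mu> \<le> (cassini q - k)\<^sup>2"
        proof (cases "N = {}")
          case False
          have "continuous_on N (\<lambda>q. (cassini q - k)\<^sup>2)" by (intro continuous_intros)
          then obtain q1 where q1: "q1 \<in> N" "\<And>q. q \<in> N \<Longrightarrow> (cassini q1 - k)\<^sup>2 \<le> (cassini q - k)\<^sup>2"
            using continuous_attains_inf[OF cN False] by blast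
          have "cassini q1 \<noteq> k"
          proof
            assume "cassini q1 = k"
            then have "q1 \<in> C" using q1(1) MS[of q1] C(1) by (auto simp: N_def)
            then show False using q1(1) e by (simp add: N_def)
          qed
          then show ?thesis using q1 by (intro exI[of _ "(cassini q1 - k)\<^sup>2"]) auto
        qed (auto intro: exI[of _ 1])
        then obtain \<mu> where \<mu>: "\<mu> > 0" "\<And>q. q \<in> N \<Longrightarrow> \<mu> \<le> (cassini q - k)\<^sup>2" by blast
        show "\<forall>\<^sub>F t in at_top. dist (infdist (\<gamma> t) C) 0 < e"
          using order_tendstoD(2)[OF lim \<mu>(1)] eventually_ge_at_top[of "0::real"]
        proof eventually_elim
          case (elim t)
          then have "\<gamma> t \<notin> N" using \<mu>(2)[of "\<gamma> t"] by linarith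
          then show ?case using notS'[of t] elim by (simp add: N_def infdist_nonneg)
        qed
      qed
    qed
  qed
  ultimately show ?thesis unfolding attracts_nearby_def by blast
qed

lemma repelling_ovals:
  assumes k: "0 < k" "k < 1 / 4" and s: "\<sigma> * \<sigma> = 1"
  shows "repelling_limit_cycle f {q. cassini q = k \<and> \<sigma> * snd q > 0}" (is "repelling_limit_cycle f ?C")
  unfolding repelling_limit_cycle_def
proof
  have C: "?C = {q. cassini q = k} \<inter> {q. \<sigma> * snd q > 0}" by auto
  have co: "closed_orbit f ?C" by (rule closed_orbit_oval[OF k s])
  have op: "open {q. \<sigma> * snd q > 0}" "open {q. \<sigma> * snd q < 0}"
    by (intro open_Collect_less continuous_intros)+
  show "limit_cycle f ?C" by (rule limit_cycle_on_level[OF op(1) C co])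
  show "attracts_nearby (\<lambda>q. - f q) ?C"
  proof (rule attracts_nearby_level[OF k(1) _ _ _ op _ _ C])
    show "0 < min k (1 / 4 - k)" using k by simp
    show "min k (1 / 4 - k) \<le> \<bar>k - 1 / 4\<bar>" by simp
    show "?C \<noteq> {}" using co unfolding closed_orbit_def by blast
    fix q assume "\<bar>cassini q - k\<bar> < min k (1 / 4 - k)"
    then have "cassini q < 1 / 4" by linarith
    then have "snd q \<noteq> 0" by (rule cassini_less_quarter)
    moreover have "\<sigma> \<noteq> 0" using s by auto
    ultimately have "\<sigma> * snd q \<noteq> 0" by simp
    then show "q \<in> {q. \<sigma> * snd q > 0} \<union> {q. \<sigma> * snd q < 0}"
      unfolding Un_iff mem_Collect_eq by linarith
  qed auto
qed

lemma repelling_loop: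
  assumes k: "k > 1 / 4"
  shows "repelling_limit_cycle f {q. cassini q = k}" (is "repelling_limit_cycle f ?C")
  unfolding repelling_limit_cycle_def
proof
  have C: "?C = {q. cassini q = k} \<inter> UNIV" by auto
  have co: "closed_orbit f ?C" by (rule closed_orbit_loop[OF k])
  show "limit_cycle f ?C" by (rule limit_cycle_on_level[OF open_UNIV C co])
  show "attracts_nearby (\<lambda>q. - f q) ?C"
  proof (rule attracts_nearby_level[OF _ _ _ _ open_UNIV open_empty _ _ C])
    show "0 < min k (k - 1 / 4)" using k by simp
    show "?C \<noteq> {}" using co unfolding closed_orbit_def by blast
  qed (use k in auto)
qed

lemma repelling_limit_cycles_small:
  assumes k: "0 < k" "k < 1 / 4"
  shows "{C. repelling_limit_cycle f C} =
    {{q. cassini q = k \<and> 1 * snd q > 0}, {q. cassini q = k \<and> - 1 * snd q > 0}}" (is "_ = {?A, ?B}")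
proof (intro equalityI subsetI)
  have AB: "repelling_limit_cycle f ?A" "repelling_limit_cycle f ?B"
    by (rule repelling_ovals[OF k], simp)+
  then show "C \<in> {C. repelling_limit_cycle f C}" if "C \<in> {?A, ?B}" for C using that by blast
  fix C assume "C \<in> {C. repelling_limit_cycle f C}"
  then have C: "closed_orbit f C" by (simp add: repelling_limit_cycle_def limit_cycle_def)
  then obtain q where q: "q \<in> C" unfolding closed_orbit_def by blast
  then have "cassini q = k" using closed_orbit_on_level[OF C] by blast
  then have "q \<in> ?A \<or> q \<in> ?B" using cassini_less_quarter[of q] k by auto
  moreover have "closed_orbit f ?A" "closed_orbit f ?B"
    using AB by (simp_all only: repelling_limit_cycle_def limit_cycle_def)
  ultimately show "C \<in> {?A, ?B}" using closed_orbits_disjoint[OF C _ q] by blast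
qed

lemma repelling_limit_cycles_large:
  assumes k: "k > 1 / 4"
  shows "{C. repelling_limit_cycle f C} = {{q. cassini q = k}}" (is "_ = {?A}")
proof (intro equalityI subsetI)
  have A: "repelling_limit_cycle f ?A" by (rule repelling_loop[OF k])
  then show "C \<in> {C. repelling_limit_cycle f C}" if "C \<in> {?A}" for C using that by blast
  fix C assume "C \<in> {C. repelling_limit_cycle f C}"
  then have C: "closed_orbit f C" by (simp add: repelling_limit_cycle_def limit_cycle_def)
  then obtain q where q: "q \<in> C" unfolding closed_orbit_def by blast
  then have "q \<in> ?A" using closed_orbit_on_level[OF C] by blast
  moreover have "closed_orbit f ?A" using A by (simp only: repelling_limit_cycle_def limit_cycle_def)
  ultimately show "C \<in> {?A}" using closed_orbits_disjoint[OF C _ q] by blast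
qed

lemma loop_encloses:
  assumes k: "k > 1 / 4"
  shows "q = (0, 0) \<or> focal q = 0 \<Longrightarrow> q \<in> inside {q. cassini q = k}"
proof (rule in_inside_if_frontier_subset[of "{q. cassini q < k}"])
  assume "q = (0, 0) \<or> focal q = 0"
  then have "cassini q = 1 / 4 \<or> cassini q = 0" 
    by (metis cassini_def cassini_origin norm_zero zero_power2)
  then show "q \<in> {q. cassini q < k}" "q \<notin> {q. cassini q = k}" using k by auto
  show "bounded {q. cassini q < k}"
    by (rule bounded_subset[OF compact_imp_bounded[OF compact_cassini_le[of k]]]) auto
  have "open {q. cassini q < k}" "closed {q. cassini q \<le> k}"
    by (intro open_Collect_less closed_Collect_le continuous_intros)+
  moreover from this have "closure {q. cassini q < k} \<subseteq> {q. cassini q \<le> k}"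
    by (intro closure_minimal) auto
  ultimately show "frontier {q. cassini q < k} \<subseteq> {q. cassini q = k}"
    by (auto simp: frontier_def interior_open)
qed

section \<open>Homoclinic orbits\<close>

text \<open>This substitution satisfies \<open>\<theta>' = 2 * sin (\<theta> / 2)\<close> and maps the line onto the interval from \<open>0\<close> to
  \<open>2 * pi\<close>. On the lemniscate \<open>cmod z ^ 2 = sin (\<theta> / 2)\<close>, so it cancels the factor of the speed that
  vanishes at the saddle: in the parameter \<open>u\<close> the speed is \<open>2 * W\<close>, which is bounded and bounded away
  from \<open>0\<close>.\<close>

definition lobe_angle :: "real \<Rightarrow> real" where "lobe_angle u = 4 * arctan (exp u)"

lemma lobe_angle_derivative: "(lobe_angle has_real_derivative 4 * exp u / (1 + (exp u)\<^sup>2)) (at u)"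
  unfolding lobe_angle_def[abs_def]
  by (rule derivative_eq_intros refl)+ (simp add: divide_inverse)

lemma cos_lobe_angle: "cos (lobe_angle u) = 1 - 2 * (2 * exp u / (1 + (exp u)\<^sup>2))\<^sup>2"
proof -
  have "cos (2 * (2 * arctan (exp u))) = 1 - 2 * (sin (2 * arctan (exp u)))\<^sup>2" by (rule cos_double_sin)
  moreover have "sin (2 * arctan (exp u)) = 2 * exp u / (1 + (exp u)\<^sup>2)"
    unfolding sin_double sin_arctan cos_arctan by (simp add: real_sqrt_mult_self add_nonneg_nonneg)
  ultimately show ?thesis by (simp add: lobe_angle_def)
qed

lemma homoclinic_lobe:
  assumes k: "k = 1 / 4" and s: "\<sigma> * \<sigma> = 1"
  shows "homoclinic_orbit f (0, 0) {q. cassini q = k \<and> \<sigma> * snd q > 0}"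
proof -
  have sk: "sqrt k = 1 / 2" by (simp add: k real_sqrt_divide)
  define h where "h = (\<lambda>u::real. 2 * exp u / (1 + (exp u)\<^sup>2))"
  have h: "h u > 0" for u unfolding h_def by (intro divide_pos_pos add_pos_nonneg) auto
  have lt: "sqrt k * cos (lobe_angle u) < 1 / 2" for u
  proof -
    have "1 / 2 * (1 - 2 * x\<^sup>2) < 1 / 2" if "x > 0" for x :: real using that by simp
    then show ?thesis unfolding sk cos_lobe_angle using h[of u] unfolding h_def by blast
  qed
  define Z where "Z = (\<lambda>u. oval \<sigma> k (lobe_angle u))"
  have Zf: "(Z u)\<^sup>2 + 1 / 2 = sqrt k * cis (lobe_angle u)" for u unfolding Z_def by (rule oval_focal[OF s])
  have Zn: "(cmod (Z u))\<^sup>2 = h u" for u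
  proof -
    define C where "C = cos (lobe_angle u)"
    define S where "S = sin (lobe_angle u)"
    have "(Z u)\<^sup>2 = ((Z u)\<^sup>2 + 1 / 2) - 1 / 2" by simp
    also have "\<dots> = (cis (lobe_angle u) - 1) / 2" unfolding Zf sk by (simp add: diff_divide_distrib)
    finally have "(Z u)\<^sup>2 = (cis (lobe_angle u) - 1) / 2" .
    moreover have "(cmod ((cis x - 1) / 2))\<^sup>2 = ((cos x - 1)\<^sup>2 + (sin x)\<^sup>2) / 4" for x
      unfolding norm_divide power_divide cmod_power2 by simp
    ultimately have "(cmod ((Z u)\<^sup>2))\<^sup>2 = ((C - 1)\<^sup>2 + S\<^sup>2) / 4"
      unfolding C_def S_def by metis
    also have "(C - 1)\<^sup>2 + S\<^sup>2 = 2 - 2 * C"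
      using sin_cos_squared_add2[of "lobe_angle u"] by (simp add: power2_eq_square algebra_simps C_def S_def)
    also have "\<dots> / 4 = (h u)\<^sup>2" unfolding C_def cos_lobe_angle h_def by simp
    finally have "((cmod (Z u))\<^sup>2)\<^sup>2 = (h u)\<^sup>2" by (simp add: norm_power)
    then show ?thesis by (rule power2_eq_imp_eq) (use h[of u] in auto)
  qed
  have Znz: "Z u \<noteq> 0" for u using Zn[of u] h[of u] by auto
  have cas: "cassini (of_complex (Z u)) = k" for u
    using k Zf[of u] by (simp add: cassini_def focal_def norm_mult power_mult_distrib sk power_divide)
  have "range (\<lambda>u. of_complex (Z u)) = {q. cassini q = k \<and> \<sigma> * snd q > 0}"
  proof (intro equalityI subsetI)
    fix q assume "q \<in> range (\<lambda>u. of_complex (Z u))"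
    then show "q \<in> {q. cassini q = k \<and> \<sigma> * snd q > 0}"
      using cas oval_side[OF s lt] by (auto simp: Z_def of_complex_def)
  next
    fix q assume q: "q \<in> {q. cassini q = k \<and> \<sigma> * snd q > 0}"
    then obtain \<theta> where \<theta>: "0 \<le> \<theta>" "\<theta> < 2 * pi" "focal q = sqrt k * cis \<theta>" using focal_polar[of q k] k by auto
    have "\<theta> \<noteq> 0"
    proof
      assume "\<theta> = 0"
      then have "(to_complex q)\<^sup>2 = 0" using \<theta>(3) by (simp add: focal_def sk)
      then have "q = 0" by (simp add: to_complex_eq_0_iff)
      then show False using q by simp
    qed
    then have "0 < \<theta> / 4" "\<theta> / 4 < pi / 2" using \<theta> by auto
    then have "tan (\<theta> / 4) > 0" "arctan (tan (\<theta> / 4)) = \<theta> / 4" using tan_gt_zero arctan_tan by auto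
    then have "\<theta> = lobe_angle (ln (tan (\<theta> / 4)))" by (simp add: lobe_angle_def)
    then obtain u where u: "\<theta> = lobe_angle u" by blast
    have "q = of_complex (Z u)" unfolding Z_def
      by (rule oval_unique[OF s _ _ lt]) (use \<theta>(3) u q in auto)
    then show "q \<in> range (\<lambda>u. of_complex (Z u))" by blast
  qed
  moreover have "homoclinic_orbit f (0, 0) (range (\<lambda>u. of_complex (Z u)))"
  proof (rule homoclinic_orbit_of_parametrization[where K = "{q. cassini q = k}" and G = "\<lambda>q. 2 * w q",
        OF _ compact_cassini_level])
    show "range (\<lambda>u. of_complex (Z u)) \<subseteq> {q. cassini q = k}" using cas by auto
    show "continuous_on {q. cassini q = k} (\<lambda>q. 2 * w q)" by (intro continuous_intros)
    show "2 * w q > 0" for q using W_pos by simp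
    show "fixed_point f (0, 0)" by (simp add: fixed_point_iff zero_prod_def)
    show "of_complex (Z u) \<noteq> (0, 0)" for u using Znz[of u] by (auto simp: of_complex_def complex_eq_iff)
    show "((\<lambda>u. of_complex (Z u)) has_vector_derivative (1 / (2 * w (of_complex (Z u)))) *\<^sub>R f (of_complex (Z u))) (at u)" for u
    proof -
      obtain d where "(Z has_vector_derivative d) (at u)"
        using oval_differentiable[OF lobe_angle_derivative lt] unfolding Z_def by blast
      from parametrization_derivative[OF _ this Znz Zf lobe_angle_derivative]
      have "((\<lambda>u. of_complex (Z u)) has_vector_derivative
        (4 * exp u / (1 + (exp u)\<^sup>2) / (4 * (norm (of_complex (Z u)))\<^sup>2 * w (of_complex (Z u)))) *\<^sub>R f (of_complex (Z u))) (at u)"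
        using k by simp
      moreover have "4 * exp u / (1 + (exp u)\<^sup>2) = 2 * h u" by (simp add: h_def)
      moreover have "2 * h u / (4 * (norm (of_complex (Z u)))\<^sup>2 * w (of_complex (Z u))) = 1 / (2 * w (of_complex (Z u)))"
        using h[of u] by (simp add: Zn)
      ultimately show ?thesis by simp
    qed
    have bound: "norm (of_complex (Z u)) \<le> sqrt (2 * exp u)" "norm (of_complex (Z u)) \<le> sqrt (2 * exp (- u))" for u
    proof -
      have "h u \<le> 2 * exp u / 1" unfolding h_def by (intro divide_left_mono) (auto intro: add_pos_nonneg)
      then show "norm (of_complex (Z u)) \<le> sqrt (2 * exp u)" by (intro real_le_rsqrt) (simp add: Zn)
      have "h u \<le> 2 * exp u / (exp u)\<^sup>2" unfolding h_def
        by (intro divide_left_mono) (auto intro!: mult_pos_pos add_pos_nonneg)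
      also have "\<dots> = 2 * exp (- u)" by (simp add: power2_eq_square exp_minus field_simps)
      finally show "norm (of_complex (Z u)) \<le> sqrt (2 * exp (- u))" by (intro real_le_rsqrt) (simp add: Zn)
    qed
    have e: "((\<lambda>u. sqrt (2 * exp (- u))) \<longlongrightarrow> sqrt (2 * 0)) at_top" "((\<lambda>u. sqrt (2 * exp u)) \<longlongrightarrow> sqrt (2 * 0)) at_bot"
      by (intro tendsto_intros filterlim_compose[OF exp_at_bot] filterlim_uminus_at_bot_at_top exp_at_bot)+
    show "((\<lambda>u. of_complex (Z u)) \<longlongrightarrow> (0, 0)) at_top" "((\<lambda>u. of_complex (Z u)) \<longlongrightarrow> (0, 0)) at_bot"
      unfolding zero_prod_def[symmetric]
      by (rule Lim_null_comparison[where g = "\<lambda>u. sqrt (2 * exp (- u))"], use bound e in simp_all)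
         (rule Lim_null_comparison[where g = "\<lambda>u. sqrt (2 * exp u)"], use bound e in simp_all)
  qed
  ultimately show ?thesis by simp
qed

lemma homoclinic_orbits:
  assumes k: "k = 1 / 4"
  shows "{\<Gamma>. homoclinic_orbit f (0, 0) \<Gamma>} =
    {{q. cassini q = k \<and> 1 * snd q > 0}, {q. cassini q = k \<and> - 1 * snd q > 0}}" (is "_ = {?A, ?B}")
proof (intro equalityI subsetI)
  have AB: "homoclinic_orbit f (0, 0) ?A" "homoclinic_orbit f (0, 0) ?B"
    by (rule homoclinic_lobe[OF k], simp)+
  then show "\<Gamma> \<in> {\<Gamma>. homoclinic_orbit f (0, 0) \<Gamma>}" if "\<Gamma> \<in> {?A, ?B}" for \<Gamma> using that by blast
  fix \<Gamma> assume "\<Gamma> \<in> {\<Gamma>. homoclinic_orbit f (0, 0) \<Gamma>}"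
  then have \<Gamma>: "homoclinic_orbit f (0, 0) \<Gamma>" by simp
  then obtain q where q: "q \<in> \<Gamma>" unfolding homoclinic_orbit_def by blast
  have "cassini q = k" "q \<noteq> (0, 0)" using homoclinic_orbit_on_level[OF \<Gamma>] q k by auto
  then have "snd q \<noteq> 0" using cassini_le_quarter[of q] k by auto
  then have "q \<in> ?A \<or> q \<in> ?B" using \<open>cassini q = k\<close> by auto
  then show "\<Gamma> \<in> {?A, ?B}" using homoclinic_orbits_disjoint[OF \<Gamma> _ q] AB by blast
qed

end

section \<open>Degrees and leading parts\<close>

lemma total_degree_leI:
  assumes "\<And>i j. coeff (coeff p j) i \<noteq> 0 \<Longrightarrow> i + j \<le> n"
  shows "total_degree p \<le> n"
  unfolding total_degree_def by (rule Least_le) (use assms in blast)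

lemma total_degree_add_le:
  assumes "total_degree p \<le> n" "total_degree q \<le> n"
  shows "total_degree (p + q) \<le> n"
proof (rule total_degree_leI)
  fix i j assume "coeff (coeff (p + q) j) i \<noteq> 0"
  then have "coeff (coeff p j) i \<noteq> 0 \<or> coeff (coeff q j) i \<noteq> 0" by auto
  then show "i + j \<le> n" using assms coeff_le_total_degree order_trans by blast
qed

lemma total_degree_diff_le:
  assumes "total_degree p \<le> n" "total_degree q \<le> n"
  shows "total_degree (p - q) \<le> n"
proof (rule total_degree_leI)
  fix i j assume "coeff (coeff (p - q) j) i \<noteq> 0"
  then have "coeff (coeff p j) i \<noteq> 0 \<or> coeff (coeff q j) i \<noteq> 0" by auto
  then show "i + j \<le> n" using assms coeff_le_total_degree order_trans by blast
qed

lemma total_degree_mult_le: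
  assumes "total_degree p \<le> a" "total_degree q \<le> b" "a + b \<le> n"
  shows "total_degree (p * q) \<le> n"
proof (rule total_degree_leI)
  fix i j assume "coeff (coeff (p * q) j) i \<noteq> 0"
  then have "(\<Sum>l\<le>j. \<Sum>m\<le>i. coeff (coeff p l) m * coeff (coeff q (j - l)) (i - m)) \<noteq> 0"
    by (simp add: coeff_mult coeff_sum)
  then obtain l where l: "l \<le> j" "(\<Sum>m\<le>i. coeff (coeff p l) m * coeff (coeff q (j - l)) (i - m)) \<noteq> 0"
    by (rule sum.not_neutral_contains_not_neutral) simp
  from l(2) obtain m where m: "m \<le> i" "coeff (coeff p l) m * coeff (coeff q (j - l)) (i - m) \<noteq> 0"
    by (rule sum.not_neutral_contains_not_neutral) simp
  then have "m + l \<le> total_degree p" "(i - m) + (j - l) \<le> total_degree q"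
    using coeff_le_total_degree[of p l m] coeff_le_total_degree[of q "j - l" "i - m"] by force+
  then show "i + j \<le> n" using assms l(1) m(1) by linarith
qed

lemma total_degree_power2_le: "total_degree p \<le> a \<Longrightarrow> 2 * a \<le> n \<Longrightarrow> total_degree (p\<^sup>2) \<le> n"
  unfolding power2_eq_square by (rule total_degree_mult_le) auto

lemma total_degree_polC: "total_degree (polC a) \<le> n"
  by (rule total_degree_leI) (auto simp: polC_def coeff_pCons split: nat.splits)

lemma total_degree_one: "total_degree 1 \<le> n"
  using total_degree_polC[of 1 n] by (simp add: polC_def one_pCons)

lemma total_degree_two: "total_degree 2 \<le> n"
  using total_degree_add_le[OF total_degree_one total_degree_one] by (simp only: one_add_one)

lemma total_degree_polX: "1 \<le> n \<Longrightarrow> total_degree polX \<le> n"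
  by (rule total_degree_leI) (auto simp: polX_def coeff_pCons split: nat.splits)

lemma total_degree_polY: "1 \<le> n \<Longrightarrow> total_degree polY \<le> n"
  by (rule total_degree_leI) (auto simp: polY_def coeff_pCons split: nat.splits)

lemma system_degree_le:
  assumes "N \<ge> 4" "total_degree W \<le> N"
  shows "total_degree (sysP W c) \<le> N + 3" "total_degree (sysQ W c) \<le> N + 3"
proof -
  note X = total_degree_polX and Y = total_degree_polY
  have sq: "total_degree (polX\<^sup>2) \<le> 2" "total_degree (polY\<^sup>2) \<le> 2"
    by (rule total_degree_power2_le[of _ 1], rule X Y, simp, simp)+
  have r: "total_degree (2 * polX\<^sup>2 + 2 * polY\<^sup>2) \<le> 2"
    using total_degree_mult_le[OF total_degree_two[of 0] sq(1), of 2] total_degree_mult_le[OF total_degree_two[of 0] sq(2), of 2]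
    by (intro total_degree_add_le) simp_all
  have r': "total_degree (2 * polX\<^sup>2 + 2 * polY\<^sup>2 + 1) \<le> 2" "total_degree (2 * polX\<^sup>2 + 2 * polY\<^sup>2 - 1) \<le> 2"
    by (intro total_degree_add_le total_degree_diff_le r total_degree_one)+
  have sq4: "total_degree (polX\<^sup>2) \<le> 4" "total_degree (polY\<^sup>2) \<le> 4" using sq by auto
  have h: "total_degree ((polX\<^sup>2 + polY\<^sup>2)\<^sup>2 + polX\<^sup>2 - polY\<^sup>2 - polC c) \<le> 4"
    by (intro total_degree_add_le total_degree_diff_le total_degree_polC sq4
        total_degree_power2_le[OF total_degree_add_le[OF sq]]) auto
  note X3 = total_degree_mult_le[OF X[of 1] r'(1), of 3]
  note Y3 = total_degree_mult_le[OF Y[of 1] r'(2), of 3]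
  show "total_degree (sysP W c) \<le> N + 3" "total_degree (sysQ W c) \<le> N + 3"
    unfolding sysP_def sysQ_def using assms
    by (auto intro!: total_degree_add_le total_degree_diff_le total_degree_mult_le[OF X3 h]
        total_degree_mult_le[OF Y3 h] total_degree_mult_le[OF X3 assms(2)] total_degree_mult_le[OF Y3 assms(2)])
qed

lemma hom_part_eq_0_if_greater: "total_degree p < n \<Longrightarrow> hom_part n p x y = 0"
  unfolding hom_part_def
proof (rule sum.neutral, rule ballI)
  fix i assume "total_degree p < n" "i \<in> {..n}"
  then have "coeff (coeff p (n - i)) i = 0" using coeff_le_total_degree[of p "n - i" i] by fastforce
  then show "coeff (coeff p (n - i)) i * x ^ i * y ^ (n - i) = 0" by simp
qed

lemma poly_at_infinity_0: "poly_at_infinity n R 0 \<theta> = hom_part n R (cos \<theta>) (sin \<theta>)"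
proof -
  have "poly_at_infinity n R 0 \<theta> = (\<Sum>k\<le>n. if k = n then hom_part n R (cos \<theta>) (sin \<theta>) else 0)"
    unfolding poly_at_infinity_def by (rule sum.cong) auto
  then show ?thesis by simp
qed

lemma continuous_poly_at_infinity [continuous_intros]:
  fixes g h :: "'a :: t2_space \<Rightarrow> real"
  shows "continuous_on S g \<Longrightarrow> continuous_on S h \<Longrightarrow> continuous_on S (\<lambda>x. poly_at_infinity n R (g x) (h x))"
  unfolding poly_at_infinity_def hom_part_def
  by (intro continuous_intros)

lemma eq_at_0_if_continuous:
  fixes g h :: "real \<Rightarrow> real"
  assumes "continuous_on UNIV g" "continuous_on UNIV h" "\<And>s. s \<noteq> 0 \<Longrightarrow> g s = h s"
  shows "g 0 = h 0"
proof -
  have "(g \<longlongrightarrow> g 0) (at 0)" "(h \<longlongrightarrow> h 0) (at 0)" using assms(1,2) by (auto simp: continuous_on_def)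
  moreover have "\<forall>\<^sub>F s in at 0. h s = g s" using assms(3) by (simp add: eventually_at_filter)
  ultimately have "(g \<longlongrightarrow> h 0) (at 0)" by (blast intro: Lim_transform_eventually)
  then show ?thesis using \<open>(g \<longlongrightarrow> g 0) (at 0)\<close> by (rule LIM_unique[rotated])
qed

section \<open>The equator\<close>

text \<open>The coordinates \<open>(s, \<theta>)\<close> at infinity, translated back to the plane.\<close>

definition chart :: "real \<times> real \<Rightarrow> real \<times> real" where
  "chart q = (cos (snd q) / fst q, sin (snd q) / fst q)"

lemma norm_chart: "fst q > 0 \<Longrightarrow> norm (chart q) = 1 / fst q"
proof -
  assume q: "fst q > 0"
  have "(norm (chart q))\<^sup>2 = (1 / fst q)\<^sup>2"
    unfolding norm_sq chart_def by (simp add: power_divide flip: add_divide_distrib)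
  then show ?thesis by (rule power2_eq_imp_eq) (use q in auto)
qed

text \<open>The bounds say that \<open>1 / R\<close> is comparable with \<open>s^4\<close>; this lets \<open>1 / R\<close> replace \<open>s\<close> as a measure of the
  distance from the equator.\<close>

lemma cassini_chart_bounds:
  assumes "0 < fst q" "fst q \<le> 1 / 2"
  shows "1 / (4 * fst q ^ 4) \<le> cassini (chart q)" "cassini (chart q) \<le> 4 / fst q ^ 4"
proof -
  define x where "x = 1 / (fst q)\<^sup>2"
  have "(fst q)\<^sup>2 \<le> (1 / 2)\<^sup>2" using assms by (intro power_mono) auto
  then have x: "x \<ge> 4" using assms by (simp add: x_def field_simps power2_eq_square)
  have n: "(norm (chart q))\<^sup>2 = x" using norm_chart[OF assms(1)] by (simp add: x_def power_divide)
  have x2: "x * x = 1 / fst q ^ 4" by (simp add: x_def eval_nat_numeral)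
  have "(x / 2)\<^sup>2 \<le> (x - 1 / 2)\<^sup>2" using x by (intro power_mono) auto
  then show "1 / (4 * fst q ^ 4) \<le> cassini (chart q)"
    using cassini_bounds(1)[of "chart q"] x2 unfolding n by (simp add: power2_eq_square)
  have "(x + 1 / 2)\<^sup>2 \<le> (2 * x)\<^sup>2" using x by (intro power_mono) auto
  then show "cassini (chart q) \<le> 4 / fst q ^ 4"
    using cassini_bounds(2)[of "chart q"] x2 unfolding n by (simp add: power2_eq_square)
qed

locale cassini_system_infinity = cassini_system +
  fixes N :: nat
  assumes deg: "total_degree W = N" and N: "N \<ge> 4"
    and hom_pos: "\<And>x y. (x, y) \<noteq> (0, 0) \<Longrightarrow> hom_part N W x y > 0"
begin

abbreviation F :: "real \<times> real \<Rightarrow> real \<times> real" where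
  "F \<equiv> field_at_infinity (sysP W c) (sysQ W c)"

text \<open>The angular speed is that of \<open>x * Q - y * P = W * (2 * r^4 + x^2 - y^2) - 2 * x * y * (R - k)\<close> in the
  rescaled time. The right-hand side is a polynomial in \<open>s\<close>, which makes the limit at the equator
  visible: the second term carries the factor \<open>s ^ (N - 2)\<close> and does not contribute.\<close>

lemma angular_speed_near_infinity:
  assumes s: "s \<noteq> 0"
  shows "cos \<theta> * poly_at_infinity (N + 3) (sysQ W c) s \<theta> - sin \<theta> * poly_at_infinity (N + 3) (sysP W c) s \<theta> =
    poly_at_infinity N W s \<theta> * (2 + s\<^sup>2 * ((cos \<theta>)\<^sup>2 - (sin \<theta>)\<^sup>2))
    - 2 * cos \<theta> * sin \<theta> * s ^ (N - 2) * (1 + s\<^sup>2 * ((cos \<theta>)\<^sup>2 - (sin \<theta>)\<^sup>2) - c * s ^ 4)"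
proof -
  have d: "total_degree (sysP W c) \<le> N + 3" "total_degree (sysQ W c) \<le> N + 3" "total_degree W \<le> N"
    using system_degree_le[OF N] deg by auto
  define a b M where "a = cos \<theta>" and "b = sin \<theta>" and "M = s ^ (N - 2)"
  have ab: "b\<^sup>2 = 1 - a\<^sup>2" by (simp add: a_def b_def sin_squared_eq)
  have sN: "s ^ N = M * s\<^sup>2" "s ^ (N + 3) = M * s ^ 5"
  proof -
    have "N = (N - 2) + 2" "N + 3 = (N - 2) + 5" using N by simp_all
    then show "s ^ N = M * s\<^sup>2" "s ^ (N + 3) = M * s ^ 5" unfolding M_def by (metis power_add)+
  qed
  \<comment> \<open>Writing \<open>u\<close> for \<open>1 / s\<close> reduces the computation to polynomial identities modulo \<open>s * u = 1\<close>.\<close>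
  define u where "u = 1 / s"
  have su: "s * u = 1" using s by (simp add: u_def)
  define V where "V = poly2 W (a * u) (b * u)"
  define h where "h = u ^ 4 + u\<^sup>2 * (a\<^sup>2 - b\<^sup>2) - c"
  have r: "(a * u)\<^sup>2 + (b * u)\<^sup>2 = u\<^sup>2" unfolding power_mult_distrib ab by (simp add: algebra_simps)
  then have r': "2 * (a * u)\<^sup>2 + 2 * (b * u)\<^sup>2 = 2 * u\<^sup>2" by linarith
  have h': "((a * u)\<^sup>2 + (b * u)\<^sup>2)\<^sup>2 + (a * u)\<^sup>2 - (b * u)\<^sup>2 - c = h"
    unfolding r h_def by (simp add: power_mult_distrib algebra_simps)
  have P: "poly2 (sysP W c) (a * u) (b * u) = a * u * (2 * u\<^sup>2 + 1) * h - b * u * (2 * u\<^sup>2 - 1) * V"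
    and Q: "poly2 (sysQ W c) (a * u) (b * u) = b * u * (2 * u\<^sup>2 - 1) * h + a * u * (2 * u\<^sup>2 + 1) * V"
    using r' h' by (simp_all add: sysP_def sysQ_def V_def)
  have u: "u * s = 1" "u\<^sup>2 * s\<^sup>2 = 1" "u ^ 4 * s ^ 4 = 1" using su by (simp_all add: mult.commute flip: power_mult_distrib)
  have "a * poly2 (sysQ W c) (a * u) (b * u) - b * poly2 (sysP W c) (a * u) (b * u) =
      V * u * (2 * u\<^sup>2 * (a\<^sup>2 + b\<^sup>2) + (a\<^sup>2 - b\<^sup>2)) - 2 * a * b * u * h"
    unfolding P Q by algebra
  also have "a\<^sup>2 + b\<^sup>2 = 1" by (simp add: ab)
  finally have "s ^ 5 * (a * poly2 (sysQ W c) (a * u) (b * u) - b * poly2 (sysP W c) (a * u) (b * u)) =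
      s ^ 5 * (V * u * (2 * u\<^sup>2 * 1 + (a\<^sup>2 - b\<^sup>2)) - 2 * a * b * u * h)" by simp
  also have "\<dots> = s\<^sup>2 * V * (2 + s\<^sup>2 * (a\<^sup>2 - b\<^sup>2)) - 2 * a * b * (1 + s\<^sup>2 * (a\<^sup>2 - b\<^sup>2) - c * s ^ 4)"
    unfolding h_def using su by algebra
  finally have main: "s ^ 5 * (a * poly2 (sysQ W c) (a * u) (b * u) - b * poly2 (sysP W c) (a * u) (b * u)) = \<dots>" .
  have div: "a / s = a * u" "b / s = b * u" by (simp_all add: u_def)
  have "a * (M * s ^ 5 * poly2 (sysQ W c) (a * u) (b * u)) - b * (M * s ^ 5 * poly2 (sysP W c) (a * u) (b * u)) =
      M * (s ^ 5 * (a * poly2 (sysQ W c) (a * u) (b * u) - b * poly2 (sysP W c) (a * u) (b * u)))"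
    by (simp add: algebra_simps)
  also have "\<dots> = M * s\<^sup>2 * V * (2 + s\<^sup>2 * (a\<^sup>2 - b\<^sup>2)) - 2 * a * b * M * (1 + s\<^sup>2 * (a\<^sup>2 - b\<^sup>2) - c * s ^ 4)"
    unfolding main by (simp add: algebra_simps)
  finally show ?thesis
    unfolding poly_at_infinity_eq[OF s d(1)] poly_at_infinity_eq[OF s d(2)] poly_at_infinity_eq[OF s d(3)] sN
      a_def[symmetric] b_def[symmetric] M_def[symmetric] div V_def[symmetric] .
qed

lemma angular_speed_at_infinity:
  "cos \<theta> * hom_part (N + 3) (sysQ W c) (cos \<theta>) (sin \<theta>) - sin \<theta> * hom_part (N + 3) (sysP W c) (cos \<theta>) (sin \<theta>)
    = 2 * hom_part N W (cos \<theta>) (sin \<theta>)"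
proof -
  have "cos \<theta> * poly_at_infinity (N + 3) (sysQ W c) 0 \<theta> - sin \<theta> * poly_at_infinity (N + 3) (sysP W c) 0 \<theta> =
    poly_at_infinity N W 0 \<theta> * (2 + 0\<^sup>2 * ((cos \<theta>)\<^sup>2 - (sin \<theta>)\<^sup>2))
    - 2 * cos \<theta> * sin \<theta> * 0 ^ (N - 2) * (1 + 0\<^sup>2 * ((cos \<theta>)\<^sup>2 - (sin \<theta>)\<^sup>2) - c * 0 ^ 4)"
    by (rule eq_at_0_if_continuous[OF _ _ angular_speed_near_infinity]) (intro continuous_intros)+
  moreover have "(0 :: real) ^ (N - 2) = 0" using N by simp
  ultimately show ?thesis by (simp add: poly_at_infinity_0)
qed

lemma hom_part_circle_pos: "hom_part N W (cos \<theta>) (sin \<theta>) > 0"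
proof (rule hom_pos)
  have "(cos \<theta>)\<^sup>2 + (sin \<theta>)\<^sup>2 = 1" by simp
  then show "(cos \<theta>, sin \<theta>) \<noteq> (0, 0)" by (metis add.right_neutral prod.inject zero_neq_one zero_power2)
qed

text \<open>If both components had smaller degree, then their parts of degree \<open>N + 3\<close> would vanish, and with them
  the angular speed on the equator.\<close>

lemma system_degree_eq: "system_degree (sysP W c) (sysQ W c) = N + 3"
proof (rule ccontr)
  assume "system_degree (sysP W c) (sysQ W c) \<noteq> N + 3"
  then have "total_degree (sysP W c) < N + 3" "total_degree (sysQ W c) < N + 3"
    using system_degree_le[OF N, of W c] deg by (auto simp: system_degree_def)
  then have "2 * hom_part N W (cos 0) (sin 0) = 0"
    unfolding angular_speed_at_infinity[symmetric] by (simp add: hom_part_eq_0_if_greater)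
  then show False using hom_part_circle_pos[of 0] by simp
qed

lemma cycle_at_infinity: "cycle_at_infinity (sysP W c) (sysQ W c)"
  unfolding cycle_at_infinity_def
proof
  assume "\<exists>\<theta>. fixed_point F (0, \<theta>)"
  then obtain \<theta> where "F (0, \<theta>) = 0" by (auto simp: fixed_point_def)
  then have "2 * hom_part N W (cos \<theta>) (sin \<theta>) = 0"
    unfolding field_at_infinity_def system_degree_eq Let_def
    by (simp add: poly_at_infinity_0 angular_speed_at_infinity zero_prod_def)
  then show False using hom_part_circle_pos[of \<theta>] by simp
qed

lemma chart_derivative:
  assumes \<gamma>: "(\<gamma> has_vector_derivative F (\<gamma> t)) (at t within J)" and s: "fst (\<gamma> t) > 0"
  shows "((\<lambda>t. chart (\<gamma> t)) has_vector_derivative fst (\<gamma> t) ^ (N + 2) *\<^sub>R f (chart (\<gamma> t))) (at t within J)"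
proof -
  obtain s \<theta> where q: "\<gamma> t = (s, \<theta>)" by (cases "\<gamma> t")
  obtain s' \<theta>' where F: "F (s, \<theta>) = (s', \<theta>')" by (cases "F (s, \<theta>)")
  have s0: "s > 0" using s q by simp
  have chart: "chart = (\<lambda>(s, \<theta>). (cos \<theta> / s, sin \<theta> / s))" by (auto simp: chart_def fun_eq_iff)
  have deg_pos: "system_degree (sysP W c) (sysQ W c) > 0" by (simp add: system_degree_eq)
  note rel = field_at_infinity_related[OF s0 deg_pos F]
  have rel1: "(chart has_derivative
      (\<lambda>(a, b). (- cos \<theta> / s\<^sup>2 * a - sin \<theta> / s * b, - sin \<theta> / s\<^sup>2 * a + cos \<theta> / s * b))) (at (s, \<theta>))"
    unfolding chart by (rule rel(1))
  have rel2: "(- cos \<theta> / s\<^sup>2 * s' - sin \<theta> / s * \<theta>', - sin \<theta> / s\<^sup>2 * s' + cos \<theta> / s * \<theta>') =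
      s ^ (N + 2) *\<^sub>R f (chart (s, \<theta>))"
    using rel(2) by (simp add: system_degree_eq chart_def)
  have "(chart has_derivative
      (\<lambda>(a, b). (- cos \<theta> / s\<^sup>2 * a - sin \<theta> / s * b, - sin \<theta> / s\<^sup>2 * a + cos \<theta> / s * b))) (at (\<gamma> t) within \<gamma> ` J)"
    unfolding q by (rule has_derivative_at_withinI[OF rel1])
  from vector_derivative_diff_chain_within[OF \<gamma> this]
  have "((\<lambda>t. chart (\<gamma> t)) has_vector_derivative
      (- cos \<theta> / s\<^sup>2 * s' - sin \<theta> / s * \<theta>', - sin \<theta> / s\<^sup>2 * s' + cos \<theta> / s * \<theta>')) (at t within J)"
    by (simp add: o_def q F)
  then show ?thesis unfolding rel2 by (simp add: q)
qed

text \<open>The equation for \<open>R\<close> with the time scale \<open>a = s ^ (N + 2)\<close> and \<open>cmod z = 1 / s\<close>.\<close>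

lemma inverse_cassini_derivative:
  assumes \<gamma>: "(\<gamma> has_vector_derivative F (\<gamma> t)) (at t within J)" and s: "0 < fst (\<gamma> t)" "fst (\<gamma> t) \<le> 1 / 2"
  shows "((\<lambda>t. 1 / cassini (chart (\<gamma> t))) has_real_derivative
    - (8 * fst (\<gamma> t) ^ N * (1 - k * (1 / cassini (chart (\<gamma> t)))))) (at t within J)"
proof -
  define s where "s = fst (\<gamma> t)"
  define R where "R = cassini (chart (\<gamma> t))"
  have s0: "s > 0" using assms by (simp add: s_def)
  have "1 / (4 * s ^ 4) > 0" using s0 by simp
  then have R: "R > 0" using cassini_chart_bounds(1)[OF s] unfolding R_def s_def by linarith
  have "((\<lambda>t. cassini (chart (\<gamma> t))) has_real_derivative
      8 * s ^ (N + 2) * (norm (chart (\<gamma> t)))\<^sup>2 * R * (R - k)) (at t within J)"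
    unfolding s_def R_def by (rule cassini_derivative, rule chart_derivative[OF \<gamma> s(1)])
  moreover have "s ^ (N + 2) * (norm (chart (\<gamma> t)))\<^sup>2 = s ^ N"
    using norm_chart[OF s(1)] s0 by (simp add: s_def[symmetric] power_add power_divide power2_eq_square)
  then have "8 * s ^ (N + 2) * (norm (chart (\<gamma> t)))\<^sup>2 * R * (R - k) = 8 * s ^ N * R * (R - k)"
    by (simp only: mult.assoc[of 8])
  ultimately have "((\<lambda>t. cassini (chart (\<gamma> t))) has_real_derivative 8 * s ^ N * R * (R - k)) (at t within J)"
    by (simp only:)
  then have "((\<lambda>t. 1 / cassini (chart (\<gamma> t))) has_real_derivative - (8 * s ^ N * R * (R - k)) / (R * R)) (at t within J)"
    using R by (auto intro!: derivative_eq_intros simp: R_def)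
  moreover have "- (8 * s ^ N * R * (R - k)) / (R * R) = - (8 * s ^ N * (1 - k * (1 / R)))"
    using R by (simp add: field_simps)
  ultimately show ?thesis by (simp only: R_def s_def)
qed

text \<open>The equator is invariant: \<open>s' = s * g\<close> for a continuous \<open>g\<close>, so \<open>s\<close> never reaches \<open>0\<close>.\<close>

lemma fst_stays_positive:
  assumes J: "closed J" "convex J" "0 \<in> J" and \<gamma>: "solves F \<gamma> J" "fst (\<gamma> 0) > 0"
    and nn: "\<And>t. t \<in> J \<Longrightarrow> fst (\<gamma> t) \<ge> 0" and t: "t \<in> J"
  shows "fst (\<gamma> t) > 0"
proof -
  define g where "g = (\<lambda>t. - (cos (snd (\<gamma> t)) * poly_at_infinity (N + 3) (sysP W c) (fst (\<gamma> t)) (snd (\<gamma> t)) +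
      sin (snd (\<gamma> t)) * poly_at_infinity (N + 3) (sysQ W c) (fst (\<gamma> t)) (snd (\<gamma> t))))"
  have c\<gamma>: "continuous_on J \<gamma>" using \<gamma>(1) by (rule solves_continuous_on)
  have cg: "continuous_on J (\<lambda>t. complex_of_real (g t))" unfolding g_def by (intro continuous_intros c\<gamma>)
  have fF: "fst (F q) = - fst q * (cos (snd q) * poly_at_infinity (N + 3) (sysP W c) (fst q) (snd q) +
      sin (snd q) * poly_at_infinity (N + 3) (sysQ W c) (fst q) (snd q))" for q
    unfolding field_at_infinity_def system_degree_eq Let_def by (simp add: case_prod_beta)
  have d: "((\<lambda>t. complex_of_real (fst (\<gamma> t))) has_vector_derivative of_real (g t) * of_real (fst (\<gamma> t))) (at t within J)"
    if "t \<in> J" for t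
  proof -
    have "(\<gamma> has_vector_derivative F (\<gamma> t)) (at t within J)" using \<gamma>(1) that by (simp add: solves_def)
    from bounded_linear.has_vector_derivative[OF bounded_linear_fst this]
    have "((\<lambda>t. fst (\<gamma> t)) has_real_derivative fst (F (\<gamma> t))) (at t within J)"
      by (simp add: has_real_derivative_iff_has_vector_derivative)
    from has_vector_derivative_of_real[OF this]
    show ?thesis unfolding fF g_def by (simp add: algebra_simps)
  qed
  obtain A where "complex_of_real (fst (\<gamma> t)) = of_real (fst (\<gamma> 0)) * exp (A t)"
    using linear_ode_solution[OF J cg d] t by blast
  then have "fst (\<gamma> t) \<noteq> 0" using \<gamma>(2) by auto
  then show ?thesis using nn[OF t] by simp
qed

text \<open>On a strip \<open>s \<le> d\<close> so thin that \<open>k / R \<le> 1/2\<close>, the function \<open>V = 1 / R\<close> decreases at least at the rate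
  \<open>4 * s ^ N\<close>. As \<open>s^4 / 4 \<le> V \<le> 4 * s^4\<close>, a start with \<open>s < d / 4\<close> keeps \<open>s < 2 * (d / 4)\<close>, so the strip
  traps the trajectory, and the rate stays positive until \<open>V\<close> and with it \<open>s\<close> tend to \<open>0\<close>.\<close>

lemma attracting_at_infinity: "attracting_limit_cycle_at_infinity (sysP W c) (sysQ W c)"
proof -
  define d where "d = min (1 / 2) (1 / (8 * (\<bar>k\<bar> + 1)))"
  have d: "0 < d" "d \<le> 1 / 2" "8 * \<bar>k\<bar> * d \<le> 1"
  proof -
    define a where "a = \<bar>k\<bar>"
    have a: "a \<ge> 0" by (simp add: a_def)
    show "0 < d" "d \<le> 1 / 2" unfolding d_def a_def[symmetric] using a by auto
    have "8 * a * d \<le> 8 * a * (1 / (8 * (a + 1)))"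
      unfolding d_def a_def[symmetric] using a by (intro mult_left_mono) auto
    also have "\<dots> \<le> 1" using a by (simp add: divide_simps)
    finally show "8 * \<bar>k\<bar> * d \<le> 1" by (simp only: a_def)
  qed
  have d4: "d ^ 4 \<le> d" using d power_decreasing[of 1 4 d] by simp
  define K where "K = {0..d} \<times> (UNIV :: real set)"
  obtain L where L: "L-lipschitz_on K F" using field_at_infinity_lipschitz[OF K_def] by blast
  define V where "V = (\<lambda>q. 1 / cassini (chart q))"
  have V: "fst q ^ 4 / 4 \<le> V q" "V q \<le> 4 * fst q ^ 4" "k * V q \<le> 1 / 2"
    if "fst q > 0" "fst q \<le> d" for q
  proof -
    have h: "fst q \<le> 1 / 2" using that d(2) by linarith
    note b = cassini_chart_bounds[OF that(1) h]
    have p: "fst q ^ 4 > 0" using that by simp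
    then have "0 < 1 / (4 * fst q ^ 4)" by simp
    then have c: "cassini (chart q) > 0" using b(1) by linarith
    show "fst q ^ 4 / 4 \<le> V q" using b(2) p c by (simp add: V_def field_simps)
    show V4: "V q \<le> 4 * fst q ^ 4" using b(1) p c by (simp add: V_def field_simps)
    have "fst q ^ 4 \<le> d ^ 4" using that by (intro power_mono) auto
    then have "V q \<le> 4 * d" using V4 d4 by linarith
    moreover have "V q > 0" using c by (simp add: V_def)
    ultimately have "k * V q \<le> \<bar>k\<bar> * (4 * d)" by (intro mult_mono) auto
    then show "k * V q \<le> 1 / 2" using d(3) by linarith
  qed
  have dV: "((\<lambda>t. V (\<gamma> t)) has_real_derivative - (8 * fst (\<gamma> t) ^ N * (1 - k * V (\<gamma> t)))) (at t within J)"
    "- (8 * fst (\<gamma> t) ^ N * (1 - k * V (\<gamma> t))) \<le> - (4 * fst (\<gamma> t) ^ N)"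
    if "solves F \<gamma> J" "t \<in> J" "fst (\<gamma> t) > 0" "fst (\<gamma> t) \<le> d" for \<gamma> J t
  proof -
    show "((\<lambda>t. V (\<gamma> t)) has_real_derivative - (8 * fst (\<gamma> t) ^ N * (1 - k * V (\<gamma> t)))) (at t within J)"
      unfolding V_def using that d(2) by (intro inverse_cassini_derivative) (auto simp: solves_def)
    have "8 * fst (\<gamma> t) ^ N * (1 / 2) \<le> 8 * fst (\<gamma> t) ^ N * (1 - k * V (\<gamma> t))"
      using V(3)[OF that(3,4)] that(3) by (intro mult_left_mono) auto
    then show "- (8 * fst (\<gamma> t) ^ N * (1 - k * V (\<gamma> t))) \<le> - (4 * fst (\<gamma> t) ^ N)" by simp
  qed
  have "forward_trajectory F (s, \<theta>) (\<lambda>\<gamma>. (\<forall>\<tau>\<ge>0. fst (\<gamma> \<tau>) > 0) \<and> ((\<lambda>\<tau>. fst (\<gamma> \<tau>)) \<longlongrightarrow> 0) at_top)"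
    if s: "0 < s" "s < d / 4" for s \<theta>
  proof (rule forward_trajectoryI[OF _ _ L])
    have int: "interior K = {0<..<d} \<times> UNIV" by (simp add: K_def interior_Times)
    show "closed K" "convex K" by (simp_all add: K_def closed_Times convex_Times)
    show "(s, \<theta>) \<in> interior K" using s d by (simp add: int)
    fix \<gamma> T assume T: "T > 0" and \<gamma>: "solves F \<gamma> {0..T}" "\<gamma> 0 = (s, \<theta>)" and K: "\<And>t. t \<in> {0..T} \<Longrightarrow> \<gamma> t \<in> K"
    have K': "0 \<le> fst (\<gamma> t)" "fst (\<gamma> t) \<le> d" if "t \<in> {0..T}" for t
      using K[OF that] by (auto simp: K_def mem_Times_iff)
    have J: "closed {0..T}" "convex {0..T}" "0 \<in> {0..T}" using T by auto
    have pos: "fst (\<gamma> t) > 0" if "t \<in> {0..T}" for t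
      by (rule fst_stays_positive[OF J \<gamma>(1) _ K'(1) that]) (use \<gamma>(2) s in auto)
    have "V (\<gamma> T) \<le> V (\<gamma> 0)"
    proof (rule nonincreasing_of_derivative[of 0 T "{0..T}" _ "\<lambda>t. - (8 * fst (\<gamma> t) ^ N * (1 - k * V (\<gamma> t)))"])
      fix t assume t: "t \<in> {0..T}"
      show "((\<lambda>t. V (\<gamma> t)) has_real_derivative - (8 * fst (\<gamma> t) ^ N * (1 - k * V (\<gamma> t)))) (at t within {0..T})"
        by (rule dV(1)[OF \<gamma>(1) t pos[OF t] K'(2)[OF t]])
      have "fst (\<gamma> t) ^ N \<ge> 0" using pos[OF t] by simp
      then show "- (8 * fst (\<gamma> t) ^ N * (1 - k * V (\<gamma> t))) \<le> 0"
        using dV(2)[OF \<gamma>(1) t pos[OF t] K'(2)[OF t]] by linarith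
    qed (use T in auto)
    moreover have T0: "T \<in> {0..T}" "0 \<in> {0..T}" using T by auto
    ultimately have "fst (\<gamma> T) ^ 4 / 4 \<le> 4 * s ^ 4"
      using V(1)[OF pos[OF T0(1)] K'(2)[OF T0(1)]] V(2)[OF pos[OF T0(2)] K'(2)[OF T0(2)]] \<gamma>(2) by simp
    then have "fst (\<gamma> T) ^ 4 \<le> (2 * s) ^ 4" by (simp add: power_mult_distrib)
    then have "\<not> 2 * s < fst (\<gamma> T)" using power_strict_mono[of "2 * s" "fst (\<gamma> T)" 4] s by force
    then have "fst (\<gamma> T) < d" using s by linarith
    then show "\<gamma> T \<in> interior K" using pos[OF T0(1)] by (simp add: int mem_Times_iff)
  next
    fix \<gamma> assume \<gamma>: "solves F \<gamma> {0..}" "\<gamma> 0 = (s, \<theta>)" and K: "\<And>t. t \<ge> 0 \<Longrightarrow> \<gamma> t \<in> K"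
    have K': "0 \<le> fst (\<gamma> t)" "fst (\<gamma> t) \<le> d" if "t \<in> {0..}" for t
      using K[of t] that by (auto simp: K_def mem_Times_iff)
    have J: "closed {0::real..}" "convex {0::real..}" "(0::real) \<in> {0..}" by auto
    have pos: "fst (\<gamma> t) > 0" if "t \<in> {0..}" for t
      by (rule fst_stays_positive[OF J \<gamma>(1) _ K'(1) that]) (use \<gamma>(2) s in auto)
    have V0: "V (\<gamma> t) \<ge> 0" for t by (simp add: V_def cassini_nonneg)
    have lim: "((\<lambda>t. V (\<gamma> t)) \<longlongrightarrow> 0) at_top"
    proof (rule tendsto_0_of_negative_derivative[of _ "\<lambda>t. - (8 * fst (\<gamma> t) ^ N * (1 - k * V (\<gamma> t)))"])
      fix t :: real assume "t \<ge> 0"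
      then have t: "t \<in> {0..}" by simp
      show "((\<lambda>t. V (\<gamma> t)) has_real_derivative - (8 * fst (\<gamma> t) ^ N * (1 - k * V (\<gamma> t)))) (at t within {0..})"
        by (rule dV(1)[OF \<gamma>(1) t pos[OF t] K'(2)[OF t]])
      have "fst (\<gamma> t) ^ N \<ge> 0" using pos[OF t] by simp
      then show "- (8 * fst (\<gamma> t) ^ N * (1 - k * V (\<gamma> t))) \<le> 0"
        using dV(2)[OF \<gamma>(1) t pos[OF t] K'(2)[OF t]] by linarith
    next
      fix e :: real assume e: "e > 0"
      have "- (8 * fst (\<gamma> t) ^ N * (1 - k * V (\<gamma> t))) \<le> - (4 * (e / 4) ^ N)" if "t \<ge> 0" "e \<le> V (\<gamma> t)" for t
      proof -
        have t: "t \<in> {0..}" using that by simp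
        have "e / 4 \<le> fst (\<gamma> t) ^ 4" using V(2)[OF pos[OF t] K'(2)[OF t]] that(2) by linarith
        also have "\<dots> \<le> fst (\<gamma> t) ^ 1" using pos[OF t] K'(2)[OF t] d(2) by (intro power_decreasing) auto
        finally have "(e / 4) ^ N \<le> fst (\<gamma> t) ^ N" using e by (intro power_mono) auto
        then show ?thesis using dV(2)[OF \<gamma>(1) t pos[OF t] K'(2)[OF t]] by linarith
      qed
      then show "\<exists>m>0. \<forall>t\<ge>0. e \<le> V (\<gamma> t) \<longrightarrow> - (8 * fst (\<gamma> t) ^ N * (1 - k * V (\<gamma> t))) \<le> - m"
        using e by (intro exI[of _ "4 * (e / 4) ^ N"]) auto
    qed (rule V0)
    have "((\<lambda>t. fst (\<gamma> t)) \<longlongrightarrow> 0) at_top"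
    proof (rule tendstoI)
      fix e :: real assume e: "e > 0"
      then have "e ^ 4 / 4 > 0" by simp
      from order_tendstoD(2)[OF lim this] eventually_ge_at_top[of "0::real"]
      show "\<forall>\<^sub>F t in at_top. dist (fst (\<gamma> t)) 0 < e"
      proof eventually_elim
        case (elim t)
        then have t: "t \<in> {0..}" by simp
        have "fst (\<gamma> t) ^ 4 < e ^ 4" using V(1)[OF pos[OF t] K'(2)[OF t]] elim(1) by linarith
        then have "fst (\<gamma> t) < e" by (rule power_less_imp_less_base) (use e in simp)
        then show ?case using pos[OF t] by simp
      qed
    qed
    then show "(\<forall>\<tau>\<ge>0. fst (\<gamma> \<tau>) > 0) \<and> ((\<lambda>\<tau>. fst (\<gamma> \<tau>)) \<longlongrightarrow> 0) at_top" using pos by simp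
  qed
  moreover have "d / 4 > 0" using d by simp
  ultimately show ?thesis
    unfolding attracting_limit_cycle_at_infinity_def using cycle_at_infinity by blast
qed

end

theorem theorem4:
  fixes W :: "real poly poly" and N :: nat and c :: real
  assumes "total_degree W = N"
    and "\<And>x y. poly2 W x y > 0"
    and "N \<ge> 4"
    and "\<And>x y. (x, y) \<noteq> (0, 0) \<Longrightarrow> hom_part N W x y > 0"
  shows "let P = sysP W c; Q = sysQ W c; f = poly_field P Q;
             p1 = (0, 1 / sqrt 2); p2 = (0, - (1 / sqrt 2))
         in
           {q. fixed_point f q} = {(0, 0), p1, p2} \<and>
           saddle_point f (0, 0) \<and>
           attracting_limit_cycle_at_infinity P Q \<and>
           (c \<le> - 1 / 4 \<longrightarrow> unstable_spiral f p1 \<and> unstable_spiral f p2) \<and>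
           (- 1 / 4 < c \<and> c < 0 \<longrightarrow>
              stable_spiral f p1 \<and> stable_spiral f p2 \<and>
              (\<exists>C1 C2. {C. repelling_limit_cycle f C} = {C1, C2} \<and>
                 p1 \<in> inside C1 \<and> p2 \<notin> inside C1 \<and> p2 \<in> inside C2 \<and> p1 \<notin> inside C2)) \<and>
           (c = 0 \<longrightarrow>
              stable_spiral f p1 \<and> stable_spiral f p2 \<and>
              (\<exists>\<Gamma>1 \<Gamma>2. {\<Gamma>. homoclinic_orbit f (0, 0) \<Gamma>} = {\<Gamma>1, \<Gamma>2} \<and>
                 p1 \<in> inside (insert (0, 0) \<Gamma>1) \<and> p2 \<notin> inside (insert (0, 0) \<Gamma>1) \<and>
                 p2 \<in> inside (insert (0, 0) \<Gamma>2) \<and> p1 \<notin> inside (insert (0, 0) \<Gamma>2))) \<and>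
           (c > 0 \<longrightarrow>
              stable_spiral f p1 \<and> stable_spiral f p2 \<and>
              (\<exists>C. {C'. repelling_limit_cycle f C'} = {C} \<and> uminus ` C = C \<and>
                 {(0, 0), p1, p2} \<subseteq> inside C))"
proof -
  interpret cassini_system_infinity W c N
    using assms by unfold_locales auto
  define p1 p2 :: "real \<times> real" where p: "p1 = (0, 1 / sqrt 2)" "p2 = (0, - (1 / sqrt 2))"
  have focal: "focal p1 = 0" "focal p2 = 0"
    by (simp_all add: p focal_def complex_eq_iff power2_eq_square)
  have fixed: "{q. fixed_point f q} = {(0, 0), p1, p2}"
  proof (intro equalityI subsetI)
    fix q assume "q \<in> {q. fixed_point f q}"
    then consider "q = 0" | "focal q = 0" unfolding fixed_point_iff by blast
    then show "q \<in> {(0, 0), p1, p2}"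
    proof cases
      case 2
      then have "Re ((to_complex q)\<^sup>2) = - 1 / 2" "Im ((to_complex q)\<^sup>2) = 0"
        by (simp_all add: focal_def eq_neg_iff_add_eq_0 complex_eq_iff)
      then have e: "fst q * fst q - snd q * snd q = - 1 / 2" "fst q * snd q = 0"
        by (simp_all add: power2_eq_square)
      have "snd q \<noteq> 0"
      proof
        assume "snd q = 0"
        with e(1) zero_le_square[of "fst q"] show False by simp
      qed
      then have "fst q = 0" using e(2) by simp
      then have "(snd q)\<^sup>2 = (1 / sqrt 2)\<^sup>2" using e(1) by (simp add: power2_eq_square)
      then show ?thesis using \<open>fst q = 0\<close> by (auto simp: p power2_eq_iff prod_eq_iff)
    qed (simp add: zero_prod_def)
  qed (use focal in \<open>auto simp: fixed_point_iff zero_prod_def\<close>)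
  have unstable: "unstable_spiral f p1 \<and> unstable_spiral f p2" if "c \<le> - 1 / 4"
    unfolding unstable_spiral_def
    using spiral_at_focus[OF focal(1), of "-1"] spiral_at_focus[OF focal(2), of "-1"] that by simp
  have stable: "stable_spiral f p1 \<and> stable_spiral f p2" if "c > - 1 / 4"
    using spiral_at_focus[OF focal(1), of 1] spiral_at_focus[OF focal(2), of 1] that by simp
  define A B where "A = {q. cassini q = k \<and> 1 * snd q > 0}" and "B = {q. cassini q = k \<and> - 1 * snd q > 0}"
  have inside: "p1 \<in> inside (insert (0, 0) A)" "p2 \<notin> inside (insert (0, 0) A)"
    "p2 \<in> inside (insert (0, 0) B)" "p1 \<notin> inside (insert (0, 0) B)" if "c = 0"
    using oval_inside[of 1 k "insert (0, 0) A"] oval_inside[of "-1" k "insert (0, 0) B"] that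
    by (auto simp: p A_def B_def)
  have inside': "p1 \<in> inside A" "p2 \<notin> inside A" "p2 \<in> inside B" "p1 \<notin> inside B" if "- 1 / 4 < c" "c < 0"
    using oval_inside[of 1 k A] oval_inside[of "-1" k B] that
    by (auto simp: p A_def B_def)
  have ovals: "\<exists>C1 C2. {C. repelling_limit_cycle f C} = {C1, C2} \<and>
      p1 \<in> inside C1 \<and> p2 \<notin> inside C1 \<and> p2 \<in> inside C2 \<and> p1 \<notin> inside C2" if "- 1 / 4 < c" "c < 0"
    using repelling_limit_cycles_small inside'[OF that] that unfolding A_def B_def
    by (intro exI conjI) auto
  have homoclinic: "\<exists>\<Gamma>1 \<Gamma>2. {\<Gamma>. homoclinic_orbit f (0, 0) \<Gamma>} = {\<Gamma>1, \<Gamma>2} \<and>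
      p1 \<in> inside (insert (0, 0) \<Gamma>1) \<and> p2 \<notin> inside (insert (0, 0) \<Gamma>1) \<and>
      p2 \<in> inside (insert (0, 0) \<Gamma>2) \<and> p1 \<notin> inside (insert (0, 0) \<Gamma>2)" if "c = 0"
    using homoclinic_orbits inside[OF that] that unfolding A_def B_def
    by (intro exI conjI) auto
  have loop: "\<exists>C. {C'. repelling_limit_cycle f C'} = {C} \<and> uminus ` C = C \<and> {(0, 0), p1, p2} \<subseteq> inside C" if "c > 0"
  proof -
    have k: "k > 1 / 4" using that by simp
    have "uminus ` {q. cassini q = k} = {q. cassini q = k}"
    proof (intro equalityI subsetI)
      fix q assume "q \<in> {q. cassini q = k}"
      then show "q \<in> uminus ` {q. cassini q = k}" by (intro image_eqI[of _ _ "- q"]) simp_all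
    next
      fix q assume "q \<in> uminus ` {q. cassini q = k}"
      then obtain r where "q = - r" "cassini r = k" by blast
      then show "q \<in> {q. cassini q = k}" by simp
    qed
    then show ?thesis
      using repelling_limit_cycles_large[OF k] loop_encloses[OF k] focal by blast
  qed
  show ?thesis
    unfolding Let_def p[symmetric]
    using fixed saddle_origin attracting_at_infinity unstable stable ovals homoclinic loop
    by (intro conjI impI) auto
qed

end
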